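(* Let $[\beta]:1\to A\to G\to Q\to 1$ be an extension of a finite group $Q$ by a finite abelian group $A$, and let $K_\beta=\{[\pi]\in H^1(Q,\check A)\ :\ [\beta]\cup[\pi]=0\in H^3(Q,\mathbb{C}^* )\}$. Then the homomorphisms $$C:K_\beta\to\ker(\mathrm{res}^G_A)/\mathrm{im}(\mathrm{inf}^Q_G),\quad [\pi]\mapsto[c_\pi]\bmod \mathrm{im}(\mathrm{inf}^Q_G),$$ and $$\Pi:\ker(\mathrm{res}^G_A)/\mathrm{im}(\mathrm{inf}^Q_G)\to K_\beta,\quad [c]\bmod\mathrm{im}(\mathrm{inf}^Q_G)\mapsto[\pi_c],$$ are mutually inverse.
   Context: All groups act trivially on $\mathbb{C}^*$. $\check{A}=\mathrm{Hom}(A,\mathbb{C}^* )$ is a $Q$-module via $\langle g(\chi),a\rangle=\langle\chi,g^{-1}(a)\rangle$, where $\langle\chi,a\rangle=\chi(a)$. Fix a transversal $\{\bar g\}_{g\in Q}$ of $Q$ in $G$ with $\bar 1=1$, so every element of $G$ is uniquely $a\bar g$ with $a\in A$, $g\in Q$; $\bar g a\bar g^{-1}=g(a)$ and $\bar g_1\bar g_2=\beta(g_1,g_2)\overline{g_1g_2}$, where $\beta$ is a normalized 2-cocycle. $[\beta]\cup[\pi]$ is represented by the 3-cocycle $(g_1,g_2,g_3)\mapsto\langle\pi(g_1),g_1(\beta(g_2,g_3))\rangle$. The maps $\mathrm{res}^G_A:H^2(G,\mathbb{C}^* )\to H^2(A,\mathbb{C}^* )$ and $\mathrm{inf}^Q_G:H^2(Q,\mathbb{C}^*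 )\to H^2(G,\mathbb{C}^* )$ are restriction and inflation. Definition of $c_\pi$: for $\pi\in Z^1(Q,\check A)$ with $[\pi]\in K_\beta$, choose $\zeta_\pi\in C^2(Q,\mathbb{C}^* )$ with $\delta_Q^2(\zeta_\pi)(g_1,g_2,g_3)=\langle\pi(g_1),g_1(\beta(g_2,g_3))\rangle$, where $\delta_Q^2(\zeta)(g_1,g_2,g_3)=\zeta(g_2,g_3)\zeta(g_1g_2,g_3)^{-1}\zeta(g_1,g_2g_3)\zeta(g_1,g_2)^{-1}$, and set $c_\pi(a_1\bar g_1,a_2\bar g_2)=\langle\pi(g_1),g_1(a_2)\rangle^{-1}\zeta_\pi(g_1,g_2)=\langle\pi(g_1^{-1}),a_2\rangle\zeta_\pi(g_1,g_2)$. This is a 2-cocycle on $G$, and $C$ is a well-defined homomorphism. Definition of $\pi_c$: every class in $\ker(\mathrm{res}^G_A)$ has a representative $c\in Z^2(G,\mathbb{C}^* )$ with $c(1,1)=1$ and $c(a\gamma_1,\gamma_2)=c(\gamma_1,\gamma_2)$ for all $\gamma_1,\gamma_2\in G$, $a\in A$. For such $c$, set $\pi_c(g)(a)=c(\overline{g^{-1}},a)$ for $g\in Q$, $a\in A$. Then $\pi_c\in Z^1(Q,\check A)$, and $\Pi$ is a well-defined homomorphism. *)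

theory Defs
  imports Complex_Main "HOL-Algebra.FiniteProduct" "HOL-Algebra.Product_Groups"
begin

section \<open>Group cohomology via the inhomogeneous bar complex\<close>

text \<open>
  Throughout, \<open>G\<close> is a group, \<open>M\<close> an abelian group (written multiplicatively) and
  \<open>act\<close> the action of \<open>G\<close> on \<open>M\<close>.  An \<open>n\<close>-cochain is a function on the lists of length \<open>n\<close>
  over \<open>carrier G\<close>, extended by \<open>undefined\<close> to all other lists, so that equality of cochains is
  equality of functions.
\<close>

definition tuples :: "nat \<Rightarrow> ('g, 'x) monoid_scheme \<Rightarrow> 'g list set" where
  "tuples n G = {xs \<in> lists (carrier G). length xs = n}"

definition cochains ::
  "nat \<Rightarrow> ('g, 'x) monoid_scheme \<Rightarrow> ('m, 'y) monoid_scheme \<Rightarrow> ('g list \<Rightarrow> 'm) monoid" where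
  "cochains n G M = product_group (tuples n G) (\<lambda>_. M)"

definition merge_at :: "('g, 'x) monoid_scheme \<Rightarrow> nat \<Rightarrow> 'g list \<Rightarrow> 'g list" where
  "merge_at G i xs = take i xs @ (xs ! i \<otimes>\<^bsub>G\<^esub> xs ! Suc i) # drop (i + 2) xs"

text \<open>The entries are numbered from 0, whence the sign \<open>(-1)^(i + 1)\<close> of the face that multiplies
  the entries \<open>i\<close> and \<open>i + 1\<close>.\<close>

definition coboundary ::
  "nat \<Rightarrow> ('g, 'x) monoid_scheme \<Rightarrow> ('m, 'y) monoid_scheme \<Rightarrow> ('g \<Rightarrow> 'm \<Rightarrow> 'm)
    \<Rightarrow> ('g list \<Rightarrow> 'm) \<Rightarrow> ('g list \<Rightarrow> 'm)" where
  "coboundary n G M act f = (\<lambda>xs \<in> tuples (Suc n) G.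
     act (hd xs) (f (tl xs))
     \<otimes>\<^bsub>M\<^esub> (\<Otimes>\<^bsub>M\<^esub>i\<in>{..<n}. f (merge_at G i xs) [^]\<^bsub>M\<^esub> ((-1) ^ (i + 1) :: int))
     \<otimes>\<^bsub>M\<^esub> f (butlast xs) [^]\<^bsub>M\<^esub> ((-1) ^ (n + 1) :: int))"

definition cocycles ::
  "nat \<Rightarrow> ('g, 'x) monoid_scheme \<Rightarrow> ('m, 'y) monoid_scheme \<Rightarrow> ('g \<Rightarrow> 'm \<Rightarrow> 'm)
    \<Rightarrow> ('g list \<Rightarrow> 'm) set" where
  "cocycles n G M act =
     kernel (cochains n G M) (cochains (Suc n) G M) (coboundary n G M act)"

definition coboundaries ::
  "nat \<Rightarrow> ('g, 'x) monoid_scheme \<Rightarrow> ('m, 'y) monoid_scheme \<Rightarrow> ('g \<Rightarrow> 'm \<Rightarrow> 'm)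
    \<Rightarrow> ('g list \<Rightarrow> 'm) set" where
  "coboundaries n G M act =
     (case n of 0 \<Rightarrow> {\<one>\<^bsub>cochains 0 G M\<^esub>}
      | Suc m \<Rightarrow> coboundary m G M act ` carrier (cochains m G M))"

definition cocycle_group ::
  "nat \<Rightarrow> ('g, 'x) monoid_scheme \<Rightarrow> ('m, 'y) monoid_scheme \<Rightarrow> ('g \<Rightarrow> 'm \<Rightarrow> 'm)
    \<Rightarrow> ('g list \<Rightarrow> 'm) monoid" where
  "cocycle_group n G M act = (cochains n G M)\<lparr>carrier := cocycles n G M act\<rparr>"

definition cohomology ::
  "nat \<Rightarrow> ('g, 'x) monoid_scheme \<Rightarrow> ('m, 'y) monoid_scheme \<Rightarrow> ('g \<Rightarrow> 'm \<Rightarrow> 'm)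
    \<Rightarrow> ('g list \<Rightarrow> 'm) set monoid" where
  "cohomology n G M act = cocycle_group n G M act Mod coboundaries n G M act"

definition coclass ::
  "nat \<Rightarrow> ('g, 'x) monoid_scheme \<Rightarrow> ('m, 'y) monoid_scheme \<Rightarrow> ('g \<Rightarrow> 'm \<Rightarrow> 'm)
    \<Rightarrow> ('g list \<Rightarrow> 'm) \<Rightarrow> ('g list \<Rightarrow> 'm) set" where
  "coclass n G M act c = coboundaries n G M act #>\<^bsub>cocycle_group n G M act\<^esub> c"

text \<open>
  The map \<open>H\<^sup>n(G, M) \<rightarrow> H\<^sup>n(H, M)\<close> induced by a homomorphism \<open>f\<close> from \<open>H\<close> to \<open>G\<close>: restriction if
  \<open>f\<close> is the inclusion of a subgroup, inflation if \<open>f\<close> is the projection onto a quotient.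
  As the classes of all the pulled-back representatives coincide, their common value is
  extracted with \<open>the_elem\<close>.
\<close>

definition pullback ::
  "nat \<Rightarrow> ('h, 'z) monoid_scheme \<Rightarrow> ('h \<Rightarrow> 'g) \<Rightarrow> ('g list \<Rightarrow> 'm) \<Rightarrow> ('h list \<Rightarrow> 'm)" where
  "pullback n H f c = (\<lambda>xs \<in> tuples n H. c (map f xs))"

definition cohomology_map ::
  "nat \<Rightarrow> ('h, 'z) monoid_scheme \<Rightarrow> ('h \<Rightarrow> 'g) \<Rightarrow> ('m, 'y) monoid_scheme \<Rightarrow> ('g \<Rightarrow> 'm \<Rightarrow> 'm)
    \<Rightarrow> ('g list \<Rightarrow> 'm) set \<Rightarrow> ('h list \<Rightarrow> 'm) set" where
  "cohomology_map n H f M act U =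
     the_elem ((\<lambda>c. coclass n H M (\<lambda>h. act (f h)) (pullback n H f c)) ` U)"


section \<open>Coefficient modules\<close>

definition Cstar :: "complex monoid" where
  "Cstar = \<lparr>carrier = - {0}, mult = (*), one = 1\<rparr>"

definition trivial_action :: "'g \<Rightarrow> 'm \<Rightarrow> 'm" where
  "trivial_action g m = m"

definition dual :: "('a, 'x) monoid_scheme \<Rightarrow> ('a \<Rightarrow> complex) monoid" where
  "dual A = \<lparr>carrier = hom A Cstar \<inter> extensional (carrier A),
     mult = (\<lambda>\<chi> \<psi>. \<lambda>a \<in> carrier A. \<chi> a * \<psi> a),
     one = (\<lambda>a \<in> carrier A. 1)\<rparr>"

definition dual_action ::
  "('a, 'x) monoid_scheme \<Rightarrow> ('g, 'y) monoid_scheme \<Rightarrow> ('g \<Rightarrow> 'a \<Rightarrow> 'a)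
    \<Rightarrow> 'g \<Rightarrow> ('a \<Rightarrow> complex) \<Rightarrow> ('a \<Rightarrow> complex)" where
  "dual_action A Q act g \<chi> = (\<lambda>a \<in> carrier A. \<chi> (act (inv\<^bsub>Q\<^esub> g) a))"

lemma group_Cstar: "comm_group Cstar"
proof (rule comm_groupI)
  fix x assume "x \<in> carrier Cstar"
  then show "\<exists>y \<in> carrier Cstar. y \<otimes>\<^bsub>Cstar\<^esub> x = \<one>\<^bsub>Cstar\<^esub>"
    by (intro bexI[of _ "inverse x"]) (auto simp: Cstar_def)
qed (auto simp: Cstar_def)

lemma inv_Cstar: "x \<in> carrier Cstar \<Longrightarrow> inv\<^bsub>Cstar\<^esub> x = inverse x"
proof -
  assume x: "x \<in> carrier Cstar"
  interpret comm_group Cstar by (rule group_Cstar)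
  show ?thesis
    by (rule inv_equality) (use x in \<open>auto simp: Cstar_def\<close>)
qed

lemma coboundary_2_Cstar:
  assumes "group G" and \<zeta>: "\<zeta> \<in> carrier (cochains 2 G Cstar)"
    and x: "x \<in> carrier G" and y: "y \<in> carrier G" and z: "z \<in> carrier G"
  shows "coboundary 2 G Cstar trivial_action \<zeta> [x, y, z] =
    \<zeta> [y, z] * inverse (\<zeta> [x \<otimes>\<^bsub>G\<^esub> y, z]) * \<zeta> [x, y \<otimes>\<^bsub>G\<^esub> z] * inverse (\<zeta> [x, y])"
proof -
  interpret G: group G by fact
  interpret C: comm_group Cstar by (rule group_Cstar)
  have cl: "\<zeta> [u, v] \<in> carrier Cstar" if "u \<in> carrier G" "v \<in> carrier G" for u v
    using \<zeta> that by (auto simp: cochains_def tuples_def PiE_def Pi_def)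
  have m0: "merge_at G 0 [x, y, z] = [x \<otimes>\<^bsub>G\<^esub> y, z]"
    and m1: "merge_at G (Suc 0) [x, y, z] = [x, y \<otimes>\<^bsub>G\<^esub> z]"
    by (simp_all add: merge_at_def)
  have i: "a [^]\<^bsub>Cstar\<^esub> (-1 :: int) = inverse a" if "a \<in> carrier Cstar" for a
    using that by (simp add: C.int_pow_neg inv_Cstar)
  have ic: "inverse a \<in> carrier Cstar" if "a \<in> carrier Cstar" for a
    using that by (auto simp: Cstar_def)
  have s: "{..<2::nat} = {0, Suc 0}" by auto
  have "[x, y, z] \<in> tuples (Suc 2) G" using x y z by (simp add: tuples_def)
  then have "coboundary 2 G Cstar trivial_action \<zeta> [x, y, z] = \<zeta> [y, z] \<otimes>\<^bsub>Cstar\<^esub>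
      (inverse (\<zeta> [x \<otimes>\<^bsub>G\<^esub> y, z]) \<otimes>\<^bsub>Cstar\<^esub> \<zeta> [x, y \<otimes>\<^bsub>G\<^esub> z]) \<otimes>\<^bsub>Cstar\<^esub> inverse (\<zeta> [x, y])"
    using x y z by (simp add: coboundary_def s m0 m1 i ic cl trivial_action_def)
  then show ?thesis by (simp add: Cstar_def mult.assoc)
qed


section \<open>Extensions with a normalized transversal\<close>

text \<open>
  An extension of the finite group \<open>Q\<close> by the finite abelian group \<open>A\<close>, given by its inclusion
  \<open>\<iota>\<close> and projection \<open>p\<close>, together with a transversal \<open>s\<close>, where \<open>s g\<close> is the element
  written as \<open>g\<close> with a bar above.
\<close>

locale abelian_extension =
  A: comm_group A + G: group G + Q: group Q
  for A :: "'a monoid" and G :: "'g monoid" and Q :: "'q monoid" +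
  fixes \<iota> :: "'a \<Rightarrow> 'g" and p :: "'g \<Rightarrow> 'q" and s :: "'q \<Rightarrow> 'g"
  assumes finite_A: "finite (carrier A)"
    and finite_Q: "finite (carrier Q)"
    and \<iota>_hom: "\<iota> \<in> hom A G"
    and \<iota>_inj: "inj_on \<iota> (carrier A)"
    and p_hom: "p \<in> hom G Q"
    and p_surj: "p ` carrier G = carrier Q"
    and exact: "\<iota> ` carrier A = kernel G Q p"
    and s_closed: "g \<in> carrier Q \<Longrightarrow> s g \<in> carrier G"
    and p_s: "g \<in> carrier Q \<Longrightarrow> p (s g) = g"
    and s_one: "s \<one>\<^bsub>Q\<^esub> = \<one>\<^bsub>G\<^esub>"
begin

text \<open>\<open>\<gamma> = \<iota> (A_part \<gamma>) \<otimes> s (p \<gamma>)\<close> is the decomposition of \<open>\<gamma>\<close> with respect to the transversal.\<close>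

definition A_part :: "'g \<Rightarrow> 'a" where
  "A_part \<gamma> = the_inv_into (carrier A) \<iota> (\<gamma> \<otimes>\<^bsub>G\<^esub> inv\<^bsub>G\<^esub> (s (p \<gamma>)))"

definition act :: "'q \<Rightarrow> 'a \<Rightarrow> 'a" where
  "act g a = the_inv_into (carrier A) \<iota> (s g \<otimes>\<^bsub>G\<^esub> \<iota> a \<otimes>\<^bsub>G\<^esub> inv\<^bsub>G\<^esub> (s g))"

definition \<beta> :: "'q list \<Rightarrow> 'a" where
  "\<beta> = (\<lambda>xs \<in> tuples 2 Q. the_inv_into (carrier A) \<iota>
     (s (xs ! 0) \<otimes>\<^bsub>G\<^esub> s (xs ! 1) \<otimes>\<^bsub>G\<^esub> inv\<^bsub>G\<^esub> (s (xs ! 0 \<otimes>\<^bsub>Q\<^esub> xs ! 1))))"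

abbreviation dual_act :: "'q \<Rightarrow> ('a \<Rightarrow> complex) \<Rightarrow> ('a \<Rightarrow> complex)" where
  "dual_act \<equiv> dual_action A Q act"

definition H1_dual :: "('q list \<Rightarrow> 'a \<Rightarrow> complex) set monoid" where
  "H1_dual = cohomology 1 Q (dual A) dual_act"

definition Z1_dual :: "('q list \<Rightarrow> 'a \<Rightarrow> complex) set" where
  "Z1_dual = cocycles 1 Q (dual A) dual_act"

definition class1 :: "('q list \<Rightarrow> 'a \<Rightarrow> complex) \<Rightarrow> ('q list \<Rightarrow> 'a \<Rightarrow> complex) set" where
  "class1 \<pi> = coclass 1 Q (dual A) dual_act \<pi>"

text \<open>The cup product \<open>H\<^sup>2(Q, A) \<times> H\<^sup>1(Q, A\<^sup>*) \<rightarrow> H\<^sup>3(Q, C\<^sup>*)\<close> induced by evaluation of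
  characters.  Exchanging the factors costs no sign, as one of the degrees is even, so the
  representative with the character in front is used.\<close>

definition cup_cochain ::
  "('q list \<Rightarrow> 'a) \<Rightarrow> ('q list \<Rightarrow> 'a \<Rightarrow> complex) \<Rightarrow> ('q list \<Rightarrow> complex)" where
  "cup_cochain b \<pi> = (\<lambda>xs \<in> tuples 3 Q. \<pi> [xs ! 0] (act (xs ! 0) (b [xs ! 1, xs ! 2])))"

definition cup ::
  "('q list \<Rightarrow> 'a) set \<Rightarrow> ('q list \<Rightarrow> 'a \<Rightarrow> complex) set \<Rightarrow> ('q list \<Rightarrow> complex) set" where
  "cup V U = the_elem {coclass 3 Q Cstar trivial_action (cup_cochain b \<pi>) | b \<pi>.
     b \<in> cocycles 2 Q A act \<and> coclass 2 Q A act b = V \<and> \<pi> \<in> Z1_dual \<and> class1 \<pi> = U}"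

definition K\<beta> :: "('q list \<Rightarrow> 'a \<Rightarrow> complex) set monoid" where
  "K\<beta> = H1_dual\<lparr>carrier := {U \<in> carrier H1_dual.
     cup (coclass 2 Q A act \<beta>) U = \<one>\<^bsub>cohomology 3 Q Cstar trivial_action\<^esub>}\<rparr>"

definition H2_G :: "('g list \<Rightarrow> complex) set monoid" where
  "H2_G = cohomology 2 G Cstar trivial_action"

definition Z2_G :: "('g list \<Rightarrow> complex) set" where
  "Z2_G = cocycles 2 G Cstar trivial_action"

definition class2 :: "('g list \<Rightarrow> complex) \<Rightarrow> ('g list \<Rightarrow> complex) set" where
  "class2 c = coclass 2 G Cstar trivial_action c"

definition res :: "('g list \<Rightarrow> complex) set \<Rightarrow> ('a list \<Rightarrow> complex) set" where
  "res = cohomology_map 2 A \<iota> Cstar trivial_action"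

definition infl :: "('q list \<Rightarrow> complex) set \<Rightarrow> ('g list \<Rightarrow> complex) set" where
  "infl = cohomology_map 2 G p Cstar trivial_action"

definition ker_res :: "('g list \<Rightarrow> complex) set set" where
  "ker_res = kernel H2_G (cohomology 2 A Cstar trivial_action) res"

definition im_inf :: "('g list \<Rightarrow> complex) set set" where
  "im_inf = infl ` carrier (cohomology 2 Q Cstar trivial_action)"

definition ker_res_mod_im_inf :: "('g list \<Rightarrow> complex) set set monoid" where
  "ker_res_mod_im_inf = H2_G\<lparr>carrier := ker_res\<rparr> Mod im_inf"

definition mod_im_inf :: "('g list \<Rightarrow> complex) set \<Rightarrow> ('g list \<Rightarrow> complex) set set" where
  "mod_im_inf U = im_inf #>\<^bsub>H2_G\<lparr>carrier := ker_res\<rparr>\<^esub> U"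

text \<open>The possible choices of \<open>\<zeta>\<^sub>\<pi>\<close>.\<close>

definition admissible_\<zeta> :: "('q list \<Rightarrow> 'a \<Rightarrow> complex) \<Rightarrow> ('q list \<Rightarrow> complex) set" where
  "admissible_\<zeta> \<pi> = {\<zeta> \<in> carrier (cochains 2 Q Cstar).
     coboundary 2 Q Cstar trivial_action \<zeta> = cup_cochain \<beta> \<pi>}"

definition c\<pi> ::
  "('q list \<Rightarrow> 'a \<Rightarrow> complex) \<Rightarrow> ('q list \<Rightarrow> complex) \<Rightarrow> ('g list \<Rightarrow> complex)" where
  "c\<pi> \<pi> \<zeta> = (\<lambda>xs \<in> tuples 2 G.
     inverse (\<pi> [p (xs ! 0)] (act (p (xs ! 0)) (A_part (xs ! 1)))) * \<zeta> [p (xs ! 0), p (xs ! 1)])"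

definition C_map ::
  "('q list \<Rightarrow> 'a \<Rightarrow> complex) set \<Rightarrow> ('g list \<Rightarrow> complex) set set" where
  "C_map U = the_elem {mod_im_inf (class2 (c\<pi> \<pi> \<zeta>)) | \<pi> \<zeta>.
     \<pi> \<in> Z1_dual \<and> class1 \<pi> = U \<and> \<zeta> \<in> admissible_\<zeta> \<pi>}"

text \<open>The normalization of 2-cocycles on \<open>G\<close> needed for the definition of \<open>\<pi>c\<close>.\<close>

definition A_normalized :: "('g list \<Rightarrow> complex) set" where
  "A_normalized = {c \<in> Z2_G. c [\<one>\<^bsub>G\<^esub>, \<one>\<^bsub>G\<^esub>] = 1 \<and>
     (\<forall>a \<in> carrier A. \<forall>\<gamma>\<^sub>1 \<in> carrier G. \<forall>\<gamma>\<^sub>2 \<in> carrier G.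
        c [\<iota> a \<otimes>\<^bsub>G\<^esub> \<gamma>\<^sub>1, \<gamma>\<^sub>2] = c [\<gamma>\<^sub>1, \<gamma>\<^sub>2])}"

definition \<pi>c :: "('g list \<Rightarrow> complex) \<Rightarrow> ('q list \<Rightarrow> 'a \<Rightarrow> complex)" where
  "\<pi>c c = (\<lambda>xs \<in> tuples 1 Q. \<lambda>a \<in> carrier A. c [s (inv\<^bsub>Q\<^esub> (xs ! 0)), \<iota> a])"

definition Pi_map ::
  "('g list \<Rightarrow> complex) set set \<Rightarrow> ('q list \<Rightarrow> 'a \<Rightarrow> complex) set" where
  "Pi_map V = the_elem {class1 (\<pi>c c) | c.
     c \<in> A_normalized \<and> class2 c \<in> ker_res \<and> mod_im_inf (class2 c) = V}"

text \<open>The values of \<open>C_map\<close> and \<open>Pi_map\<close> do not depend on the choices in their definitions,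
  choices are always possible, and the values lie in the respective targets.\<close>

definition C_map_well_defined :: bool where
  "C_map_well_defined \<longleftrightarrow>
     (\<forall>\<pi> \<in> Z1_dual. class1 \<pi> \<in> carrier K\<beta> \<longrightarrow>
        admissible_\<zeta> \<pi> \<noteq> {} \<and>
        (\<forall>\<zeta> \<in> admissible_\<zeta> \<pi>. c\<pi> \<pi> \<zeta> \<in> Z2_G \<and> class2 (c\<pi> \<pi> \<zeta>) \<in> ker_res \<and>
           C_map (class1 \<pi>) = mod_im_inf (class2 (c\<pi> \<pi> \<zeta>))))"

definition Pi_map_well_defined :: bool where
  "Pi_map_well_defined \<longleftrightarrow>
     (\<forall>U \<in> ker_res. \<exists>c \<in> A_normalized. class2 c = U) \<and>
     (\<forall>c \<in> A_normalized. class2 c \<in> ker_res \<longrightarrow>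
        \<pi>c c \<in> Z1_dual \<and> class1 (\<pi>c c) \<in> carrier K\<beta> \<and>
        Pi_map (mod_im_inf (class2 c)) = class1 (\<pi>c c))"

end

end

theory Submission
  imports Defs
begin

text \<open>
  For a 1-cocycle \<open>\<pi>\<close> and a 2-cochain \<open>\<zeta>\<close> on \<open>Q\<close>, the cochain \<open>c\<pi> \<pi> \<zeta>\<close> is a cocycle on \<open>G\<close>
  exactly when the coboundary of \<open>\<zeta>\<close> is the cup product of \<open>\<pi>\<close> with \<open>\<beta>\<close>.  Changing \<open>\<pi>\<close> by the
  coboundary of a character \<open>\<chi>\<close> changes \<open>c\<pi> \<pi> \<zeta>\<close> by the coboundary of \<open>inverse (\<chi> \<circ> A_part)\<close> and
  an inflated cocycle.

  Conversely, a cocycle \<open>c\<close> that is invariant under \<open>A\<close> in the first argument satisfies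
  \<open>c [x, y] = c [s (p x), \<iota> (A_part y)] * c [s (p x), s (p y)]\<close>.  This says that \<open>c\<close> is
  \<open>c\<pi> (\<pi>c c) \<zeta>\<close> for \<open>\<zeta> [g, h] = c [s g, s h]\<close>, so both composites are the identity on
  representatives, and \<open>\<Pi>\<close> is a homomorphism because its inverse \<open>C\<close> is one.
\<close>

section \<open>Cohomology groups in low degrees\<close>

text \<open>Left invariance makes \<open>c [x, \<iota> a]\<close>, as a function of
  \<open>a\<close>, a character of \<open>A\<close> that depends on \<open>p x\<close> only. The
  cocycle identity makes this family a crossed homomorphism with its factors in reverse order; hence
  the argument \<open>s (inv g)\<close> in \<open>\<pi>c\<close> and the inverse of a value of
  \<open>\<pi>\<close> in \<open>c\<pi>\<close>. The rest of \<open>c\<close> lives on the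
  transversal, where it need not be a cocycle on \<open>Q\<close>: \<open>s\<close> fails to be a
  homomorphism by \<open>\<beta>\<close>, and the cup product measures the effect. As the cocycle
  criterion for \<open>c\<pi> \<pi> \<zeta>\<close> is an equivalence, \<Pi> lands in
  \<open>K\<beta>\<close> without a separate computation with \<open>\<beta>\<close>. The main
  burden is choice: both maps are defined through \<open>the_elem\<close>, so all admissible choices
  must be shown to agree. In one direction \<open>A_part\<close> turns a character of
  \<open>A\<close> into a function on \<open>G\<close>. In the other, the function on
  \<open>G\<close> that links two normalized cocycles restricts to a character of \<open>A\<close>,
  up to a constant that comes from inflated cocycles with \<open>w [1, 1]\<close> different from
  1.\<close>

lemma tuples_1E: "xs \<in> tuples (Suc 0) G \<Longrightarrow> (\<And>x. x \<in> carrier G \<Longrightarrow> xs = [x] \<Longrightarrow> P) \<Longrightarrow> P"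
  by (auto simp: tuples_def length_Suc_conv)

lemma tuples_2E:
  "xs \<in> tuples 2 G \<Longrightarrow> (\<And>x y. x \<in> carrier G \<Longrightarrow> y \<in> carrier G \<Longrightarrow> xs = [x, y] \<Longrightarrow> P) \<Longrightarrow> P"
  by (auto simp: tuples_def numeral_2_eq_2 length_Suc_conv)

lemma tuples_3E:
  "xs \<in> tuples 3 G \<Longrightarrow>
    (\<And>x y z. x \<in> carrier G \<Longrightarrow> y \<in> carrier G \<Longrightarrow> z \<in> carrier G \<Longrightarrow> xs = [x, y, z] \<Longrightarrow> P) \<Longrightarrow> P"
  by (auto simp: tuples_def numeral_3_eq_3 length_Suc_conv)

lemma Nil_in_tuples [simp]: "[] \<in> tuples 0 G"
  and tuples_1_iff [simp]: "[x] \<in> tuples (Suc 0) G \<longleftrightarrow> x \<in> carrier G"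
  and tuples_2_iff [simp]: "[x, y] \<in> tuples 2 G \<longleftrightarrow> x \<in> carrier G \<and> y \<in> carrier G"
  and tuples_3_iff [simp]:
    "[x, y, z] \<in> tuples 3 G \<longleftrightarrow> x \<in> carrier G \<and> y \<in> carrier G \<and> z \<in> carrier G"
  by (auto simp: tuples_def)

section \<open>Cochains as a pointwise product group\<close>

lemma carrier_cochains: "carrier (cochains n G M) = tuples n G \<rightarrow>\<^sub>E carrier M"
  by (simp add: cochains_def)

lemma mult_cochains: "f \<otimes>\<^bsub>cochains n G M\<^esub> g = (\<lambda>xs \<in> tuples n G. f xs \<otimes>\<^bsub>M\<^esub> g xs)"
  by (simp add: cochains_def)

lemma one_cochains: "\<one>\<^bsub>cochains n G M\<^esub> = (\<lambda>xs \<in> tuples n G. \<one>\<^bsub>M\<^esub>)"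
  by (simp add: cochains_def)

lemma cochain_closed: "f \<in> carrier (cochains n G M) \<Longrightarrow> xs \<in> tuples n G \<Longrightarrow> f xs \<in> carrier M"
  by (auto simp: carrier_cochains)

lemma cochain_eqI:
  assumes "f \<in> carrier (cochains n G M)" "g \<in> carrier (cochains n G M)"
    and "\<And>xs. xs \<in> tuples n G \<Longrightarrow> f xs = g xs"
  shows "f = g"
  using assms by (auto simp: carrier_cochains intro: PiE_ext)

lemma comm_group_cochains: "comm_group M \<Longrightarrow> comm_group (cochains n G M)"
proof -
  assume "comm_group M"
  then interpret comm_group M .
  show ?thesis
    unfolding cochains_def
    by (rule group.group_comm_groupI)
      (auto simp: m_comm PiE_iff intro!: restrict_ext product_group is_group)
qed

lemma inv_cochains:
  assumes "group M" "f \<in> carrier (cochains n G M)"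
  shows "inv\<^bsub>cochains n G M\<^esub> f = (\<lambda>xs \<in> tuples n G. inv\<^bsub>M\<^esub> (f xs))"
  unfolding cochains_def
  by (rule inv_product_group) (use assms in \<open>simp_all add: carrier_cochains\<close>)

lemma comm_group_subgroup:
  assumes "comm_group N" "subgroup H N"
  shows "comm_group (N\<lparr>carrier := H\<rparr>)"
proof -
  interpret N: comm_group N by fact
  interpret H: subgroup H N by fact
  show ?thesis
    by (intro group.group_comm_groupI H.subgroup_is_group) (auto simp: N.m_comm N.is_group)
qed

text \<open>One interface for all coefficient systems of the theorem: \<open>Q\<close> acting on
  \<open>A\<close> and on \<open>dual A\<close>, and \<open>A\<close>, \<open>Q\<close> and
  \<open>G\<close> acting trivially on \<open>Cstar\<close>.\<close>

locale group_module = G: group G + M: comm_group M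
  for G :: "('g, 'x) monoid_scheme" and M :: "('m, 'y) monoid_scheme" +
  fixes act :: "'g \<Rightarrow> 'm \<Rightarrow> 'm"
  assumes act_hom: "g \<in> carrier G \<Longrightarrow> act g \<in> hom M M"
    and act_mult: "\<lbrakk>g \<in> carrier G; h \<in> carrier G; m \<in> carrier M\<rbrakk> \<Longrightarrow>
      act (g \<otimes>\<^bsub>G\<^esub> h) m = act g (act h m)"
begin

lemma act_closed [simp]: "g \<in> carrier G \<Longrightarrow> m \<in> carrier M \<Longrightarrow> act g m \<in> carrier M"
  using act_hom by (auto simp: hom_def)

lemma act_distrib:
  "g \<in> carrier G \<Longrightarrow> m \<in> carrier M \<Longrightarrow> m' \<in> carrier M \<Longrightarrow>
    act g (m \<otimes>\<^bsub>M\<^esub> m') = act g m \<otimes>\<^bsub>M\<^esub> act g m'"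
  using act_hom by (auto simp: hom_def)

lemma act_inv: "g \<in> carrier G \<Longrightarrow> m \<in> carrier M \<Longrightarrow> act g (inv\<^bsub>M\<^esub> m) = inv\<^bsub>M\<^esub> (act g m)"
  using group_hom.hom_inv[of M M "act g" m] act_hom
  by (simp add: group_hom_def group_hom_axioms_def)

lemma faces_in_tuples:
  assumes "xs \<in> tuples (Suc n) G"
  shows "hd xs \<in> carrier G" "tl xs \<in> tuples n G" "butlast xs \<in> tuples n G"
    and "i < n \<Longrightarrow> merge_at G i xs \<in> tuples n G"
proof -
  have "set (take i xs) \<subseteq> carrier G" "set (drop (i + 2) xs) \<subseteq> carrier G"
    using assms set_take_subset[of i xs] set_drop_subset[of "i + 2" xs]
    by (auto simp: tuples_def)
  then show "i < n \<Longrightarrow> merge_at G i xs \<in> tuples n G"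
    using assms by (auto simp: tuples_def merge_at_def in_lists_conv_set)
  show "hd xs \<in> carrier G" "tl xs \<in> tuples n G"
    using assms by (cases xs; simp add: tuples_def)+
  show "butlast xs \<in> tuples n G"
    using assms by (auto simp: tuples_def in_lists_conv_set dest: in_set_butlastD)
qed

text \<open>Each of the three factors of the differential is multiplicative in the cochain, and
  commutativity of \<open>M\<close> allows regrouping. This is what makes kernels and images of
  differentials subgroups in every degree.\<close>

lemma coboundary_hom: "coboundary n G M act \<in> hom (cochains n G M) (cochains (Suc n) G M)"
proof (rule homI)
  note f_t = faces_in_tuples
  fix f assume f: "f \<in> carrier (cochains n G M)"
  then show "coboundary n G M act f \<in> carrier (cochains (Suc n) G M)"
    unfolding carrier_cochains[of "Suc n"] coboundary_def
    by (intro restrict_PiE_iff[THEN iffD2] ballI M.m_closed M.int_pow_closed M.finprod_closed Pi_I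
        act_closed cochain_closed[OF f] f_t) auto
  fix g assume g: "g \<in> carrier (cochains n G M)"
  have "act (hd xs) ((f \<otimes>\<^bsub>cochains n G M\<^esub> g) (tl xs))
     \<otimes>\<^bsub>M\<^esub> (\<Otimes>\<^bsub>M\<^esub>i\<in>{..<n}. (f \<otimes>\<^bsub>cochains n G M\<^esub> g) (merge_at G i xs) [^]\<^bsub>M\<^esub> ((-1) ^ (i + 1) :: int))
     \<otimes>\<^bsub>M\<^esub> (f \<otimes>\<^bsub>cochains n G M\<^esub> g) (butlast xs) [^]\<^bsub>M\<^esub> ((-1) ^ (n + 1) :: int) =
     (act (hd xs) (f (tl xs))
     \<otimes>\<^bsub>M\<^esub> (\<Otimes>\<^bsub>M\<^esub>i\<in>{..<n}. f (merge_at G i xs) [^]\<^bsub>M\<^esub> ((-1) ^ (i + 1) :: int))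
     \<otimes>\<^bsub>M\<^esub> f (butlast xs) [^]\<^bsub>M\<^esub> ((-1) ^ (n + 1) :: int)) \<otimes>\<^bsub>M\<^esub>
     (act (hd xs) (g (tl xs))
     \<otimes>\<^bsub>M\<^esub> (\<Otimes>\<^bsub>M\<^esub>i\<in>{..<n}. g (merge_at G i xs) [^]\<^bsub>M\<^esub> ((-1) ^ (i + 1) :: int))
     \<otimes>\<^bsub>M\<^esub> g (butlast xs) [^]\<^bsub>M\<^esub> ((-1) ^ (n + 1) :: int))"
    (is "?a \<otimes>\<^bsub>M\<^esub> ?b \<otimes>\<^bsub>M\<^esub> ?c = (?a1 \<otimes>\<^bsub>M\<^esub> ?b1 \<otimes>\<^bsub>M\<^esub> ?c1) \<otimes>\<^bsub>M\<^esub> (?a2 \<otimes>\<^bsub>M\<^esub> ?b2 \<otimes>\<^bsub>M\<^esub> ?c2)")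
    if xs: "xs \<in> tuples (Suc n) G" for xs
  proof -
    note cl = cochain_closed[OF f] cochain_closed[OF g] f_t[OF xs]
    have "?a = ?a1 \<otimes>\<^bsub>M\<^esub> ?a2"
      using cl by (simp add: mult_cochains act_distrib)
    moreover have "?c = ?c1 \<otimes>\<^bsub>M\<^esub> ?c2"
      using cl by (simp add: mult_cochains M.int_pow_distrib)
    moreover have "?b = (\<Otimes>\<^bsub>M\<^esub>i\<in>{..<n}. f (merge_at G i xs) [^]\<^bsub>M\<^esub> ((-1) ^ (i + 1) :: int)
        \<otimes>\<^bsub>M\<^esub> g (merge_at G i xs) [^]\<^bsub>M\<^esub> ((-1) ^ (i + 1) :: int))"
      using cl by (intro M.finprod_cong) (auto simp: mult_cochains M.int_pow_distrib)
    then have "?b = ?b1 \<otimes>\<^bsub>M\<^esub> ?b2"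
      using cl by (subst (asm) M.finprod_multf) auto
    moreover have "?a1 \<in> carrier M" "?b1 \<in> carrier M" "?c1 \<in> carrier M"
      "?a2 \<in> carrier M" "?b2 \<in> carrier M" "?c2 \<in> carrier M"
      using cl by (auto intro!: M.finprod_closed)
    ultimately show ?thesis
      by (simp only: M.m_ac M.m_closed)
  qed
  then show "coboundary n G M act (f \<otimes>\<^bsub>cochains n G M\<^esub> g) =
      coboundary n G M act f \<otimes>\<^bsub>cochains (Suc n) G M\<^esub> coboundary n G M act g"
    unfolding mult_cochains[of "Suc n"]
    by (intro ext) (auto simp only: coboundary_def restrict_def split: if_splits)
qed

lemma cochains_comm_group: "comm_group (cochains n G M)"
  by (rule comm_group_cochains) (rule M.comm_group_axioms)

lemma group_hom_coboundary:
  "group_hom (cochains n G M) (cochains (Suc n) G M) (coboundary n G M act)"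
  using cochains_comm_group coboundary_hom
  by (simp add: group_hom_def group_hom_axioms_def comm_group_def)

lemma coboundary_closed:
  "f \<in> carrier (cochains n G M) \<Longrightarrow> coboundary n G M act f \<in> carrier (cochains (Suc n) G M)"
  using coboundary_hom by (auto simp: hom_def)

lemma coboundary_0:
  assumes "f \<in> carrier (cochains 0 G M)" "x \<in> carrier G"
  shows "coboundary 0 G M act f [x] = act x (f []) \<otimes>\<^bsub>M\<^esub> inv\<^bsub>M\<^esub> (f [])"
  using assms cochain_closed[OF assms(1)]
  by (simp add: coboundary_def M.int_pow_neg)

lemma coboundary_1:
  assumes "f \<in> carrier (cochains 1 G M)" "x \<in> carrier G" "y \<in> carrier G"
  shows "coboundary 1 G M act f [x, y] =
    act x (f [y]) \<otimes>\<^bsub>M\<^esub> inv\<^bsub>M\<^esub> (f [x \<otimes>\<^bsub>G\<^esub> y]) \<otimes>\<^bsub>M\<^esub> f [x]"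
proof -
  have "{..<1::nat} = {0}" by auto
  moreover have "[x, y] \<in> tuples (Suc 1) G" using assms by (simp add: tuples_def)
  ultimately show ?thesis
    using assms cochain_closed[OF assms(1)]
    by (simp add: coboundary_def M.int_pow_neg merge_at_def)
qed

lemma coboundary_2:
  assumes "f \<in> carrier (cochains 2 G M)" "x \<in> carrier G" "y \<in> carrier G" "z \<in> carrier G"
  shows "coboundary 2 G M act f [x, y, z] = act x (f [y, z]) \<otimes>\<^bsub>M\<^esub>
    (inv\<^bsub>M\<^esub> (f [x \<otimes>\<^bsub>G\<^esub> y, z]) \<otimes>\<^bsub>M\<^esub> f [x, y \<otimes>\<^bsub>G\<^esub> z]) \<otimes>\<^bsub>M\<^esub> inv\<^bsub>M\<^esub> (f [x, y])"
proof -
  have "{..<2::nat} = {0, Suc 0}" by auto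
  moreover have "[x, y, z] \<in> tuples (Suc 2) G" using assms by (simp add: tuples_def)
  ultimately show ?thesis
    using assms cochain_closed[OF assms(1)]
    by (simp add: coboundary_def M.int_pow_neg merge_at_def)
qed

section \<open>Cocycles, coboundaries and their cosets\<close>

lemma subgroup_cocycles: "subgroup (cocycles n G M act) (cochains n G M)"
  unfolding cocycles_def by (rule group_hom.subgroup_kernel[OF group_hom_coboundary])

lemma subgroup_coboundaries: "subgroup (coboundaries n G M act) (cochains n G M)"
proof (cases n)
  case 0
  interpret C: comm_group "cochains 0 G M" by (rule cochains_comm_group)
  show ?thesis using 0 C.triv_subgroup by (simp add: coboundaries_def)
next
  case (Suc m)
  interpret C: comm_group "cochains m G M" by (rule cochains_comm_group)
  show ?thesis
    using group_hom.subgroup_img_is_subgroup[OF group_hom_coboundary[of m] C.subgroup_self] Suc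
    by (simp add: coboundaries_def)
qed

lemma cocycles_closed: "c \<in> cocycles n G M act \<Longrightarrow> c \<in> carrier (cochains n G M)"
  by (simp add: cocycles_def kernel_def)

text \<open>A coset depends only on the multiplication, which the cocycle group inherits from the
  cochains. Coset arguments thus apply to arbitrary cochains, in particular to cup products in
  degree 3, for which only membership in the cochain group is established.\<close>

lemma coclass_conv: "coclass n G M act c = coboundaries n G M act #>\<^bsub>cochains n G M\<^esub> c"
  by (simp add: coclass_def cocycle_group_def r_coset_def)

lemma coclass_self: "c \<in> carrier (cochains n G M) \<Longrightarrow> c \<in> coclass n G M act c"
  unfolding coclass_conv
  by (rule group.rcos_self) (use cochains_comm_group subgroup_coboundaries in \<open>auto simp: comm_group_def\<close>)

lemma coclass_mult_coboundary:
  assumes "c \<in> carrier (cochains n G M)" "b \<in> coboundaries n G M act"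
  shows "coclass n G M act (b \<otimes>\<^bsub>cochains n G M\<^esub> c) = coclass n G M act c"
proof -
  interpret C: comm_group "cochains n G M" by (rule cochains_comm_group)
  note sub = subgroup_coboundaries[of n]
  show ?thesis
    unfolding coclass_conv
    by (rule C.repr_independence[symmetric])
      (use assms sub in \<open>auto simp: r_coset_def\<close>)
qed

lemma coclass_eqE:
  assumes "coclass n G M act c = coclass n G M act d" "c \<in> carrier (cochains n G M)"
  obtains b where "b \<in> coboundaries n G M act" "c = b \<otimes>\<^bsub>cochains n G M\<^esub> d"
  using coclass_self[OF assms(2)] unfolding assms(1) by (auto simp: coclass_conv r_coset_def)

lemma coclass_eq_coboundaries_iff:
  assumes "c \<in> carrier (cochains n G M)"
  shows "coclass n G M act c = coboundaries n G M act \<longleftrightarrow> c \<in> coboundaries n G M act"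
proof -
  interpret C: comm_group "cochains n G M" by (rule cochains_comm_group)
  show ?thesis
    using C.coset_join1[OF _ assms subgroup_coboundaries] C.coset_join2[OF assms subgroup_coboundaries]
    by (auto simp: coclass_conv subgroup.subset[OF subgroup_coboundaries])
qed

section \<open>Composites of consecutive differentials in low degrees\<close>

lemma coboundary_coboundary_0:
  assumes f: "f \<in> carrier (cochains 0 G M)"
  shows "coboundary 1 G M act (coboundary 0 G M act f) = \<one>\<^bsub>cochains 2 G M\<^esub>"
proof (rule cochain_eqI[of _ 2 G M])
  have cl: "f [] \<in> carrier M" using cochain_closed[OF f] by simp
  have d: "coboundary 0 G M act f \<in> carrier (cochains 1 G M)"
    using coboundary_closed[OF f] by simp
  then show "coboundary 1 G M act (coboundary 0 G M act f) \<in> carrier (cochains 2 G M)"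
    using coboundary_closed[OF d] by (simp add: numeral_2_eq_2)
  show "\<one>\<^bsub>cochains 2 G M\<^esub> \<in> carrier (cochains 2 G M)"
    by (simp add: one_cochains carrier_cochains)
  fix xs assume "xs \<in> tuples 2 G"
  then obtain x y where xy: "x \<in> carrier G" "y \<in> carrier G" and xs: "xs = [x, y]"
    by (rule tuples_2E)
  show "coboundary 1 G M act (coboundary 0 G M act f) xs = \<one>\<^bsub>cochains 2 G M\<^esub> xs"
    unfolding xs coboundary_1[OF d xy]
    using xy cl
    by (simp add: coboundary_0[OF f] one_cochains act_distrib act_inv act_mult M.inv_mult_group M.m_ac
        M.inv_solve_left' M.r_inv flip: M.m_assoc)
qed

lemma coboundary_coboundary_1:
  assumes f: "f \<in> carrier (cochains 1 G M)"
  shows "coboundary 2 G M act (coboundary 1 G M act f) = \<one>\<^bsub>cochains 3 G M\<^esub>"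
proof (rule cochain_eqI[of _ 3 G M])
  have d: "coboundary 1 G M act f \<in> carrier (cochains 2 G M)"
    using coboundary_closed[OF f] by (simp add: numeral_2_eq_2)
  then show "coboundary 2 G M act (coboundary 1 G M act f) \<in> carrier (cochains 3 G M)"
    using coboundary_closed[OF d] by simp
  show "\<one>\<^bsub>cochains 3 G M\<^esub> \<in> carrier (cochains 3 G M)"
    by (simp add: one_cochains carrier_cochains)
  fix xs assume "xs \<in> tuples 3 G"
  then obtain x y z where xyz: "x \<in> carrier G" "y \<in> carrier G" "z \<in> carrier G" and xs: "xs = [x, y, z]"
    by (rule tuples_3E)
  have cl: "f [u] \<in> carrier M" if "u \<in> carrier G" for u
    using cochain_closed[OF f] that by simp
  show "coboundary 2 G M act (coboundary 1 G M act f) xs = \<one>\<^bsub>cochains 3 G M\<^esub> xs"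
  proof -
    define P Q R S T U where "P = act x (act y (f [z]))" and "Q = act x (f [y \<otimes>\<^bsub>G\<^esub> z])"
      and "R = act x (f [y])" and "S = f [x \<otimes>\<^bsub>G\<^esub> (y \<otimes>\<^bsub>G\<^esub> z)]" and "T = f [x \<otimes>\<^bsub>G\<^esub> y]" and "U = f [x]"
    note defs = this
    have [simp]: "P \<in> carrier M" "Q \<in> carrier M" "R \<in> carrier M"
      "S \<in> carrier M" "T \<in> carrier M" "U \<in> carrier M"
      using xyz cl by (auto simp: defs)
    have "coboundary 2 G M act (coboundary 1 G M act f) [x, y, z] =
      (P \<otimes>\<^bsub>M\<^esub> inv\<^bsub>M\<^esub> Q \<otimes>\<^bsub>M\<^esub> R) \<otimes>\<^bsub>M\<^esub> (inv\<^bsub>M\<^esub> (P \<otimes>\<^bsub>M\<^esub> inv\<^bsub>M\<^esub> S \<otimes>\<^bsub>M\<^esub> T) \<otimes>\<^bsub>M\<^esub> (Q \<otimes>\<^bsub>M\<^esub> inv\<^bsub>M\<^esub> S \<otimes>\<^bsub>M\<^esub> U))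
        \<otimes>\<^bsub>M\<^esub> inv\<^bsub>M\<^esub> (R \<otimes>\<^bsub>M\<^esub> inv\<^bsub>M\<^esub> T \<otimes>\<^bsub>M\<^esub> U)"
      unfolding coboundary_2[OF d xyz] using xyz cl
      by (simp add: coboundary_1[OF f, unfolded One_nat_def] defs act_distrib act_inv act_mult G.m_assoc)
    \<comment> \<open>The twelve factors are six values, each occurring once plain and once
      inverted. The cancellation rules are switched off so that both sides are first sorted into the
      same product.\<close>
    also have "\<dots> = (P \<otimes>\<^bsub>M\<^esub> Q \<otimes>\<^bsub>M\<^esub> R \<otimes>\<^bsub>M\<^esub> S \<otimes>\<^bsub>M\<^esub> T \<otimes>\<^bsub>M\<^esub> U) \<otimes>\<^bsub>M\<^esub> inv\<^bsub>M\<^esub> (P \<otimes>\<^bsub>M\<^esub> Q \<otimes>\<^bsub>M\<^esub> R \<otimes>\<^bsub>M\<^esub> S \<otimes>\<^bsub>M\<^esub> T \<otimes>\<^bsub>M\<^esub> U)"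
      by (simp add: M.inv_mult_group M.m_ac del: M.r_inv M.l_inv M.Units_r_inv M.Units_l_inv)
    also have "\<dots> = \<one>\<^bsub>M\<^esub>"
      by (rule M.r_inv) simp
    finally show ?thesis
      using xyz by (simp add: xs one_cochains)
  qed
qed

lemma coboundaries_subset_cocycles:
  assumes "\<And>f. f \<in> carrier (cochains n G M) \<Longrightarrow>
    coboundary (Suc n) G M act (coboundary n G M act f) = \<one>\<^bsub>cochains (Suc (Suc n)) G M\<^esub>"
  shows "coboundaries (Suc n) G M act \<subseteq> cocycles (Suc n) G M act"
  using assms coboundary_closed by (auto simp: coboundaries_def cocycles_def kernel_def)

lemma coboundaries_1_subset: "coboundaries 1 G M act \<subseteq> cocycles 1 G M act"
  using coboundaries_subset_cocycles[of 0] coboundary_coboundary_0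
  by (simp add: numeral_2_eq_2)

lemma coboundaries_2_subset: "coboundaries 2 G M act \<subseteq> cocycles 2 G M act"
  using coboundaries_subset_cocycles[of 1] coboundary_coboundary_1
  by (simp add: numeral_2_eq_2 numeral_3_eq_3)

lemma comm_group_cocycle_group: "comm_group (cocycle_group n G M act)"
  unfolding cocycle_group_def
  by (rule comm_group_subgroup[OF cochains_comm_group subgroup_cocycles])

lemma coboundaries_subgroup_cocycle_group:
  assumes "coboundaries n G M act \<subseteq> cocycles n G M act"
  shows "subgroup (coboundaries n G M act) (cocycle_group n G M act)"
  unfolding cocycle_group_def
  by (rule group.subgroup_incl)
    (use assms cochains_comm_group subgroup_cocycles subgroup_coboundaries in
      \<open>auto simp: comm_group_def\<close>)

lemma comm_group_cohomology:
  assumes "coboundaries n G M act \<subseteq> cocycles n G M act"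
  shows "comm_group (cohomology n G M act)"
  unfolding cohomology_def
  by (rule comm_group.abelian_FactGroup[OF comm_group_cocycle_group coboundaries_subgroup_cocycle_group[OF assms]])

lemma coclass_mult:
  assumes "coboundaries n G M act \<subseteq> cocycles n G M act"
    and "c \<in> cocycles n G M act" "d \<in> cocycles n G M act"
  shows "coclass n G M act (c \<otimes>\<^bsub>cochains n G M\<^esub> d) =
    coclass n G M act c \<otimes>\<^bsub>cohomology n G M act\<^esub> coclass n G M act d"
proof -
  interpret Z: comm_group "cocycle_group n G M act" by (rule comm_group_cocycle_group)
  interpret B: normal "coboundaries n G M act" "cocycle_group n G M act"
    by (rule Z.subgroup_imp_normal[OF coboundaries_subgroup_cocycle_group[OF assms(1)]])
  show ?thesis
    using B.rcos_sum[of c d] assms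
    by (simp add: coclass_def cohomology_def cocycle_group_def)
qed

lemma carrier_cohomology:
  "carrier (cohomology n G M act) = coclass n G M act ` cocycles n G M act"
  by (simp add: cohomology_def carrier_FactGroup coclass_def cocycle_group_def)

lemma one_cohomology: "\<one>\<^bsub>cohomology n G M act\<^esub> = coboundaries n G M act"
  by (simp add: cohomology_def)

section \<open>Cocycle conditions and equality of classes as equations between values\<close>

lemma mult_inv_eq_one_iff:
  "m \<in> carrier M \<Longrightarrow> m' \<in> carrier M \<Longrightarrow> m \<otimes>\<^bsub>M\<^esub> inv\<^bsub>M\<^esub> m' = \<one>\<^bsub>M\<^esub> \<longleftrightarrow> m = m'"
  by (simp add: eq_commute[of _ "\<one>\<^bsub>M\<^esub>"] M.inv_solve_right)

lemma cocycles_1_iff: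
  "f \<in> cocycles 1 G M act \<longleftrightarrow> f \<in> carrier (cochains 1 G M) \<and>
    (\<forall>x \<in> carrier G. \<forall>y \<in> carrier G. f [x \<otimes>\<^bsub>G\<^esub> y] = f [x] \<otimes>\<^bsub>M\<^esub> act x (f [y]))"
proof (cases "f \<in> carrier (cochains 1 G M)")
  case f: True
  have cl: "f [x] \<in> carrier M" if "x \<in> carrier G" for x
    using cochain_closed[OF f] that by simp
  have d: "coboundary 1 G M act f \<in> carrier (cochains 2 G M)"
    using coboundary_closed[OF f] by (simp add: numeral_2_eq_2)
  have one: "\<one>\<^bsub>cochains 2 G M\<^esub> \<in> carrier (cochains 2 G M)"
    by (simp add: one_cochains carrier_cochains)
  have "coboundary 1 G M act f [x, y] = \<one>\<^bsub>M\<^esub> \<longleftrightarrow> f [x \<otimes>\<^bsub>G\<^esub> y] = f [x] \<otimes>\<^bsub>M\<^esub> act x (f [y])"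
    if "x \<in> carrier G" "y \<in> carrier G" for x y
  proof -
    have "coboundary 1 G M act f [x, y] = (f [x] \<otimes>\<^bsub>M\<^esub> act x (f [y])) \<otimes>\<^bsub>M\<^esub> inv\<^bsub>M\<^esub> (f [x \<otimes>\<^bsub>G\<^esub> y])"
      unfolding coboundary_1[OF f that] using that cl by (simp add: M.m_ac)
    then show ?thesis
      using that cl mult_inv_eq_one_iff[of "f [x] \<otimes>\<^bsub>M\<^esub> act x (f [y])" "f [x \<otimes>\<^bsub>G\<^esub> y]"] by auto
  qed
  moreover have "coboundary 1 G M act f = \<one>\<^bsub>cochains 2 G M\<^esub> \<longleftrightarrow>
    (\<forall>x \<in> carrier G. \<forall>y \<in> carrier G. coboundary 1 G M act f [x, y] = \<one>\<^bsub>M\<^esub>)"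
  proof
    assume "\<forall>x \<in> carrier G. \<forall>y \<in> carrier G. coboundary 1 G M act f [x, y] = \<one>\<^bsub>M\<^esub>"
    then show "coboundary 1 G M act f = \<one>\<^bsub>cochains 2 G M\<^esub>"
      by (intro cochain_eqI[OF d one]) (auto simp: one_cochains elim!: tuples_2E)
  qed (simp add: one_cochains)
  ultimately show ?thesis
    using f by (simp add: cocycles_def kernel_def numeral_2_eq_2)
qed (simp add: cocycles_def kernel_def)

lemma cocycles_2_iff:
  "f \<in> cocycles 2 G M act \<longleftrightarrow> f \<in> carrier (cochains 2 G M) \<and>
    (\<forall>x \<in> carrier G. \<forall>y \<in> carrier G. \<forall>z \<in> carrier G.
      act x (f [y, z]) \<otimes>\<^bsub>M\<^esub> f [x, y \<otimes>\<^bsub>G\<^esub> z] = f [x, y] \<otimes>\<^bsub>M\<^esub> f [x \<otimes>\<^bsub>G\<^esub> y, z])"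
proof (cases "f \<in> carrier (cochains 2 G M)")
  case f: True
  have cl: "f [x, y] \<in> carrier M" if "x \<in> carrier G" "y \<in> carrier G" for x y
    using cochain_closed[OF f] that by simp
  have d: "coboundary 2 G M act f \<in> carrier (cochains 3 G M)"
    using coboundary_closed[OF f] by simp
  have one: "\<one>\<^bsub>cochains 3 G M\<^esub> \<in> carrier (cochains 3 G M)"
    by (simp add: one_cochains carrier_cochains)
  have "coboundary 2 G M act f [x, y, z] = \<one>\<^bsub>M\<^esub> \<longleftrightarrow>
      act x (f [y, z]) \<otimes>\<^bsub>M\<^esub> f [x, y \<otimes>\<^bsub>G\<^esub> z] = f [x, y] \<otimes>\<^bsub>M\<^esub> f [x \<otimes>\<^bsub>G\<^esub> y, z]"
    if "x \<in> carrier G" "y \<in> carrier G" "z \<in> carrier G" for x y z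
  proof -
    have "coboundary 2 G M act f [x, y, z] =
        act x (f [y, z]) \<otimes>\<^bsub>M\<^esub> f [x, y \<otimes>\<^bsub>G\<^esub> z] \<otimes>\<^bsub>M\<^esub> inv\<^bsub>M\<^esub> (f [x, y] \<otimes>\<^bsub>M\<^esub> f [x \<otimes>\<^bsub>G\<^esub> y, z])"
      unfolding coboundary_2[OF f that] using that cl by (simp add: M.inv_mult_group M.m_ac)
    then show ?thesis
      using that cl by (simp add: mult_inv_eq_one_iff)
  qed
  moreover have "coboundary 2 G M act f = \<one>\<^bsub>cochains 3 G M\<^esub> \<longleftrightarrow>
    (\<forall>x \<in> carrier G. \<forall>y \<in> carrier G. \<forall>z \<in> carrier G. coboundary 2 G M act f [x, y, z] = \<one>\<^bsub>M\<^esub>)"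
  proof
    assume "\<forall>x \<in> carrier G. \<forall>y \<in> carrier G. \<forall>z \<in> carrier G. coboundary 2 G M act f [x, y, z] = \<one>\<^bsub>M\<^esub>"
    then show "coboundary 2 G M act f = \<one>\<^bsub>cochains 3 G M\<^esub>"
      by (intro cochain_eqI[OF d one]) (auto simp: one_cochains elim!: tuples_3E)
  qed (simp add: one_cochains)
  ultimately show ?thesis
    using f by (simp add: cocycles_def kernel_def)
qed (simp add: cocycles_def kernel_def)

text \<open>A 0-cochain is a single element \<open>m\<close>, so cohomologous 1-cochains differ by
  \<open>act x m\<close> over \<open>m\<close>. The inverse is moved to the other side to keep later
  computations free of division.\<close>

lemma coclass_1_eq_iff:
  assumes f: "f \<in> carrier (cochains 1 G M)" and f': "f' \<in> carrier (cochains 1 G M)"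
  shows "coclass 1 G M act f = coclass 1 G M act f' \<longleftrightarrow>
    (\<exists>m \<in> carrier M. \<forall>x \<in> carrier G. f [x] \<otimes>\<^bsub>M\<^esub> m = act x m \<otimes>\<^bsub>M\<^esub> f' [x])"
proof
  assume "coclass 1 G M act f = coclass 1 G M act f'"
  from coclass_eqE[OF this f] obtain b where "b \<in> coboundaries 1 G M act"
    and fb: "f = b \<otimes>\<^bsub>cochains 1 G M\<^esub> f'" .
  then obtain e where e: "e \<in> carrier (cochains 0 G M)" and b: "b = coboundary 0 G M act e"
    by (auto simp: coboundaries_def)
  have e_cl: "e [] \<in> carrier M"
    using cochain_closed[OF e] by simp
  have "f [x] \<otimes>\<^bsub>M\<^esub> e [] = act x (e []) \<otimes>\<^bsub>M\<^esub> f' [x]" if x: "x \<in> carrier G" for x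
  proof -
    have "f' [x] \<in> carrier M"
      using cochain_closed[OF f'] x by simp
    moreover have "f [x] = (act x (e []) \<otimes>\<^bsub>M\<^esub> inv\<^bsub>M\<^esub> (e [])) \<otimes>\<^bsub>M\<^esub> f' [x]"
      using x by (simp add: fb b mult_cochains coboundary_0[OF e x])
    ultimately have "f [x] = act x (e []) \<otimes>\<^bsub>M\<^esub> f' [x] \<otimes>\<^bsub>M\<^esub> inv\<^bsub>M\<^esub> (e [])"
      using x e_cl by (simp add: M.m_ac)
    with \<open>f' [x] \<in> carrier M\<close> show ?thesis
      using x e_cl by (simp add: M.m_assoc)
  qed
  with e_cl show "\<exists>m \<in> carrier M. \<forall>x \<in> carrier G. f [x] \<otimes>\<^bsub>M\<^esub> m = act x m \<otimes>\<^bsub>M\<^esub> f' [x]"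
    by blast
next
  assume "\<exists>m \<in> carrier M. \<forall>x \<in> carrier G. f [x] \<otimes>\<^bsub>M\<^esub> m = act x m \<otimes>\<^bsub>M\<^esub> f' [x]"
  then obtain m where m: "m \<in> carrier M"
    and eq: "\<And>x. x \<in> carrier G \<Longrightarrow> f [x] \<otimes>\<^bsub>M\<^esub> m = act x m \<otimes>\<^bsub>M\<^esub> f' [x]"
    by blast
  let ?e = "\<lambda>xs \<in> tuples 0 G. m"
  have e: "?e \<in> carrier (cochains 0 G M)"
    using m by (simp add: carrier_cochains)
  have b: "coboundary 0 G M act ?e \<in> coboundaries 1 G M act"
    using e by (simp add: coboundaries_def)
  have "f = coboundary 0 G M act ?e \<otimes>\<^bsub>cochains 1 G M\<^esub> f'"
  proof (rule cochain_eqI[OF f])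
    show "coboundary 0 G M act ?e \<otimes>\<^bsub>cochains 1 G M\<^esub> f' \<in> carrier (cochains 1 G M)"
      by (rule subgroup.m_closed[OF group.subgroup_self])
        (use cochains_comm_group f' b subgroup.subset[OF subgroup_coboundaries] in \<open>auto simp: comm_group_def\<close>)
    fix xs assume "xs \<in> tuples 1 G"
    then obtain x where x: "x \<in> carrier G" and xs: "xs = [x]"
      by (auto elim: tuples_1E)
    have cl: "f [x] \<in> carrier M" "f' [x] \<in> carrier M"
      using cochain_closed[OF f] cochain_closed[OF f'] x by simp_all
    have "f [x] = act x m \<otimes>\<^bsub>M\<^esub> f' [x] \<otimes>\<^bsub>M\<^esub> inv\<^bsub>M\<^esub> m"
      using eq[OF x] cl x m by (simp add: M.inv_solve_right)
    also have "\<dots> = act x m \<otimes>\<^bsub>M\<^esub> inv\<^bsub>M\<^esub> m \<otimes>\<^bsub>M\<^esub> f' [x]"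
      using cl x m by (simp add: M.m_ac)
    finally show "f xs = (coboundary 0 G M act ?e \<otimes>\<^bsub>cochains 1 G M\<^esub> f') xs"
      using x by (simp add: xs mult_cochains coboundary_0[OF e x])
  qed
  then show "coclass 1 G M act f = coclass 1 G M act f'"
    using coclass_mult_coboundary[OF f' b] by simp
qed

text \<open>Serves to change the cocycle that represents the extension class inside the cup product;
  the trivializing cochain is handed out as a plain function on \<open>G\<close>.\<close>

lemma coclass_2_eqE:
  assumes eq: "coclass 2 G M act c = coclass 2 G M act d"
    and c: "c \<in> carrier (cochains 2 G M)" and d: "d \<in> carrier (cochains 2 G M)"
  obtains f where "\<And>x. x \<in> carrier G \<Longrightarrow> f x \<in> carrier M"
    and "\<And>x y. x \<in> carrier G \<Longrightarrow> y \<in> carrier G \<Longrightarrow>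
      c [x, y] \<otimes>\<^bsub>M\<^esub> f (x \<otimes>\<^bsub>G\<^esub> y) = act x (f y) \<otimes>\<^bsub>M\<^esub> f x \<otimes>\<^bsub>M\<^esub> d [x, y]"
proof -
  from coclass_eqE[OF eq c] obtain b where "b \<in> coboundaries 2 G M act"
    and cb: "c = b \<otimes>\<^bsub>cochains 2 G M\<^esub> d" .
  then obtain f where f: "f \<in> carrier (cochains 1 G M)" and b: "b = coboundary 1 G M act f"
    by (auto simp: coboundaries_def numeral_2_eq_2)
  show thesis
  proof (rule that[of "\<lambda>x. f [x]"])
    show cl: "f [x] \<in> carrier M" if "x \<in> carrier G" for x
      using cochain_closed[OF f] that by simp
    fix x y assume xy: "x \<in> carrier G" "y \<in> carrier G"
    have [simp]: "act x (f [y]) \<in> carrier M" "f [x] \<in> carrier M" "f [x \<otimes>\<^bsub>G\<^esub> y] \<in> carrier M"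
      "d [x, y] \<in> carrier M"
      using xy cl cochain_closed[OF d] by simp_all
    have "c [x, y] = act x (f [y]) \<otimes>\<^bsub>M\<^esub> inv\<^bsub>M\<^esub> (f [x \<otimes>\<^bsub>G\<^esub> y]) \<otimes>\<^bsub>M\<^esub> f [x] \<otimes>\<^bsub>M\<^esub> d [x, y]"
      using xy coboundary_1[OF f xy] by (simp add: cb b mult_cochains)
    also have "\<dots> = act x (f [y]) \<otimes>\<^bsub>M\<^esub> f [x] \<otimes>\<^bsub>M\<^esub> d [x, y] \<otimes>\<^bsub>M\<^esub> inv\<^bsub>M\<^esub> (f [x \<otimes>\<^bsub>G\<^esub> y])"
      by (simp add: M.m_ac)
    finally show "c [x, y] \<otimes>\<^bsub>M\<^esub> f [x \<otimes>\<^bsub>G\<^esub> y] = act x (f [y]) \<otimes>\<^bsub>M\<^esub> f [x] \<otimes>\<^bsub>M\<^esub> d [x, y]"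
      by (simp add: M.m_assoc)
  qed
qed

end

section \<open>Coefficients in the multiplicative group of the complex numbers\<close>

lemma Cstar_simps [simp]:
  "z \<in> carrier Cstar \<longleftrightarrow> z \<noteq> 0" "z \<otimes>\<^bsub>Cstar\<^esub> w = z * w" "\<one>\<^bsub>Cstar\<^esub> = 1"
  by (simp_all add: Cstar_def)

lemma trivial_action_comp: "(\<lambda>h. trivial_action (f h)) = trivial_action"
  by (simp add: fun_eq_iff trivial_action_def)

lemma group_module_Cstar: "group G \<Longrightarrow> group_module G Cstar trivial_action"
  by (auto simp: group_module_def group_module_axioms_def group_Cstar trivial_action_def hom_def)

lemma cochain_nz: "f \<in> carrier (cochains n G Cstar) \<Longrightarrow> xs \<in> tuples n G \<Longrightarrow> f xs \<noteq> 0"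
  using cochain_closed[of f n G Cstar] by auto

lemma restrict_cochain:
  "(\<And>xs. xs \<in> tuples n G \<Longrightarrow> f xs \<noteq> 0) \<Longrightarrow> restrict f (tuples n G) \<in> carrier (cochains n G Cstar)"
  by (auto simp: carrier_cochains)

lemma mult_cochains_Cstar:
  "xs \<in> tuples n G \<Longrightarrow> (f \<otimes>\<^bsub>cochains n G Cstar\<^esub> g) xs = f xs * g xs"
  by (simp add: mult_cochains)

lemma coboundary_1_Cstar:
  assumes "group G" "h \<in> carrier (cochains 1 G Cstar)" "x \<in> carrier G" "y \<in> carrier G"
  shows "coboundary 1 G Cstar trivial_action h [x, y] = h [y] * inverse (h [x \<otimes>\<^bsub>G\<^esub> y]) * h [x]"
proof -
  interpret group_module G Cstar trivial_action by (rule group_module_Cstar[OF assms(1)])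
  have "h [x \<otimes>\<^bsub>G\<^esub> y] \<noteq> 0"
    using cochain_nz[OF assms(2)] assms(3,4) by simp
  then show ?thesis
    using coboundary_1[OF assms(2-4)] by (simp add: trivial_action_def inv_Cstar)
qed

text \<open>Common source of two conditions: with \<open>\<phi>\<close> trivial it is the 2-cocycle
  identity, with \<open>\<phi>\<close> the cup product it is admissibility of
  \<open>\<zeta>\<close>.\<close>

lemma coboundary_2_Cstar_eq_iff:
  assumes "group G" and f: "f \<in> carrier (cochains 2 G Cstar)" and \<phi>: "\<phi> \<in> carrier (cochains 3 G Cstar)"
  shows "coboundary 2 G Cstar trivial_action f = \<phi> \<longleftrightarrow>
    (\<forall>x \<in> carrier G. \<forall>y \<in> carrier G. \<forall>z \<in> carrier G.
      f [y, z] * f [x, y \<otimes>\<^bsub>G\<^esub> z] = \<phi> [x, y, z] * f [x \<otimes>\<^bsub>G\<^esub> y, z] * f [x, y])" (is "?l \<longleftrightarrow> ?r")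
proof -
  interpret group_module G Cstar trivial_action by (rule group_module_Cstar[OF assms(1)])
  have d: "coboundary 2 G Cstar trivial_action f \<in> carrier (cochains 3 G Cstar)"
    using coboundary_closed[OF f] by simp
  have "coboundary 2 G Cstar trivial_action f [x, y, z] = \<phi> [x, y, z] \<longleftrightarrow>
      f [y, z] * f [x, y \<otimes>\<^bsub>G\<^esub> z] = \<phi> [x, y, z] * f [x \<otimes>\<^bsub>G\<^esub> y, z] * f [x, y]"
    if "x \<in> carrier G" "y \<in> carrier G" "z \<in> carrier G" for x y z
  proof -
    have "f [x \<otimes>\<^bsub>G\<^esub> y, z] \<noteq> 0" "f [x, y] \<noteq> 0"
      using that cochain_nz[OF f] by auto
    then show ?thesis
      unfolding coboundary_2_Cstar[OF assms(1) f that] by (simp add: field_simps)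
  qed
  then have "?r \<longleftrightarrow> (\<forall>x \<in> carrier G. \<forall>y \<in> carrier G. \<forall>z \<in> carrier G.
      coboundary 2 G Cstar trivial_action f [x, y, z] = \<phi> [x, y, z])"
    by simp
  moreover have "\<dots> \<longleftrightarrow> ?l"
    by (auto intro!: cochain_eqI[OF d \<phi>] elim!: tuples_3E)
  ultimately show ?thesis by simp
qed

lemma cocycles_2_Cstar_iff:
  assumes "group G"
  shows "c \<in> cocycles 2 G Cstar trivial_action \<longleftrightarrow> c \<in> carrier (cochains 2 G Cstar) \<and>
    (\<forall>x \<in> carrier G. \<forall>y \<in> carrier G. \<forall>z \<in> carrier G.
      c [y, z] * c [x, y \<otimes>\<^bsub>G\<^esub> z] = c [x \<otimes>\<^bsub>G\<^esub> y, z] * c [x, y])"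
proof -
  have "\<one>\<^bsub>cochains 3 G Cstar\<^esub> \<in> carrier (cochains 3 G Cstar)"
    by (simp add: one_cochains carrier_cochains)
  from coboundary_2_Cstar_eq_iff[OF assms _ this, of c] show ?thesis
    by (auto simp: cocycles_def kernel_def one_cochains)
qed

text \<open>The trivializing 1-cochain is replaced by an arbitrary nowhere vanishing function on
  group elements, so that witnesses such as \<open>\<lambda>x. inverse (\<chi> (A_part x))\<close>
  can be supplied directly.\<close>

lemma coclass_2_Cstar_eq_iff:
  assumes "group G" and c: "c \<in> carrier (cochains 2 G Cstar)" and d: "d \<in> carrier (cochains 2 G Cstar)"
  shows "coclass 2 G Cstar trivial_action c = coclass 2 G Cstar trivial_action d \<longleftrightarrow>
    (\<exists>h. (\<forall>x \<in> carrier G. h x \<noteq> 0) \<and> (\<forall>x \<in> carrier G. \<forall>y \<in> carrier G.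
      c [x, y] * h (x \<otimes>\<^bsub>G\<^esub> y) = h x * h y * d [x, y]))"
proof -
  interpret group_module G Cstar trivial_action by (rule group_module_Cstar[OF assms(1)])
  show ?thesis
  proof
    assume "coclass 2 G Cstar trivial_action c = coclass 2 G Cstar trivial_action d"
    from coclass_eqE[OF this c] obtain b where
      b: "b \<in> coboundaries 2 G Cstar trivial_action" and cbd: "c = b \<otimes>\<^bsub>cochains 2 G Cstar\<^esub> d" .
    from b obtain h where h: "h \<in> carrier (cochains 1 G Cstar)"
      and bh: "b = coboundary 1 G Cstar trivial_action h"
      by (auto simp: coboundaries_def numeral_2_eq_2)
    show "\<exists>h. (\<forall>x \<in> carrier G. h x \<noteq> 0) \<and> (\<forall>x \<in> carrier G. \<forall>y \<in> carrier G.
      c [x, y] * h (x \<otimes>\<^bsub>G\<^esub> y) = h x * h y * d [x, y])"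
    proof (intro exI[of _ "\<lambda>x. h [x]"] conjI ballI)
      show nz: "h [x] \<noteq> 0" if "x \<in> carrier G" for x
        using that cochain_nz[OF h] by simp
      show "c [x, y] * h [x \<otimes>\<^bsub>G\<^esub> y] = h [x] * h [y] * d [x, y]"
        if "x \<in> carrier G" "y \<in> carrier G" for x y
        using that nz[of "x \<otimes>\<^bsub>G\<^esub> y"] coboundary_1_Cstar[OF assms(1) h that]
        by (simp add: cbd bh mult_cochains_Cstar)
    qed
  next
    assume "\<exists>h. (\<forall>x \<in> carrier G. h x \<noteq> 0) \<and> (\<forall>x \<in> carrier G. \<forall>y \<in> carrier G.
      c [x, y] * h (x \<otimes>\<^bsub>G\<^esub> y) = h x * h y * d [x, y])"
    then obtain h where nz: "\<And>x. x \<in> carrier G \<Longrightarrow> h x \<noteq> 0" and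
      eq: "\<And>x y. x \<in> carrier G \<Longrightarrow> y \<in> carrier G \<Longrightarrow> c [x, y] * h (x \<otimes>\<^bsub>G\<^esub> y) = h x * h y * d [x, y]"
      by blast
    define h' where "h' = (\<lambda>xs \<in> tuples 1 G. h (xs ! 0))"
    have h': "h' \<in> carrier (cochains 1 G Cstar)"
      unfolding h'_def by (rule restrict_cochain) (auto elim!: tuples_1E simp: nz)
    let ?b = "coboundary 1 G Cstar trivial_action h'"
    have b: "?b \<in> coboundaries 2 G Cstar trivial_action"
      using h' by (auto simp: coboundaries_def numeral_2_eq_2)
    have "c = ?b \<otimes>\<^bsub>cochains 2 G Cstar\<^esub> d"
    proof (rule cochain_eqI[OF c])
      show "?b \<otimes>\<^bsub>cochains 2 G Cstar\<^esub> d \<in> carrier (cochains 2 G Cstar)"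
        by (rule subgroup.m_closed[OF group.subgroup_self])
          (use cochains_comm_group d b subgroup.subset[OF subgroup_coboundaries] in \<open>auto simp: comm_group_def\<close>)
      fix xs assume "xs \<in> tuples 2 G"
      then obtain x y where xy: "x \<in> carrier G" "y \<in> carrier G" and xs: "xs = [x, y]"
        by (rule tuples_2E)
      show "c xs = (?b \<otimes>\<^bsub>cochains 2 G Cstar\<^esub> d) xs"
      proof -
        have "h (x \<otimes>\<^bsub>G\<^esub> y) \<noteq> 0"
          using xy nz by simp
        with eq[OF xy] have "c [x, y] = h y * inverse (h (x \<otimes>\<^bsub>G\<^esub> y)) * h x * d [x, y]"
          by (simp add: field_simps)
        with xy show ?thesis
          unfolding xs using coboundary_1_Cstar[OF assms(1) h' xy]
          by (simp add: mult_cochains_Cstar h'_def)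
      qed
    qed
    then show "coclass 2 G Cstar trivial_action c = coclass 2 G Cstar trivial_action d"
      using coclass_mult_coboundary[OF d b] by simp
  qed
qed

lemma coboundaries_2_Cstar_iff:
  assumes "group G" and c: "c \<in> carrier (cochains 2 G Cstar)"
  shows "c \<in> coboundaries 2 G Cstar trivial_action \<longleftrightarrow>
    (\<exists>h. (\<forall>x \<in> carrier G. h x \<noteq> 0) \<and> (\<forall>x \<in> carrier G. \<forall>y \<in> carrier G.
      c [x, y] * h (x \<otimes>\<^bsub>G\<^esub> y) = h x * h y))"
proof -
  interpret group_module G Cstar trivial_action by (rule group_module_Cstar[OF assms(1)])
  have one: "\<one>\<^bsub>cochains 2 G Cstar\<^esub> \<in> carrier (cochains 2 G Cstar)"
    by (simp add: one_cochains carrier_cochains)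
  have "coclass 2 G Cstar trivial_action \<one>\<^bsub>cochains 2 G Cstar\<^esub> = coboundaries 2 G Cstar trivial_action"
    using coclass_eq_coboundaries_iff[OF one] subgroup.one_closed[OF subgroup_coboundaries] by simp
  with coclass_2_Cstar_eq_iff[OF assms one] coclass_eq_coboundaries_iff[OF c]
  show ?thesis by (simp add: one_cochains)
qed

text \<open>The quotient of the two cochains is the coboundary of \<open>e\<close>. This is the form
  in which independence of the cup product from its representatives is verified.\<close>

lemma coclass_3_Cstar_eqI:
  assumes "group G"
    and \<phi>: "\<phi> \<in> carrier (cochains 3 G Cstar)" and \<psi>: "\<psi> \<in> carrier (cochains 3 G Cstar)"
    and nz: "\<And>x y. x \<in> carrier G \<Longrightarrow> y \<in> carrier G \<Longrightarrow> e x y \<noteq> 0"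
    and eq: "\<And>x y z. x \<in> carrier G \<Longrightarrow> y \<in> carrier G \<Longrightarrow> z \<in> carrier G \<Longrightarrow>
      \<phi> [x, y, z] * e (x \<otimes>\<^bsub>G\<^esub> y) z * e x y = e y z * e x (y \<otimes>\<^bsub>G\<^esub> z) * \<psi> [x, y, z]"
  shows "coclass 3 G Cstar trivial_action \<phi> = coclass 3 G Cstar trivial_action \<psi>"
proof -
  interpret group_module G Cstar trivial_action by (rule group_module_Cstar[OF assms(1)])
  define e' where "e' = (\<lambda>xs \<in> tuples 2 G. e (xs ! 0) (xs ! 1))"
  have e': "e' \<in> carrier (cochains 2 G Cstar)"
    unfolding e'_def by (rule restrict_cochain) (auto elim!: tuples_2E simp: nz)
  let ?b = "coboundary 2 G Cstar trivial_action e'"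
  have b: "?b \<in> coboundaries 3 G Cstar trivial_action"
    using e' by (auto simp: coboundaries_def numeral_3_eq_3 numeral_2_eq_2)
  have "\<phi> = ?b \<otimes>\<^bsub>cochains 3 G Cstar\<^esub> \<psi>"
  proof (rule cochain_eqI[OF \<phi>])
    show "?b \<otimes>\<^bsub>cochains 3 G Cstar\<^esub> \<psi> \<in> carrier (cochains 3 G Cstar)"
      by (rule subgroup.m_closed[OF group.subgroup_self])
        (use cochains_comm_group \<psi> b subgroup.subset[OF subgroup_coboundaries] in \<open>auto simp: comm_group_def\<close>)
    fix xs assume "xs \<in> tuples 3 G"
    then obtain x y z where xyz: "x \<in> carrier G" "y \<in> carrier G" "z \<in> carrier G" and xs: "xs = [x, y, z]"
      by (rule tuples_3E)
    show "\<phi> xs = (?b \<otimes>\<^bsub>cochains 3 G Cstar\<^esub> \<psi>) xs"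
    proof -
      have "e (x \<otimes>\<^bsub>G\<^esub> y) z \<noteq> 0" "e x y \<noteq> 0"
        using xyz nz by auto
      with eq[OF xyz] have "\<phi> [x, y, z] = e y z * inverse (e (x \<otimes>\<^bsub>G\<^esub> y) z) *
          e x (y \<otimes>\<^bsub>G\<^esub> z) * inverse (e x y) * \<psi> [x, y, z]"
        by (simp add: field_simps)
      with xyz show ?thesis
        unfolding xs using coboundary_2_Cstar[OF assms(1) e' xyz]
        by (simp add: mult_cochains_Cstar e'_def)
    qed
  qed
  then show ?thesis
    using coclass_mult_coboundary[OF \<psi> b] by simp
qed

section \<open>Pullback along group homomorphisms\<close>

lemma pullback_cochain:
  assumes "f \<in> hom H G" "c \<in> carrier (cochains n G M)"
  shows "pullback n H f c \<in> carrier (cochains n H M)"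
proof -
  have "map f xs \<in> tuples n G" if "xs \<in> tuples n H" for xs
    using that assms(1) by (auto simp: tuples_def hom_def in_lists_conv_set)
  then show ?thesis
    using cochain_closed[OF assms(2)] by (auto simp: pullback_def carrier_cochains)
qed

lemma pullback_2_apply:
  "x \<in> carrier H \<Longrightarrow> y \<in> carrier H \<Longrightarrow> pullback 2 H f c [x, y] = c [f x, f y]"
  by (simp add: pullback_def)

lemma pullback_2_cocycle:
  assumes "group H" "group G" "f \<in> hom H G" "c \<in> cocycles 2 G Cstar trivial_action"
  shows "pullback 2 H f c \<in> cocycles 2 H Cstar trivial_action"
proof -
  interpret H: group H by fact
  show ?thesis
    using assms pullback_cochain[OF assms(3)]
    by (auto simp: cocycles_2_Cstar_iff hom_def pullback_def Pi_def)
qed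

text \<open>A function \<open>h\<close> linking two cohomologous cochains on \<open>G\<close> pulls
  back to \<open>h\<close> composed with \<open>f\<close>, which links their pullbacks. Hence the
  set under \<open>the_elem\<close> is a singleton.\<close>

lemma cohomology_map_2_Cstar:
  assumes "group H" "group G" and f: "f \<in> hom H G" and c: "c \<in> carrier (cochains 2 G Cstar)"
  shows "cohomology_map 2 H f Cstar trivial_action (coclass 2 G Cstar trivial_action c) =
    coclass 2 H Cstar trivial_action (pullback 2 H f c)"
proof -
  interpret G: group_module G Cstar trivial_action by (rule group_module_Cstar) fact
  interpret H: group H by fact
  have f': "f x \<in> carrier G" "y \<in> carrier H \<Longrightarrow> f (x \<otimes>\<^bsub>H\<^esub> y) = f x \<otimes>\<^bsub>G\<^esub> f y"
    if "x \<in> carrier H" for x y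
    using f that by (auto simp: hom_def)
  have "coclass 2 H Cstar trivial_action (pullback 2 H f d) =
      coclass 2 H Cstar trivial_action (pullback 2 H f c)"
    if "d \<in> coclass 2 G Cstar trivial_action c" for d
  proof -
    from that obtain b where b: "b \<in> coboundaries 2 G Cstar trivial_action"
      and db: "d = b \<otimes>\<^bsub>cochains 2 G Cstar\<^esub> c"
      by (auto simp: G.coclass_conv r_coset_def)
    have d: "d \<in> carrier (cochains 2 G Cstar)"
      unfolding db
      by (rule subgroup.m_closed[OF group.subgroup_self])
        (use G.cochains_comm_group c b subgroup.subset[OF G.subgroup_coboundaries] in \<open>auto simp: comm_group_def\<close>)
    have "coclass 2 G Cstar trivial_action d = coclass 2 G Cstar trivial_action c"
      unfolding db by (rule G.coclass_mult_coboundary[OF c b])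
    then obtain h where h: "\<And>x. x \<in> carrier G \<Longrightarrow> h x \<noteq> 0"
      "\<And>x y. x \<in> carrier G \<Longrightarrow> y \<in> carrier G \<Longrightarrow> d [x, y] * h (x \<otimes>\<^bsub>G\<^esub> y) = h x * h y * c [x, y]"
      unfolding coclass_2_Cstar_eq_iff[OF assms(2) d c] by blast
    then have "\<exists>h. (\<forall>x \<in> carrier H. h x \<noteq> 0) \<and> (\<forall>x \<in> carrier H. \<forall>y \<in> carrier H.
        pullback 2 H f d [x, y] * h (x \<otimes>\<^bsub>H\<^esub> y) = h x * h y * pullback 2 H f c [x, y])"
      by (intro exI[of _ "\<lambda>x. h (f x)"]) (simp add: f' pullback_def)
    then show ?thesis
      using coclass_2_Cstar_eq_iff[OF assms(1) pullback_cochain[OF f d] pullback_cochain[OF f c]]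
      by blast
  qed
  then show ?thesis
    unfolding cohomology_map_def trivial_action_comp[of f]
    using G.coclass_self[OF c] by (intro the_elem_image_unique) blast+
qed

lemma pullback_mult:
  assumes "f \<in> hom H G"
  shows "pullback n H f (c \<otimes>\<^bsub>cochains n G M\<^esub> d) =
    pullback n H f c \<otimes>\<^bsub>cochains n H M\<^esub> pullback n H f d"
proof -
  have "map f xs \<in> tuples n G" if "xs \<in> tuples n H" for xs
    using that assms by (auto simp: tuples_def hom_def in_lists_conv_set)
  then show ?thesis
    by (auto simp: pullback_def mult_cochains intro!: restrict_ext)
qed

lemma comm_group_H2_Cstar: "group G \<Longrightarrow> comm_group (cohomology 2 G Cstar trivial_action)"
  using group_module.comm_group_cohomology group_module.coboundaries_2_subset group_module_Cstar
  by blast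

lemma coclass_2_Cstar_mult:
  assumes "group G" "c \<in> cocycles 2 G Cstar trivial_action" "d \<in> cocycles 2 G Cstar trivial_action"
  shows "coclass 2 G Cstar trivial_action (c \<otimes>\<^bsub>cochains 2 G Cstar\<^esub> d) =
    coclass 2 G Cstar trivial_action c
      \<otimes>\<^bsub>cohomology 2 G Cstar trivial_action\<^esub> coclass 2 G Cstar trivial_action d"
  using group_module.coclass_mult group_module.coboundaries_2_subset group_module_Cstar assms
  by blast

lemma group_hom_cohomology_map_2:
  assumes H: "group H" and G: "group G" and f: "f \<in> hom H G"
  shows "group_hom (cohomology 2 G Cstar trivial_action) (cohomology 2 H Cstar trivial_action)
    (cohomology_map 2 H f Cstar trivial_action)"
proof -
  interpret G: group_module G Cstar trivial_action by (rule group_module_Cstar) fact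
  interpret H: group_module H Cstar trivial_action by (rule group_module_Cstar) fact
  interpret CG: comm_group "cochains 2 G Cstar" by (rule G.cochains_comm_group)
  note map = cohomology_map_2_Cstar[OF H G f G.cocycles_closed]
  have "cohomology_map 2 H f Cstar trivial_action \<in>
      hom (cohomology 2 G Cstar trivial_action) (cohomology 2 H Cstar trivial_action)"
  proof (rule homI; unfold G.carrier_cohomology H.carrier_cohomology)
    fix U assume "U \<in> coclass 2 G Cstar trivial_action ` cocycles 2 G Cstar trivial_action"
    then obtain c where c: "c \<in> cocycles 2 G Cstar trivial_action"
      and U: "U = coclass 2 G Cstar trivial_action c" by blast
    then show "cohomology_map 2 H f Cstar trivial_action U \<in>
        coclass 2 H Cstar trivial_action ` cocycles 2 H Cstar trivial_action"
      using pullback_2_cocycle[OF H G f c] by (simp add: map)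
    fix V assume "V \<in> coclass 2 G Cstar trivial_action ` cocycles 2 G Cstar trivial_action"
    then obtain d where d: "d \<in> cocycles 2 G Cstar trivial_action"
      and V: "V = coclass 2 G Cstar trivial_action d" by blast
    have "c \<otimes>\<^bsub>cochains 2 G Cstar\<^esub> d \<in> cocycles 2 G Cstar trivial_action"
      using c d by (rule subgroup.m_closed[OF G.subgroup_cocycles])
    then show "cohomology_map 2 H f Cstar trivial_action (U \<otimes>\<^bsub>cohomology 2 G Cstar trivial_action\<^esub> V) =
        cohomology_map 2 H f Cstar trivial_action U
          \<otimes>\<^bsub>cohomology 2 H Cstar trivial_action\<^esub> cohomology_map 2 H f Cstar trivial_action V"
      using c d pullback_2_cocycle[OF H G f]
      by (simp add: U V map pullback_mult[OF f] coclass_2_Cstar_mult[OF H] flip: coclass_2_Cstar_mult[OF G])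
  qed
  then show ?thesis
    using comm_group_H2_Cstar[OF G] comm_group_H2_Cstar[OF H]
    by (simp add: group_hom_def group_hom_axioms_def comm_group_def)
qed

text \<open>The cocycle identity at \<open>(x, 1, 1)\<close> and at \<open>(1, 1, x)\<close>
  contains a common nonzero factor. Even an unnormalized cocycle is therefore constant on pairs with
  a trivial entry.\<close>

lemma cocycle_2_Cstar_one:
  assumes "group G" and c: "c \<in> cocycles 2 G Cstar trivial_action" and x: "x \<in> carrier G"
  shows "c [x, \<one>\<^bsub>G\<^esub>] = c [\<one>\<^bsub>G\<^esub>, \<one>\<^bsub>G\<^esub>]" "c [\<one>\<^bsub>G\<^esub>, x] = c [\<one>\<^bsub>G\<^esub>, \<one>\<^bsub>G\<^esub>]"
proof -
  interpret group G by fact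
  have cc: "c \<in> carrier (cochains 2 G Cstar)"
    and eq: "\<And>x y z. x \<in> carrier G \<Longrightarrow> y \<in> carrier G \<Longrightarrow> z \<in> carrier G \<Longrightarrow>
      c [y, z] * c [x, y \<otimes>\<^bsub>G\<^esub> z] = c [x \<otimes>\<^bsub>G\<^esub> y, z] * c [x, y]"
    using c by (auto simp: cocycles_2_Cstar_iff[OF assms(1)])
  have nz: "c [x, \<one>\<^bsub>G\<^esub>] \<noteq> 0" "c [\<one>\<^bsub>G\<^esub>, x] \<noteq> 0"
    using cochain_nz[OF cc] x by simp_all
  show "c [x, \<one>\<^bsub>G\<^esub>] = c [\<one>\<^bsub>G\<^esub>, \<one>\<^bsub>G\<^esub>]" "c [\<one>\<^bsub>G\<^esub>, x] = c [\<one>\<^bsub>G\<^esub>, \<one>\<^bsub>G\<^esub>]"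
    using eq[of x "\<one>\<^bsub>G\<^esub>" "\<one>\<^bsub>G\<^esub>"] eq[of "\<one>\<^bsub>G\<^esub>" "\<one>\<^bsub>G\<^esub>" x] x nz by simp_all
qed

section \<open>The dual module\<close>

lemma dual_mult: "\<chi> \<otimes>\<^bsub>dual A\<^esub> \<psi> = (\<lambda>a \<in> carrier A. \<chi> a * \<psi> a)"
  and dual_one: "\<one>\<^bsub>dual A\<^esub> = (\<lambda>a \<in> carrier A. 1)"
  by (simp_all add: dual_def)

lemma dual_carrier_iff: "\<chi> \<in> carrier (dual A) \<longleftrightarrow> \<chi> \<in> extensional (carrier A) \<and>
    (\<forall>a \<in> carrier A. \<chi> a \<noteq> 0) \<and>
    (\<forall>a \<in> carrier A. \<forall>b \<in> carrier A. \<chi> (a \<otimes>\<^bsub>A\<^esub> b) = \<chi> a * \<chi> b)"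
  by (auto simp: dual_def hom_def)

lemma comm_group_dual:
  assumes "group A"
  shows "comm_group (dual A)"
proof (rule comm_groupI)
  interpret group A by fact
  fix \<chi> assume \<chi>: "\<chi> \<in> carrier (dual A)"
  then show "\<exists>\<psi> \<in> carrier (dual A). \<psi> \<otimes>\<^bsub>dual A\<^esub> \<chi> = \<one>\<^bsub>dual A\<^esub>"
    by (intro bexI[of _ "\<lambda>a \<in> carrier A. inverse (\<chi> a)"])
      (auto simp: dual_carrier_iff dual_mult dual_one intro!: restrict_ext)
  show "\<one>\<^bsub>dual A\<^esub> \<otimes>\<^bsub>dual A\<^esub> \<chi> = \<chi>"
    using \<chi> by (auto simp: dual_carrier_iff dual_mult dual_one fun_eq_iff extensional_def)
next
  interpret group A by fact
  show "\<one>\<^bsub>dual A\<^esub> \<in> carrier (dual A)" by (simp add: dual_carrier_iff dual_one)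
  show "\<chi> \<otimes>\<^bsub>dual A\<^esub> \<psi> \<in> carrier (dual A)"
    if "\<chi> \<in> carrier (dual A)" "\<psi> \<in> carrier (dual A)" for \<chi> \<psi>
    using that by (simp add: dual_carrier_iff dual_mult)
qed (auto simp: dual_mult fun_eq_iff)

lemma inv_dual:
  assumes "group A" and \<chi>: "\<chi> \<in> carrier (dual A)"
  shows "inv\<^bsub>dual A\<^esub> \<chi> = (\<lambda>a \<in> carrier A. inverse (\<chi> a))"
proof -
  interpret A: group A by fact
  interpret D: comm_group "dual A" by (rule comm_group_dual) fact
  show ?thesis
    by (rule D.inv_equality)
      (use \<chi> in \<open>auto simp: dual_carrier_iff dual_mult dual_one intro!: restrict_ext\<close>)
qed

text \<open>Precomposition with the action alone would reverse products; the inverse in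
  \<open>dual_action\<close> reverses them again and yields a left action.\<close>

lemma group_module_dual_action:
  assumes "group_module Q A act"
  shows "group_module Q (dual A) (dual_action A Q act)"
proof -
  interpret group_module Q A act by fact
  interpret D: comm_group "dual A" by (rule comm_group_dual) (rule M.is_group)
  show ?thesis
  proof
    show "dual_action A Q act g \<in> hom (dual A) (dual A)" if "g \<in> carrier Q" for g
      using that by (auto simp: hom_def dual_carrier_iff dual_action_def dual_mult act_distrib)
    show "dual_action A Q act (g \<otimes>\<^bsub>Q\<^esub> h) \<chi> = dual_action A Q act g (dual_action A Q act h \<chi>)"
      if "g \<in> carrier Q" "h \<in> carrier Q" "\<chi> \<in> carrier (dual A)" for g h \<chi>
      using that by (auto simp: dual_action_def G.inv_mult_group act_mult fun_eq_iff)
  qed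
qed

section \<open>The extension in terms of the transversal\<close>

context abelian_extension
begin

lemma \<iota>_closed [simp]: "a \<in> carrier A \<Longrightarrow> \<iota> a \<in> carrier G"
  using \<iota>_hom by (auto simp: hom_def)

lemma \<iota>_mult: "a \<in> carrier A \<Longrightarrow> b \<in> carrier A \<Longrightarrow> \<iota> (a \<otimes>\<^bsub>A\<^esub> b) = \<iota> a \<otimes>\<^bsub>G\<^esub> \<iota> b"
  using \<iota>_hom by (auto simp: hom_def)

lemma \<iota>_one [simp]: "\<iota> \<one>\<^bsub>A\<^esub> = \<one>\<^bsub>G\<^esub>"
  using hom_one[OF \<iota>_hom A.is_group G.is_group] .

lemma \<iota>_eq_iff: "a \<in> carrier A \<Longrightarrow> b \<in> carrier A \<Longrightarrow> \<iota> a = \<iota> b \<longleftrightarrow> a = b"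
  using \<iota>_inj by (auto dest: inj_onD)

lemma p_closed [simp]: "x \<in> carrier G \<Longrightarrow> p x \<in> carrier Q"
  using p_hom by (auto simp: hom_def)

lemma p_mult [simp]: "x \<in> carrier G \<Longrightarrow> y \<in> carrier G \<Longrightarrow> p (x \<otimes>\<^bsub>G\<^esub> y) = p x \<otimes>\<^bsub>Q\<^esub> p y"
  using p_hom by (auto simp: hom_def)

lemma p_inv [simp]: "x \<in> carrier G \<Longrightarrow> p (inv\<^bsub>G\<^esub> x) = inv\<^bsub>Q\<^esub> (p x)"
  using group_hom.hom_inv[of G Q p x] p_hom
  by (simp add: group_hom_def group_hom_axioms_def G.is_group Q.is_group)

lemma p_one [simp]: "p \<one>\<^bsub>G\<^esub> = \<one>\<^bsub>Q\<^esub>"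
  using hom_one[OF p_hom G.is_group Q.is_group] .

lemma p_\<iota> [simp]: "a \<in> carrier A \<Longrightarrow> p (\<iota> a) = \<one>\<^bsub>Q\<^esub>"
  using exact by (auto simp: kernel_def)

lemmas [simp] = s_closed p_s s_one

section \<open>Coordinates on \<open>G\<close> given by the transversal\<close>

lemma the_inv_\<iota>:
  assumes "x \<in> carrier G" "p x = \<one>\<^bsub>Q\<^esub>"
  shows "the_inv_into (carrier A) \<iota> x \<in> carrier A" "\<iota> (the_inv_into (carrier A) \<iota> x) = x"
proof -
  have "x \<in> \<iota> ` carrier A"
    using assms by (simp add: exact kernel_def)
  then show "the_inv_into (carrier A) \<iota> x \<in> carrier A" "\<iota> (the_inv_into (carrier A) \<iota> x) = x"
    using the_inv_into_into[OF \<iota>_inj] f_the_inv_into_f[OF \<iota>_inj] by auto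
qed

lemma A_part_closed [simp]: "x \<in> carrier G \<Longrightarrow> A_part x \<in> carrier A"
  unfolding A_part_def by (rule the_inv_\<iota>) auto

lemma A_part_decomp:
  assumes "x \<in> carrier G"
  shows "\<iota> (A_part x) \<otimes>\<^bsub>G\<^esub> s (p x) = x"
  using assms by (simp add: A_part_def the_inv_\<iota> G.m_assoc)

text \<open>Uniqueness of the decomposition, by cancelling \<open>s (p x)\<close>. It lets the
  \<open>A\<close>-part of an explicit product be computed without unfolding the inverse of
  \<open>\<iota>\<close>.\<close>

lemma A_part_eqI:
  assumes "a \<in> carrier A" "x \<in> carrier G" "\<iota> a \<otimes>\<^bsub>G\<^esub> s (p x) = x"
  shows "A_part x = a"
proof -
  have "\<iota> (A_part x) \<otimes>\<^bsub>G\<^esub> s (p x) = \<iota> a \<otimes>\<^bsub>G\<^esub> s (p x)"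
    using assms by (simp add: A_part_decomp)
  then have "\<iota> (A_part x) = \<iota> a"
    by (subst (asm) G.right_cancel) (use assms in auto)
  then show ?thesis
    using assms by (simp add: \<iota>_eq_iff)
qed

lemma A_part_\<iota> [simp]: "a \<in> carrier A \<Longrightarrow> A_part (\<iota> a) = a"
  by (rule A_part_eqI) auto

lemma A_part_s [simp]: "g \<in> carrier Q \<Longrightarrow> A_part (s g) = \<one>\<^bsub>A\<^esub>"
  by (rule A_part_eqI) auto

lemma A_part_\<iota>_mult:
  assumes "a \<in> carrier A" "x \<in> carrier G"
  shows "A_part (\<iota> a \<otimes>\<^bsub>G\<^esub> x) = a \<otimes>\<^bsub>A\<^esub> A_part x"
  by (rule A_part_eqI) (use assms in \<open>simp_all add: \<iota>_mult G.m_assoc A_part_decomp\<close>)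

section \<open>The action of \<open>Q\<close> on \<open>A\<close> by conjugation\<close>

lemma act_closed [simp]: "g \<in> carrier Q \<Longrightarrow> a \<in> carrier A \<Longrightarrow> act g a \<in> carrier A"
  unfolding act_def by (rule the_inv_\<iota>) auto

lemma \<iota>_act: "g \<in> carrier Q \<Longrightarrow> a \<in> carrier A \<Longrightarrow>
    \<iota> (act g a) = s g \<otimes>\<^bsub>G\<^esub> \<iota> a \<otimes>\<^bsub>G\<^esub> inv\<^bsub>G\<^esub> (s g)"
  unfolding act_def by (rule the_inv_\<iota>) auto

text \<open>\<open>act\<close> is defined by conjugation with \<open>s (p x)\<close>, but
  \<open>x\<close> differs from it by an element of the abelian group \<open>A\<close>, which
  commutes past \<open>\<iota> a\<close> and leaves the conjugate unchanged.\<close>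

lemma \<iota>_act_commute:
  assumes "x \<in> carrier G" "a \<in> carrier A"
  shows "\<iota> (act (p x) a) \<otimes>\<^bsub>G\<^esub> x = x \<otimes>\<^bsub>G\<^esub> \<iota> a"
proof -
  let ?b = "A_part x"
  have "\<iota> (act (p x) a) \<otimes>\<^bsub>G\<^esub> x = \<iota> (act (p x) a) \<otimes>\<^bsub>G\<^esub> (\<iota> ?b \<otimes>\<^bsub>G\<^esub> s (p x))"
    using assms by (simp add: A_part_decomp)
  also have "\<dots> = \<iota> (?b \<otimes>\<^bsub>A\<^esub> act (p x) a) \<otimes>\<^bsub>G\<^esub> s (p x)"
    using assms by (subst A.m_comm) (simp_all add: \<iota>_mult G.m_assoc)
  also have "\<dots> = (\<iota> ?b \<otimes>\<^bsub>G\<^esub> s (p x)) \<otimes>\<^bsub>G\<^esub> \<iota> a"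
    using assms by (simp add: \<iota>_mult \<iota>_act G.m_assoc)
  finally show ?thesis
    using assms by (simp add: A_part_decomp)
qed

lemma act_eqI:
  assumes "x \<in> carrier G" "a \<in> carrier A" "b \<in> carrier A" "\<iota> b \<otimes>\<^bsub>G\<^esub> x = x \<otimes>\<^bsub>G\<^esub> \<iota> a"
  shows "act (p x) a = b"
proof -
  have "\<iota> (act (p x) a) \<otimes>\<^bsub>G\<^esub> x = \<iota> b \<otimes>\<^bsub>G\<^esub> x"
    using assms by (simp add: \<iota>_act_commute)
  then have "\<iota> (act (p x) a) = \<iota> b"
    by (subst (asm) G.right_cancel) (use assms in auto)
  then show ?thesis
    using assms by (simp add: \<iota>_eq_iff)
qed

lemma act_one [simp]: "a \<in> carrier A \<Longrightarrow> act \<one>\<^bsub>Q\<^esub> a = a"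
  using act_eqI[of "\<one>\<^bsub>G\<^esub>" a a] by simp

text \<open>The product \<open>s g \<otimes> s h\<close> need not be
  \<open>s (g \<otimes> h)\<close>, but it lies over the same element of \<open>Q\<close>, and any
  such element computes the action.\<close>

lemma act_mult:
  assumes "g \<in> carrier Q" "h \<in> carrier Q" "a \<in> carrier A"
  shows "act (g \<otimes>\<^bsub>Q\<^esub> h) a = act g (act h a)"
proof -
  have "act (p (s g \<otimes>\<^bsub>G\<^esub> s h)) a = act g (act h a)"
  proof (rule act_eqI)
    have "\<iota> (act g (act h a)) \<otimes>\<^bsub>G\<^esub> (s g \<otimes>\<^bsub>G\<^esub> s h) = s g \<otimes>\<^bsub>G\<^esub> \<iota> (act h a) \<otimes>\<^bsub>G\<^esub> s h"
      using assms \<iota>_act_commute[of "s g" "act h a"] by (simp flip: G.m_assoc)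
    also have "\<dots> = s g \<otimes>\<^bsub>G\<^esub> s h \<otimes>\<^bsub>G\<^esub> \<iota> a"
      using assms \<iota>_act_commute[of "s h" a] by (simp add: G.m_assoc)
    finally show "\<iota> (act g (act h a)) \<otimes>\<^bsub>G\<^esub> (s g \<otimes>\<^bsub>G\<^esub> s h) = s g \<otimes>\<^bsub>G\<^esub> s h \<otimes>\<^bsub>G\<^esub> \<iota> a" .
  qed (use assms in auto)
  then show ?thesis using assms by simp
qed

lemma act_A_mult:
  assumes "g \<in> carrier Q" "a \<in> carrier A" "b \<in> carrier A"
  shows "act g (a \<otimes>\<^bsub>A\<^esub> b) = act g a \<otimes>\<^bsub>A\<^esub> act g b"
proof -
  have "inv\<^bsub>G\<^esub> (s g) \<otimes>\<^bsub>G\<^esub> (s g \<otimes>\<^bsub>G\<^esub> \<iota> b) = \<iota> b"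
    using assms by (simp flip: G.m_assoc)
  then have "act (p (s g)) (a \<otimes>\<^bsub>A\<^esub> b) = act g a \<otimes>\<^bsub>A\<^esub> act g b"
    by (intro act_eqI) (use assms in \<open>simp_all add: \<iota>_mult \<iota>_act G.m_assoc\<close>)
  then show ?thesis using assms by simp
qed

lemma act_inv_act [simp]:
  assumes "g \<in> carrier Q" "a \<in> carrier A"
  shows "act (inv\<^bsub>Q\<^esub> g) (act g a) = a" "act g (act (inv\<^bsub>Q\<^esub> g) a) = a"
  using assms by (simp_all flip: act_mult)

lemma group_module_act: "group_module Q A act"
  by unfold_locales (auto simp: hom_def act_A_mult act_mult)

section \<open>The cocycle of the extension\<close>

lemma \<beta>_closed [simp]: "g \<in> carrier Q \<Longrightarrow> h \<in> carrier Q \<Longrightarrow> \<beta> [g, h] \<in> carrier A"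
  by (auto simp: \<beta>_def intro!: the_inv_\<iota>)

lemma \<iota>_\<beta>:
  assumes "g \<in> carrier Q" "h \<in> carrier Q"
  shows "\<iota> (\<beta> [g, h]) \<otimes>\<^bsub>G\<^esub> s (g \<otimes>\<^bsub>Q\<^esub> h) = s g \<otimes>\<^bsub>G\<^esub> s h"
proof -
  have "\<iota> (\<beta> [g, h]) = s g \<otimes>\<^bsub>G\<^esub> s h \<otimes>\<^bsub>G\<^esub> inv\<^bsub>G\<^esub> (s (g \<otimes>\<^bsub>Q\<^esub> h))"
    using assms by (simp add: \<beta>_def the_inv_\<iota>)
  then show ?thesis
    using assms by (simp add: G.m_assoc)
qed

text \<open>Multiplication in coordinates: the \<open>A\<close>-part of \<open>y\<close> moves left
  across \<open>s (p x)\<close> at the price of the action, and the two transversal elements then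
  merge at the price of \<open>\<beta>\<close>. Read on cochains, \<open>A_part\<close> trivializes
  the inflation of \<open>\<beta>\<close> up to inversion.\<close>

lemma A_part_mult:
  assumes x: "x \<in> carrier G" and y: "y \<in> carrier G"
  shows "A_part (x \<otimes>\<^bsub>G\<^esub> y) = A_part x \<otimes>\<^bsub>A\<^esub> act (p x) (A_part y) \<otimes>\<^bsub>A\<^esub> \<beta> [p x, p y]"
proof (rule A_part_eqI)
  have "\<iota> (A_part x \<otimes>\<^bsub>A\<^esub> act (p x) (A_part y) \<otimes>\<^bsub>A\<^esub> \<beta> [p x, p y]) \<otimes>\<^bsub>G\<^esub> s (p (x \<otimes>\<^bsub>G\<^esub> y)) =
      \<iota> (A_part x) \<otimes>\<^bsub>G\<^esub> (\<iota> (act (p x) (A_part y)) \<otimes>\<^bsub>G\<^esub> s (p x)) \<otimes>\<^bsub>G\<^esub> s (p y)"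
    using assms \<iota>_\<beta>[of "p x" "p y"] by (simp add: \<iota>_mult G.m_assoc)
  also have "\<dots> = (\<iota> (A_part x) \<otimes>\<^bsub>G\<^esub> s (p x)) \<otimes>\<^bsub>G\<^esub> (\<iota> (A_part y) \<otimes>\<^bsub>G\<^esub> s (p y))"
    using assms \<iota>_act_commute[of "s (p x)" "A_part y"] by (simp add: G.m_assoc)
  finally show "\<iota> (A_part x \<otimes>\<^bsub>A\<^esub> act (p x) (A_part y) \<otimes>\<^bsub>A\<^esub> \<beta> [p x, p y]) \<otimes>\<^bsub>G\<^esub> s (p (x \<otimes>\<^bsub>G\<^esub> y)) =
      x \<otimes>\<^bsub>G\<^esub> y"
    using assms by (simp add: A_part_decomp)
qed (use assms in auto)

text \<open>Associativity of \<open>s g\<close>, \<open>s h\<close>, \<open>s k\<close>, compared on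
  \<open>A\<close>-parts; the \<open>A\<close>-parts of the three factors are trivial, so only
  \<open>\<beta>\<close> survives.\<close>

lemma \<beta>_cocycle_eq:
  assumes g: "g \<in> carrier Q" and h: "h \<in> carrier Q" and k: "k \<in> carrier Q"
  shows "act g (\<beta> [h, k]) \<otimes>\<^bsub>A\<^esub> \<beta> [g, h \<otimes>\<^bsub>Q\<^esub> k] = \<beta> [g, h] \<otimes>\<^bsub>A\<^esub> \<beta> [g \<otimes>\<^bsub>Q\<^esub> h, k]"
proof -
  have one: "act u \<one>\<^bsub>A\<^esub> = \<one>\<^bsub>A\<^esub>" if "u \<in> carrier Q" for u
    using that by (intro hom_one[of _ A A]) (auto simp: hom_def act_A_mult A.is_group)
  have "A_part (s g \<otimes>\<^bsub>G\<^esub> (s h \<otimes>\<^bsub>G\<^esub> s k)) = A_part (s g \<otimes>\<^bsub>G\<^esub> s h \<otimes>\<^bsub>G\<^esub> s k)"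
    using assms by (simp add: G.m_assoc)
  then show ?thesis
    using assms by (simp add: A_part_mult one)
qed

lemma \<beta>_cochain: "\<beta> \<in> carrier (cochains 2 Q A)"
  unfolding carrier_cochains
proof (rule PiE_I)
  show "\<beta> xs \<in> carrier A" if "xs \<in> tuples 2 Q" for xs
    using that by (auto elim!: tuples_2E)
qed (simp add: \<beta>_def)

lemma \<beta>_cocycle: "\<beta> \<in> cocycles 2 Q A act"
  unfolding group_module.cocycles_2_iff[OF group_module_act] using \<beta>_cochain \<beta>_cocycle_eq by blast

section \<open>Characters and the cup product with the extension class\<close>

lemma group_module_dual: "group_module Q (dual A) dual_act"
  by (rule group_module_dual_action[OF group_module_act])

section \<open>Crossed homomorphisms into the dual group\<close>

lemma Z1_dual_iff:
  "\<pi> \<in> Z1_dual \<longleftrightarrow> \<pi> \<in> carrier (cochains 1 Q (dual A)) \<and>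
    (\<forall>g \<in> carrier Q. \<forall>h \<in> carrier Q. \<forall>a \<in> carrier A.
      \<pi> [g \<otimes>\<^bsub>Q\<^esub> h] a = \<pi> [g] a * \<pi> [h] (act (inv\<^bsub>Q\<^esub> g) a))"
proof (cases "\<pi> \<in> carrier (cochains 1 Q (dual A))")
  case \<pi>: True
  have ext: "\<pi> [g] \<in> extensional (carrier A)" if "g \<in> carrier Q" for g
    using cochain_closed[OF \<pi>] that by (simp add: dual_carrier_iff)
  have "\<pi> [g \<otimes>\<^bsub>Q\<^esub> h] = \<pi> [g] \<otimes>\<^bsub>dual A\<^esub> dual_act g (\<pi> [h]) \<longleftrightarrow>
      (\<forall>a \<in> carrier A. \<pi> [g \<otimes>\<^bsub>Q\<^esub> h] a = \<pi> [g] a * \<pi> [h] (act (inv\<^bsub>Q\<^esub> g) a))"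
    if "g \<in> carrier Q" "h \<in> carrier Q" for g h
    using that by (auto simp: dual_mult dual_action_def intro: extensionalityI[OF ext])
  then show ?thesis
    using \<pi> unfolding Z1_dual_def group_module.cocycles_1_iff[OF group_module_dual] by simp
qed (unfold Z1_dual_def group_module.cocycles_1_iff[OF group_module_dual], simp)

lemma Z1_dual_cochain: "\<pi> \<in> Z1_dual \<Longrightarrow> \<pi> \<in> carrier (cochains 1 Q (dual A))"
  by (simp add: Z1_dual_iff)

context
  fixes \<pi> assumes \<pi>: "\<pi> \<in> Z1_dual"
begin

lemma Z1_dual_mult:
  "g \<in> carrier Q \<Longrightarrow> h \<in> carrier Q \<Longrightarrow> a \<in> carrier A \<Longrightarrow>
    \<pi> [g \<otimes>\<^bsub>Q\<^esub> h] a = \<pi> [g] a * \<pi> [h] (act (inv\<^bsub>Q\<^esub> g) a)"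
  using \<pi> by (simp add: Z1_dual_iff)

lemma Z1_dual_char: "g \<in> carrier Q \<Longrightarrow> \<pi> [g] \<in> carrier (dual A)"
  using cochain_closed[OF Z1_dual_cochain[OF \<pi>]] by simp

lemma Z1_dual_nz: "g \<in> carrier Q \<Longrightarrow> a \<in> carrier A \<Longrightarrow> \<pi> [g] a \<noteq> 0"
  using Z1_dual_char by (simp add: dual_carrier_iff)

lemma Z1_dual_hom: "g \<in> carrier Q \<Longrightarrow> a \<in> carrier A \<Longrightarrow> b \<in> carrier A \<Longrightarrow>
    \<pi> [g] (a \<otimes>\<^bsub>A\<^esub> b) = \<pi> [g] a * \<pi> [g] b"
  using Z1_dual_char by (simp add: dual_carrier_iff)

lemma Z1_dual_one: "a \<in> carrier A \<Longrightarrow> \<pi> [\<one>\<^bsub>Q\<^esub>] a = 1"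
  using Z1_dual_mult[of "\<one>\<^bsub>Q\<^esub>" "\<one>\<^bsub>Q\<^esub>" a] Z1_dual_nz[of "\<one>\<^bsub>Q\<^esub>" a] by simp

lemma Z1_dual_one_A: "g \<in> carrier Q \<Longrightarrow> \<pi> [g] \<one>\<^bsub>A\<^esub> = 1"
  using Z1_dual_hom[of g "\<one>\<^bsub>A\<^esub>" "\<one>\<^bsub>A\<^esub>"] Z1_dual_nz[of g "\<one>\<^bsub>A\<^esub>"] by simp

text \<open>The crossed homomorphism rule for \<open>inv g \<otimes> g\<close>. It reconciles the
  two formulas for \<open>c\<pi>\<close>, one with an inverted value at \<open>g\<close> and one
  with a value at \<open>inv g\<close>.\<close>

lemma Z1_dual_inv:
  assumes "g \<in> carrier Q" "a \<in> carrier A"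
  shows "\<pi> [inv\<^bsub>Q\<^esub> g] a = inverse (\<pi> [g] (act g a))"
proof -
  have "\<pi> [inv\<^bsub>Q\<^esub> g] a * \<pi> [g] (act g a) = 1"
    using assms Z1_dual_mult[of "inv\<^bsub>Q\<^esub> g" g a] by (simp add: Z1_dual_one)
  then show ?thesis
    by (simp add: inverse_unique mult.commute)
qed

end

lemma class1_eq_iff:
  assumes "\<pi> \<in> Z1_dual" "\<pi>' \<in> Z1_dual"
  shows "class1 \<pi> = class1 \<pi>' \<longleftrightarrow> (\<exists>\<chi> \<in> carrier (dual A). \<forall>g \<in> carrier Q. \<forall>a \<in> carrier A.
    \<pi> [g] a * \<chi> a = \<chi> (act (inv\<^bsub>Q\<^esub> g) a) * \<pi>' [g] a)"
proof -
  have "\<pi> [g] \<otimes>\<^bsub>dual A\<^esub> \<chi> = dual_act g \<chi> \<otimes>\<^bsub>dual A\<^esub> \<pi>' [g] \<longleftrightarrow>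
      (\<forall>a \<in> carrier A. \<pi> [g] a * \<chi> a = \<chi> (act (inv\<^bsub>Q\<^esub> g) a) * \<pi>' [g] a)"
    if "g \<in> carrier Q" for g \<chi>
    using that by (auto simp: dual_mult dual_action_def fun_eq_iff)
  then show ?thesis
    unfolding class1_def
    by (subst group_module.coclass_1_eq_iff[OF group_module_dual])
      (use assms in \<open>simp_all add: Z1_dual_iff\<close>)
qed

section \<open>The cup product and its independence of representatives\<close>

lemma cup_cochain_apply:
  "g \<in> carrier Q \<Longrightarrow> h \<in> carrier Q \<Longrightarrow> k \<in> carrier Q \<Longrightarrow>
    cup_cochain b \<pi> [g, h, k] = \<pi> [g] (act g (b [h, k]))"
  by (simp add: cup_cochain_def)

lemma cup_cochain_closed:
  assumes "b \<in> carrier (cochains 2 Q A)" "\<pi> \<in> Z1_dual"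
  shows "cup_cochain b \<pi> \<in> carrier (cochains 3 Q Cstar)"
proof -
  have "\<pi> [g] (act g (b [h, k])) \<noteq> 0" if "g \<in> carrier Q" "h \<in> carrier Q" "k \<in> carrier Q" for g h k
    using that cochain_closed[OF assms(1)] by (simp add: Z1_dual_nz[OF assms(2)])
  then show ?thesis
    unfolding cup_cochain_def by (intro restrict_cochain) (auto elim!: tuples_3E)
qed

lemma cup_cochain_cong_right:
  assumes b: "b \<in> cocycles 2 Q A act" and \<pi>: "\<pi> \<in> Z1_dual" and \<pi>': "\<pi>' \<in> Z1_dual"
    and "class1 \<pi> = class1 \<pi>'"
  shows "coclass 3 Q Cstar trivial_action (cup_cochain b \<pi>) =
    coclass 3 Q Cstar trivial_action (cup_cochain b \<pi>')"
proof -
  from b have bc: "b \<in> carrier (cochains 2 Q A)"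
    and b_eq: "\<And>g h k. g \<in> carrier Q \<Longrightarrow> h \<in> carrier Q \<Longrightarrow> k \<in> carrier Q \<Longrightarrow>
      act g (b [h, k]) \<otimes>\<^bsub>A\<^esub> b [g, h \<otimes>\<^bsub>Q\<^esub> k] = b [g, h] \<otimes>\<^bsub>A\<^esub> b [g \<otimes>\<^bsub>Q\<^esub> h, k]"
    by (auto simp: group_module.cocycles_2_iff[OF group_module_act])
  have b_cl: "b [g, h] \<in> carrier A" if "g \<in> carrier Q" "h \<in> carrier Q" for g h
    using cochain_closed[OF bc] that by simp
  from assms obtain \<chi> where \<chi>: "\<chi> \<in> carrier (dual A)"
    and eq: "\<And>g a. g \<in> carrier Q \<Longrightarrow> a \<in> carrier A \<Longrightarrow>
      \<pi> [g] a * \<chi> a = \<chi> (act (inv\<^bsub>Q\<^esub> g) a) * \<pi>' [g] a"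
    by (auto simp: class1_eq_iff)
  have nz: "\<chi> a \<noteq> 0" if "a \<in> carrier A" for a
    using \<chi> that by (simp add: dual_carrier_iff)
  have \<chi>_mult: "\<chi> (a \<otimes>\<^bsub>A\<^esub> a') = \<chi> a * \<chi> a'" if "a \<in> carrier A" "a' \<in> carrier A" for a a'
    using \<chi> that by (simp add: dual_carrier_iff)
  show ?thesis
  \<comment> \<open>The witness \<open>\<chi> (b [g, h])\<close> is the cup product of
    \<open>b\<close> with the degree 0 cochain \<open>\<chi>\<close>. As \<open>b\<close> is a
    cocycle, its coboundary is the cup product of \<open>b\<close> with the coboundary of
    \<open>\<chi>\<close>.\<close>
  proof (rule coclass_3_Cstar_eqI[OF Q.is_group cup_cochain_closed[OF bc \<pi>] cup_cochain_closed[OF bc \<pi>'],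
        where e = "\<lambda>g h. \<chi> (b [g, h])"])
    show "\<chi> (b [g, h]) \<noteq> 0" if "g \<in> carrier Q" "h \<in> carrier Q" for g h
      using that nz b_cl by simp
    fix g h k assume ghk: "g \<in> carrier Q" "h \<in> carrier Q" "k \<in> carrier Q"
    have "\<chi> (act g (b [h, k])) * \<chi> (b [g, h \<otimes>\<^bsub>Q\<^esub> k]) = \<chi> (b [g, h]) * \<chi> (b [g \<otimes>\<^bsub>Q\<^esub> h, k])"
      using b_eq[OF ghk] ghk b_cl by (simp flip: \<chi>_mult)
    moreover have "\<pi> [g] (act g (b [h, k])) * \<chi> (act g (b [h, k])) =
        \<chi> (b [h, k]) * \<pi>' [g] (act g (b [h, k]))"
      using eq[of g "act g (b [h, k])"] ghk b_cl by simp
    ultimately show "cup_cochain b \<pi> [g, h, k] * \<chi> (b [g \<otimes>\<^bsub>Q\<^esub> h, k]) * \<chi> (b [g, h]) =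
        \<chi> (b [h, k]) * \<chi> (b [g, h \<otimes>\<^bsub>Q\<^esub> k]) * cup_cochain b \<pi>' [g, h, k]"
      unfolding cup_cochain_apply[OF ghk] by algebra
  qed
qed

lemma cup_cochain_cong_left:
  assumes b: "b \<in> carrier (cochains 2 Q A)" and b': "b' \<in> carrier (cochains 2 Q A)"
    and \<pi>: "\<pi> \<in> Z1_dual" and "coclass 2 Q A act b = coclass 2 Q A act b'"
  shows "coclass 3 Q Cstar trivial_action (cup_cochain b \<pi>) =
    coclass 3 Q Cstar trivial_action (cup_cochain b' \<pi>)"
proof -
  obtain f where f_cl: "\<And>g. g \<in> carrier Q \<Longrightarrow> f g \<in> carrier A"
    and b_eq: "\<And>g h. g \<in> carrier Q \<Longrightarrow> h \<in> carrier Q \<Longrightarrow>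
      b [g, h] \<otimes>\<^bsub>A\<^esub> f (g \<otimes>\<^bsub>Q\<^esub> h) = act g (f h) \<otimes>\<^bsub>A\<^esub> f g \<otimes>\<^bsub>A\<^esub> b' [g, h]"
    by (rule group_module.coclass_2_eqE[OF group_module_act assms(4) b b']) blast
  have b_cl: "b [g, h] \<in> carrier A" "b' [g, h] \<in> carrier A" if "g \<in> carrier Q" "h \<in> carrier Q" for g h
    using cochain_closed[OF b] cochain_closed[OF b'] that by simp_all
  note nz = Z1_dual_nz[OF \<pi>] and \<pi>_A = Z1_dual_hom[OF \<pi>]
  show ?thesis
  \<comment> \<open>The witness is the cup product of \<open>\<pi>\<close> with the 1-cochain
    \<open>f\<close> linking \<open>b\<close> and \<open>b'\<close>. The inverse is the sign in the
    Leibniz rule for moving the differential past the degree 1 factor \<open>\<pi>\<close>.\<close>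
  proof (rule coclass_3_Cstar_eqI[OF Q.is_group cup_cochain_closed[OF b \<pi>] cup_cochain_closed[OF b' \<pi>],
        where e = "\<lambda>g h. inverse (\<pi> [g] (act g (f h)))"])
    show "inverse (\<pi> [g] (act g (f h))) \<noteq> 0" if "g \<in> carrier Q" "h \<in> carrier Q" for g h
      using that nz f_cl by simp
    fix g h k assume ghk: "g \<in> carrier Q" "h \<in> carrier Q" "k \<in> carrier Q"
    have "\<pi> [g] (act g (b [h, k] \<otimes>\<^bsub>A\<^esub> f (h \<otimes>\<^bsub>Q\<^esub> k))) = \<pi> [g] (act g (act h (f k) \<otimes>\<^bsub>A\<^esub> f h \<otimes>\<^bsub>A\<^esub> b' [h, k]))"
      using b_eq ghk by simp
    then have 1: "\<pi> [g] (act g (b [h, k])) * \<pi> [g] (act g (f (h \<otimes>\<^bsub>Q\<^esub> k))) =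
        \<pi> [g] (act g (act h (f k))) * \<pi> [g] (act g (f h)) * \<pi> [g] (act g (b' [h, k]))"
      using ghk f_cl b_cl by (simp add: act_A_mult \<pi>_A)
    have 2: "\<pi> [g \<otimes>\<^bsub>Q\<^esub> h] (act (g \<otimes>\<^bsub>Q\<^esub> h) (f k)) = \<pi> [g] (act g (act h (f k))) * \<pi> [h] (act h (f k))"
      using ghk f_cl by (simp add: Z1_dual_mult[OF \<pi>] act_mult)
    have "\<pi> [g] (act g (f (h \<otimes>\<^bsub>Q\<^esub> k))) \<noteq> 0" "\<pi> [g] (act g (act h (f k))) \<noteq> 0"
      "\<pi> [g] (act g (f h)) \<noteq> 0" "\<pi> [h] (act h (f k)) \<noteq> 0"
      using ghk nz f_cl by simp_all
    with 1 show "cup_cochain b \<pi> [g, h, k] * inverse (\<pi> [g \<otimes>\<^bsub>Q\<^esub> h] (act (g \<otimes>\<^bsub>Q\<^esub> h) (f k))) *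
          inverse (\<pi> [g] (act g (f h))) =
        inverse (\<pi> [h] (act h (f k))) * inverse (\<pi> [g] (act g (f (h \<otimes>\<^bsub>Q\<^esub> k)))) * cup_cochain b' \<pi> [g, h, k]"
      unfolding cup_cochain_apply[OF ghk] 2 by (simp add: divide_simps mult_ac)
  qed
qed

lemma cup_eq:
  assumes \<pi>: "\<pi> \<in> Z1_dual"
  shows "cup (coclass 2 Q A act \<beta>) (class1 \<pi>) = coclass 3 Q Cstar trivial_action (cup_cochain \<beta> \<pi>)"
proof -
  have "coclass 3 Q Cstar trivial_action (cup_cochain b \<pi>') =
      coclass 3 Q Cstar trivial_action (cup_cochain \<beta> \<pi>)"
    if "b \<in> cocycles 2 Q A act" "coclass 2 Q A act b = coclass 2 Q A act \<beta>"
      "\<pi>' \<in> Z1_dual" "class1 \<pi>' = class1 \<pi>" for b \<pi>'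
    using that \<beta>_cochain \<beta>_cocycle \<pi> group_module.cocycles_closed[OF group_module_act]
      cup_cochain_cong_left[of b \<beta> \<pi>'] cup_cochain_cong_right[of \<beta> \<pi>' \<pi>] by simp
  then have "{coclass 3 Q Cstar trivial_action (cup_cochain b \<pi>') | b \<pi>'. b \<in> cocycles 2 Q A act \<and>
      coclass 2 Q A act b = coclass 2 Q A act \<beta> \<and> \<pi>' \<in> Z1_dual \<and> class1 \<pi>' = class1 \<pi>} =
      {coclass 3 Q Cstar trivial_action (cup_cochain \<beta> \<pi>)}"
    using \<beta>_cocycle \<pi> by blast
  then show ?thesis by (simp add: cup_def)
qed

section \<open>Admissible cochains and the subgroup \<open>K\<beta>\<close>\<close>

lemma admissible_\<zeta>_iff:
  assumes "\<pi> \<in> Z1_dual"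
  shows "\<zeta> \<in> admissible_\<zeta> \<pi> \<longleftrightarrow> \<zeta> \<in> carrier (cochains 2 Q Cstar) \<and>
    (\<forall>g \<in> carrier Q. \<forall>h \<in> carrier Q. \<forall>k \<in> carrier Q. \<zeta> [h, k] * \<zeta> [g, h \<otimes>\<^bsub>Q\<^esub> k] =
      \<pi> [g] (act g (\<beta> [h, k])) * \<zeta> [g \<otimes>\<^bsub>Q\<^esub> h, k] * \<zeta> [g, h])"
  using coboundary_2_Cstar_eq_iff[OF Q.is_group _ cup_cochain_closed[OF \<beta>_cochain assms]]
  by (auto simp: admissible_\<zeta>_def cup_cochain_apply)

lemma carrier_H1_dual: "carrier H1_dual = class1 ` Z1_dual"
  by (simp add: H1_dual_def class1_def[abs_def] Z1_dual_def
      group_module.carrier_cohomology[OF group_module_dual])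

text \<open>The cup product class vanishes exactly when its representative is a coboundary, that is,
  when some \<open>\<zeta>\<close> exists. As this applies to every \<open>\<pi>\<close> in the
  class, a choice of \<open>\<zeta>\<close> is possible for each representative.\<close>

lemma class1_in_K\<beta>_iff:
  assumes "\<pi> \<in> Z1_dual"
  shows "class1 \<pi> \<in> carrier K\<beta> \<longleftrightarrow> admissible_\<zeta> \<pi> \<noteq> {}"
proof -
  interpret QC: group_module Q Cstar trivial_action by (rule group_module_Cstar[OF Q.is_group])
  have "class1 \<pi> \<in> carrier K\<beta> \<longleftrightarrow> cup_cochain \<beta> \<pi> \<in> coboundaries 3 Q Cstar trivial_action"
    using assms
    by (simp add: K\<beta>_def carrier_H1_dual cup_eq QC.one_cohomology
        QC.coclass_eq_coboundaries_iff[OF cup_cochain_closed[OF \<beta>_cochain]])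
  moreover have "coboundaries 3 Q Cstar trivial_action =
      coboundary 2 Q Cstar trivial_action ` carrier (cochains 2 Q Cstar)"
    by (simp add: coboundaries_def numeral_3_eq_3 numeral_2_eq_2)
  ultimately show ?thesis
    unfolding admissible_\<zeta>_def by (simp only: image_iff) (metis (mono_tags, lifting) empty_Collect_eq)
qed

lemma carrier_K\<beta>: "carrier K\<beta> = class1 ` {\<pi> \<in> Z1_dual. admissible_\<zeta> \<pi> \<noteq> {}}"
proof -
  have "carrier K\<beta> \<subseteq> class1 ` Z1_dual"
    by (auto simp: K\<beta>_def carrier_H1_dual)
  then show ?thesis using class1_in_K\<beta>_iff by auto
qed

lemma comm_group_H1_dual: "comm_group H1_dual"
  unfolding H1_dual_def
  by (rule group_module.comm_group_cohomology[OF group_module_dual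
        group_module.coboundaries_1_subset[OF group_module_dual]])

lemma Z1_dual_mult_closed:
  assumes "\<pi> \<in> Z1_dual" "\<pi>' \<in> Z1_dual"
  shows "\<pi> \<otimes>\<^bsub>cochains 1 Q (dual A)\<^esub> \<pi>' \<in> Z1_dual"
  using subgroup.m_closed[OF group_module.subgroup_cocycles[OF group_module_dual]] assms
  by (simp add: Z1_dual_def)

lemma class1_mult:
  assumes "\<pi> \<in> Z1_dual" "\<pi>' \<in> Z1_dual"
  shows "class1 (\<pi> \<otimes>\<^bsub>cochains 1 Q (dual A)\<^esub> \<pi>') = class1 \<pi> \<otimes>\<^bsub>H1_dual\<^esub> class1 \<pi>'"
  using assms unfolding H1_dual_def class1_def Z1_dual_def
  by (rule group_module.coclass_mult[OF group_module_dual
        group_module.coboundaries_1_subset[OF group_module_dual]])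

lemma mult_cochains_dual:
  "g \<in> carrier Q \<Longrightarrow> a \<in> carrier A \<Longrightarrow>
    (\<pi> \<otimes>\<^bsub>cochains 1 Q (dual A)\<^esub> \<pi>') [g] a = \<pi> [g] a * \<pi>' [g] a"
  by (simp add: mult_cochains dual_mult)

lemma admissible_\<zeta>_mult:
  assumes "\<pi> \<in> Z1_dual" "\<pi>' \<in> Z1_dual" "\<zeta> \<in> admissible_\<zeta> \<pi>" "\<zeta>' \<in> admissible_\<zeta> \<pi>'"
  shows "\<zeta> \<otimes>\<^bsub>cochains 2 Q Cstar\<^esub> \<zeta>' \<in> admissible_\<zeta> (\<pi> \<otimes>\<^bsub>cochains 1 Q (dual A)\<^esub> \<pi>')"
  unfolding admissible_\<zeta>_iff[OF Z1_dual_mult_closed[OF assms(1,2)]]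
proof (intro conjI ballI)
  note \<zeta> = assms(3)[unfolded admissible_\<zeta>_iff[OF assms(1)]]
  note \<zeta>' = assms(4)[unfolded admissible_\<zeta>_iff[OF assms(2)]]
  show "\<zeta> \<otimes>\<^bsub>cochains 2 Q Cstar\<^esub> \<zeta>' \<in> carrier (cochains 2 Q Cstar)"
    unfolding mult_cochains using \<zeta> \<zeta>' by (intro restrict_cochain) (auto simp: cochain_nz)
  fix g h k assume ghk: "g \<in> carrier Q" "h \<in> carrier Q" "k \<in> carrier Q"
  have "\<zeta> [h, k] * \<zeta> [g, h \<otimes>\<^bsub>Q\<^esub> k] = \<pi> [g] (act g (\<beta> [h, k])) * \<zeta> [g \<otimes>\<^bsub>Q\<^esub> h, k] * \<zeta> [g, h]"
    "\<zeta>' [h, k] * \<zeta>' [g, h \<otimes>\<^bsub>Q\<^esub> k] = \<pi>' [g] (act g (\<beta> [h, k])) * \<zeta>' [g \<otimes>\<^bsub>Q\<^esub> h, k] * \<zeta>' [g, h]"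
    using ghk \<zeta> \<zeta>' by simp_all
  then show "(\<zeta> \<otimes>\<^bsub>cochains 2 Q Cstar\<^esub> \<zeta>') [h, k] * (\<zeta> \<otimes>\<^bsub>cochains 2 Q Cstar\<^esub> \<zeta>') [g, h \<otimes>\<^bsub>Q\<^esub> k] =
      (\<pi> \<otimes>\<^bsub>cochains 1 Q (dual A)\<^esub> \<pi>') [g] (act g (\<beta> [h, k])) *
      (\<zeta> \<otimes>\<^bsub>cochains 2 Q Cstar\<^esub> \<zeta>') [g \<otimes>\<^bsub>Q\<^esub> h, k] * (\<zeta> \<otimes>\<^bsub>cochains 2 Q Cstar\<^esub> \<zeta>') [g, h]"
    using ghk by (simp only: mult_cochains_Cstar tuples_2_iff mult_cochains_dual act_closed \<beta>_closed
        Q.m_closed simp_thms) algebra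
qed

text \<open>Closure is checked on witnesses: cup products with \<open>\<beta>\<close> are
  multiplicative in \<open>\<pi>\<close>, so admissible cochains can be multiplied and inverted
  pointwise. No group structure on the third cohomology enters.\<close>

lemma subgroup_K\<beta>: "subgroup (carrier K\<beta>) H1_dual"
proof -
  interpret H1: comm_group H1_dual by (rule comm_group_H1_dual)
  interpret QD: group_module Q "dual A" dual_act by (rule group_module_dual)
  have mult: "U \<otimes>\<^bsub>H1_dual\<^esub> V \<in> carrier K\<beta>" if "U \<in> carrier K\<beta>" "V \<in> carrier K\<beta>" for U V
  proof -
    from that obtain \<pi> \<pi>' \<zeta> \<zeta>' where \<pi>: "\<pi> \<in> Z1_dual" "\<pi>' \<in> Z1_dual"
      and "\<zeta> \<in> admissible_\<zeta> \<pi>" "\<zeta>' \<in> admissible_\<zeta> \<pi>'" and UV: "U = class1 \<pi>" "V = class1 \<pi>'"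
      by (auto simp: carrier_K\<beta>)
    then have "admissible_\<zeta> (\<pi> \<otimes>\<^bsub>cochains 1 Q (dual A)\<^esub> \<pi>') \<noteq> {}"
      using admissible_\<zeta>_mult by blast
    then show ?thesis
      using class1_in_K\<beta>_iff[OF Z1_dual_mult_closed[OF \<pi>]] by (simp only: UV class1_mult[OF \<pi>] simp_thms)
  qed
  show ?thesis
  proof (rule H1.subgroupI)
    show sub: "carrier K\<beta> \<subseteq> carrier H1_dual"
      by (auto simp: K\<beta>_def)
    define e where "e = \<one>\<^bsub>cochains 1 Q (dual A)\<^esub>"
    have e: "e \<in> Z1_dual"
      unfolding e_def Z1_dual_def by (rule subgroup.one_closed[OF QD.subgroup_cocycles])
    have "(\<lambda>xs \<in> tuples 2 Q. 1) \<in> admissible_\<zeta> e"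
      unfolding admissible_\<zeta>_iff[OF e]
      by (auto simp: restrict_cochain e_def one_cochains dual_one)
    with e show "carrier K\<beta> \<noteq> {}"
      by (auto simp: carrier_K\<beta>)
    fix U assume "U \<in> carrier K\<beta>"
    then obtain \<pi> \<zeta> where \<pi>: "\<pi> \<in> Z1_dual" and U: "U = class1 \<pi>" and \<zeta>: "\<zeta> \<in> admissible_\<zeta> \<pi>"
      by (auto simp: carrier_K\<beta>)
    interpret CD: comm_group "cochains 1 Q (dual A)" by (rule QD.cochains_comm_group)
    define \<pi>' where "\<pi>' = inv\<^bsub>cochains 1 Q (dual A)\<^esub> \<pi>"
    have \<pi>': "\<pi>' \<in> Z1_dual"
      using subgroup.m_inv_closed[OF QD.subgroup_cocycles] \<pi> by (simp add: \<pi>'_def Z1_dual_def)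
    have "class1 \<pi>' \<otimes>\<^bsub>H1_dual\<^esub> class1 \<pi> = class1 e"
      unfolding class1_mult[OF \<pi>' \<pi>, symmetric] by (simp only: e_def \<pi>'_def CD.l_inv[OF Z1_dual_cochain[OF \<pi>]])
    also have "\<dots> = \<one>\<^bsub>H1_dual\<^esub>"
      unfolding class1_def H1_dual_def QD.one_cohomology e_def
      by (rule QD.coclass_eq_coboundaries_iff[THEN iffD2, OF CD.one_closed
            subgroup.one_closed[OF QD.subgroup_coboundaries]])
    finally have inv: "inv\<^bsub>H1_dual\<^esub> U = class1 \<pi>'"
      using \<pi> \<pi>' by (intro H1.inv_equality) (auto simp: U carrier_H1_dual)
    have \<pi>'_eq: "\<pi>' [g] a = inverse (\<pi> [g] a)" if "g \<in> carrier Q" "a \<in> carrier A" for g a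
      using that Z1_dual_char[OF \<pi>] Z1_dual_cochain[OF \<pi>]
      by (simp add: \<pi>'_def inv_cochains QD.M.is_group inv_dual A.is_group)
    note \<zeta>' = \<zeta>[unfolded admissible_\<zeta>_iff[OF \<pi>]]
    have "(\<lambda>xs \<in> tuples 2 Q. inverse (\<zeta> xs)) \<in> admissible_\<zeta> \<pi>'"
      unfolding admissible_\<zeta>_iff[OF \<pi>']
    proof (intro conjI ballI restrict_cochain)
      show "inverse (\<zeta> xs) \<noteq> 0" if "xs \<in> tuples 2 Q" for xs
        using \<zeta>' that by (auto simp: cochain_nz)
    qed (use \<zeta>' in \<open>simp add: \<pi>'_eq flip: inverse_mult_distrib\<close>)
    then show "inv\<^bsub>H1_dual\<^esub> U \<in> carrier K\<beta>"
      using \<pi>' by (auto simp: inv carrier_K\<beta>)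
  qed (rule mult)
qed

lemma comm_group_K\<beta>: "comm_group K\<beta>"
  using comm_group_subgroup[OF comm_group_H1_dual subgroup_K\<beta>] by (simp add: K\<beta>_def)

section \<open>The kernel of restriction modulo inflated classes\<close>

lemma Z2_G_iff:
  "c \<in> Z2_G \<longleftrightarrow> c \<in> carrier (cochains 2 G Cstar) \<and>
    (\<forall>x \<in> carrier G. \<forall>y \<in> carrier G. \<forall>z \<in> carrier G.
      c [y, z] * c [x, y \<otimes>\<^bsub>G\<^esub> z] = c [x \<otimes>\<^bsub>G\<^esub> y, z] * c [x, y])"
  unfolding Z2_G_def by (rule cocycles_2_Cstar_iff[OF G.is_group])

lemma Z2_G_cochain: "c \<in> Z2_G \<Longrightarrow> c \<in> carrier (cochains 2 G Cstar)"
  by (simp add: Z2_G_iff)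

lemma Z2_G_nz: "c \<in> Z2_G \<Longrightarrow> x \<in> carrier G \<Longrightarrow> y \<in> carrier G \<Longrightarrow> c [x, y] \<noteq> 0"
  using cochain_nz[OF Z2_G_cochain] by simp

lemma Z2_G_eq: "c \<in> Z2_G \<Longrightarrow> x \<in> carrier G \<Longrightarrow> y \<in> carrier G \<Longrightarrow> z \<in> carrier G \<Longrightarrow>
    c [y, z] * c [x, y \<otimes>\<^bsub>G\<^esub> z] = c [x \<otimes>\<^bsub>G\<^esub> y, z] * c [x, y]"
  by (simp add: Z2_G_iff)

lemma Z2_G_mult: "c \<in> Z2_G \<Longrightarrow> d \<in> Z2_G \<Longrightarrow> c \<otimes>\<^bsub>cochains 2 G Cstar\<^esub> d \<in> Z2_G"
  unfolding Z2_G_def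
  by (rule subgroup.m_closed[OF group_module.subgroup_cocycles[OF group_module_Cstar[OF G.is_group]]])

lemma class2_mult:
  "c \<in> Z2_G \<Longrightarrow> d \<in> Z2_G \<Longrightarrow>
    class2 (c \<otimes>\<^bsub>cochains 2 G Cstar\<^esub> d) = class2 c \<otimes>\<^bsub>H2_G\<^esub> class2 d"
  unfolding Z2_G_def class2_def H2_G_def by (rule coclass_2_Cstar_mult[OF G.is_group])

lemma carrier_H2_G: "carrier H2_G = class2 ` Z2_G"
  by (simp add: H2_G_def class2_def[abs_def] Z2_G_def
      group_module.carrier_cohomology[OF group_module_Cstar[OF G.is_group]])

lemma comm_group_H2_G: "comm_group H2_G"
  unfolding H2_G_def by (rule comm_group_H2_Cstar[OF G.is_group])

lemma class2_eq_iff: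
  assumes "c \<in> Z2_G" "d \<in> Z2_G"
  shows "class2 c = class2 d \<longleftrightarrow> (\<exists>h. (\<forall>x \<in> carrier G. h x \<noteq> 0) \<and>
    (\<forall>x \<in> carrier G. \<forall>y \<in> carrier G. c [x, y] * h (x \<otimes>\<^bsub>G\<^esub> y) = h x * h y * d [x, y]))"
  unfolding class2_def
  by (rule coclass_2_Cstar_eq_iff[OF G.is_group Z2_G_cochain[OF assms(1)] Z2_G_cochain[OF assms(2)]])

lemma subgroup_ker_res: "subgroup ker_res H2_G"
  unfolding ker_res_def H2_G_def res_def
  by (rule group_hom.subgroup_kernel[OF group_hom_cohomology_map_2[OF A.is_group G.is_group \<iota>_hom]])

lemma class2_in_ker_res_iff:
  assumes "c \<in> Z2_G"
  shows "class2 c \<in> ker_res \<longleftrightarrow> (\<exists>h. (\<forall>a \<in> carrier A. h a \<noteq> 0) \<and>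
    (\<forall>a \<in> carrier A. \<forall>b \<in> carrier A. c [\<iota> a, \<iota> b] * h (a \<otimes>\<^bsub>A\<^esub> b) = h a * h b))"
proof -
  interpret AC: group_module A Cstar trivial_action by (rule group_module_Cstar[OF A.is_group])
  note c = Z2_G_cochain[OF assms]
  have pc: "pullback 2 A \<iota> c \<in> carrier (cochains 2 A Cstar)"
    by (rule pullback_cochain[OF \<iota>_hom c])
  have "class2 c \<in> ker_res \<longleftrightarrow> pullback 2 A \<iota> c \<in> coboundaries 2 A Cstar trivial_action"
    using assms carrier_H2_G cohomology_map_2_Cstar[OF A.is_group G.is_group \<iota>_hom c]
    by (simp add: ker_res_def kernel_def res_def class2_def AC.one_cohomology
        AC.coclass_eq_coboundaries_iff[OF pc])
  also have "\<dots> \<longleftrightarrow> (\<exists>h. (\<forall>a \<in> carrier A. h a \<noteq> 0) \<and>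
    (\<forall>a \<in> carrier A. \<forall>b \<in> carrier A. c [\<iota> a, \<iota> b] * h (a \<otimes>\<^bsub>A\<^esub> b) = h a * h b))"
    by (simp add: coboundaries_2_Cstar_iff[OF A.is_group pc] pullback_2_apply)
  finally show ?thesis .
qed

lemma ker_resE:
  assumes "U \<in> ker_res"
  obtains c where "c \<in> Z2_G" "U = class2 c"
  using assms carrier_H2_G by (auto simp: ker_res_def kernel_def)

section \<open>Inflated classes and the quotient by them\<close>

abbreviation Z2_Q :: "('q list \<Rightarrow> complex) set" where
  "Z2_Q \<equiv> cocycles 2 Q Cstar trivial_action"

lemma pullback_p_Z2: "w \<in> Z2_Q \<Longrightarrow> pullback 2 G p w \<in> Z2_G"
  unfolding Z2_G_def by (rule pullback_2_cocycle[OF G.is_group Q.is_group p_hom])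

lemma im_inf_eq: "im_inf = (\<lambda>w. class2 (pullback 2 G p w)) ` Z2_Q"
proof -
  interpret QC: group_module Q Cstar trivial_action by (rule group_module_Cstar[OF Q.is_group])
  show ?thesis
    using cohomology_map_2_Cstar[OF G.is_group Q.is_group p_hom QC.cocycles_closed]
    by (simp add: im_inf_def QC.carrier_cohomology image_image infl_def class2_def)
qed

lemma im_inf_subset: "im_inf \<subseteq> ker_res"
proof
  fix U assume "U \<in> im_inf"
  then obtain w where w: "w \<in> Z2_Q" and U: "U = class2 (pullback 2 G p w)"
    by (auto simp: im_inf_eq)
  have "w [\<one>\<^bsub>Q\<^esub>, \<one>\<^bsub>Q\<^esub>] \<noteq> 0"
    using w by (intro cochain_nz[of w 2 Q]) (auto simp: cocycles_2_Cstar_iff[OF Q.is_group])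
  then show "U \<in> ker_res"
    unfolding U class2_in_ker_res_iff[OF pullback_p_Z2[OF w]]
    \<comment> \<open>\<open>A\<close> maps to the identity of \<open>Q\<close>, so the inflated
      cocycle is the constant \<open>w [1, 1]\<close> on \<open>A\<close>, and that constant, taken
      as a 1-cochain, has it as coboundary.\<close>
    by (intro exI[of _ "\<lambda>_. w [\<one>\<^bsub>Q\<^esub>, \<one>\<^bsub>Q\<^esub>]"]) (simp add: pullback_def)
qed

lemma subgroup_im_inf: "subgroup im_inf H2_G"
proof -
  interpret infl: group_hom "cohomology 2 Q Cstar trivial_action" H2_G infl
    unfolding H2_G_def infl_def by (rule group_hom_cohomology_map_2[OF G.is_group Q.is_group p_hom])
  show ?thesis
    unfolding im_inf_def by (rule infl.img_is_subgroup)
qed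

lemma comm_group_ker_res: "comm_group (H2_G\<lparr>carrier := ker_res\<rparr>)"
  by (rule comm_group_subgroup[OF comm_group_H2_G subgroup_ker_res])

lemma subgroup_im_inf_ker_res: "subgroup im_inf (H2_G\<lparr>carrier := ker_res\<rparr>)"
  using group.subgroup_incl[OF _ subgroup_im_inf subgroup_ker_res im_inf_subset] comm_group_H2_G
  by (simp add: comm_group_def)

lemma comm_group_ker_res_mod_im_inf: "comm_group ker_res_mod_im_inf"
  unfolding ker_res_mod_im_inf_def
  by (rule comm_group.abelian_FactGroup[OF comm_group_ker_res subgroup_im_inf_ker_res])

lemma carrier_ker_res_mod_im_inf: "carrier ker_res_mod_im_inf = mod_im_inf ` ker_res"
  by (simp add: ker_res_mod_im_inf_def carrier_FactGroup mod_im_inf_def[abs_def])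

lemma mod_im_inf_mult:
  assumes "U \<in> ker_res" "V \<in> ker_res"
  shows "mod_im_inf (U \<otimes>\<^bsub>H2_G\<^esub> V) = mod_im_inf U \<otimes>\<^bsub>ker_res_mod_im_inf\<^esub> mod_im_inf V"
proof -
  interpret R: comm_group "H2_G\<lparr>carrier := ker_res\<rparr>" by (rule comm_group_ker_res)
  interpret I: normal im_inf "H2_G\<lparr>carrier := ker_res\<rparr>"
    by (rule R.subgroup_imp_normal[OF subgroup_im_inf_ker_res])
  show ?thesis
    using I.rcos_sum[of U V] assms by (simp add: mod_im_inf_def ker_res_mod_im_inf_def)
qed

text \<open>Resolves both quotients at once into an inflated cocycle \<open>w\<close> and the
  coboundary of \<open>h\<close>. Well-definedness of each of the two maps is reduced to this
  equation.\<close>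

lemma mod_im_inf_eq_iff:
  assumes c: "c \<in> Z2_G" "class2 c \<in> ker_res" and d: "d \<in> Z2_G" "class2 d \<in> ker_res"
  shows "mod_im_inf (class2 c) = mod_im_inf (class2 d) \<longleftrightarrow>
    (\<exists>w \<in> Z2_Q. \<exists>h. (\<forall>x \<in> carrier G. h x \<noteq> 0) \<and> (\<forall>x \<in> carrier G. \<forall>y \<in> carrier G.
      c [x, y] * h (x \<otimes>\<^bsub>G\<^esub> y) = h x * h y * (w [p x, p y] * d [x, y])))"
proof -
  interpret R: comm_group "H2_G\<lparr>carrier := ker_res\<rparr>" by (rule comm_group_ker_res)
  have "mod_im_inf (class2 c) = mod_im_inf (class2 d) \<longleftrightarrow> class2 c \<in> mod_im_inf (class2 d)"
    unfolding mod_im_inf_def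
    using R.rcos_self[of "class2 c", OF _ subgroup_im_inf_ker_res] c(2) d(2)
      R.repr_independence[OF _ _ subgroup_im_inf_ker_res, of "class2 c" "class2 d"] by auto
  also have "\<dots> \<longleftrightarrow> (\<exists>w \<in> Z2_Q. class2 c = class2 (pullback 2 G p w \<otimes>\<^bsub>cochains 2 G Cstar\<^esub> d))"
    using d(1) by (auto simp: mod_im_inf_def r_coset_def im_inf_eq class2_mult pullback_p_Z2)
  also have "\<dots> \<longleftrightarrow> (\<exists>w \<in> Z2_Q. \<exists>h. (\<forall>x \<in> carrier G. h x \<noteq> 0) \<and> (\<forall>x \<in> carrier G. \<forall>y \<in> carrier G.
      c [x, y] * h (x \<otimes>\<^bsub>G\<^esub> y) = h x * h y * (w [p x, p y] * d [x, y])))"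
    using c(1) d(1)
    by (intro bex_cong refl) (simp add: class2_eq_iff Z2_G_mult pullback_p_Z2 mult_cochains_Cstar pullback_2_apply)
  finally show ?thesis .
qed

section \<open>The map \<open>C\<close>\<close>

lemma c\<pi>_apply: "x \<in> carrier G \<Longrightarrow> y \<in> carrier G \<Longrightarrow>
    c\<pi> \<pi> \<zeta> [x, y] = inverse (\<pi> [p x] (act (p x) (A_part y))) * \<zeta> [p x, p y]"
  by (simp add: c\<pi>_def)

lemma c\<pi>_cochain:
  assumes "\<pi> \<in> Z1_dual" "\<zeta> \<in> carrier (cochains 2 Q Cstar)"
  shows "c\<pi> \<pi> \<zeta> \<in> carrier (cochains 2 G Cstar)"
  unfolding c\<pi>_def
  by (rule restrict_cochain)
    (use Z1_dual_nz[OF assms(1)] cochain_nz[OF assms(2)] in \<open>auto elim!: tuples_2E\<close>)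

text \<open>\<open>F\<close> is the cup product on \<open>G\<close> of the inflated
  \<open>\<pi>\<close> with the 1-cochain \<open>A_part\<close>. Since \<open>A_part\<close>
  trivializes the inflated \<open>\<beta>\<close> up to inversion, \<open>F\<close> has the inflated
  cup product of \<open>\<pi>\<close> and \<open>\<beta>\<close> as its coboundary.\<close>

lemma Z1_dual_A_part_cocycle:
  assumes \<pi>: "\<pi> \<in> Z1_dual" and xyz: "x \<in> carrier G" "y \<in> carrier G" "z \<in> carrier G"
  defines "F \<equiv> \<lambda>x y. \<pi> [p x] (act (p x) (A_part y))"
  shows "F y z * F x (y \<otimes>\<^bsub>G\<^esub> z) =
    \<pi> [p x] (act (p x) (\<beta> [p y, p z])) * (F (x \<otimes>\<^bsub>G\<^esub> y) z * F x y)"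
proof -
  have "F x (y \<otimes>\<^bsub>G\<^esub> z) = F x y * \<pi> [p x] (act (p x) (act (p y) (A_part z))) *
      \<pi> [p x] (act (p x) (\<beta> [p y, p z]))"
    using xyz by (simp add: F_def A_part_mult act_A_mult Z1_dual_hom[OF \<pi>])
  moreover have "F (x \<otimes>\<^bsub>G\<^esub> y) z = \<pi> [p x] (act (p x) (act (p y) (A_part z))) * F y z"
    using xyz by (simp add: F_def act_mult Z1_dual_mult[OF \<pi>])
  ultimately show ?thesis by simp
qed

text \<open>\<open>c\<pi> \<pi> \<zeta>\<close> is the inflation of \<open>\<zeta>\<close> divided
  by \<open>F\<close> of the preceding lemma, so it is a cocycle precisely when the inflation of
  \<open>\<zeta>\<close> has the same coboundary as \<open>F\<close>.\<close>

lemma c\<pi>_in_Z2_G_iff: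
  assumes \<pi>: "\<pi> \<in> Z1_dual" and \<zeta>: "\<zeta> \<in> carrier (cochains 2 Q Cstar)"
  shows "c\<pi> \<pi> \<zeta> \<in> Z2_G \<longleftrightarrow> \<zeta> \<in> admissible_\<zeta> \<pi>"
proof -
  have key: "c\<pi> \<pi> \<zeta> [y, z] * c\<pi> \<pi> \<zeta> [x, y \<otimes>\<^bsub>G\<^esub> z] = c\<pi> \<pi> \<zeta> [x \<otimes>\<^bsub>G\<^esub> y, z] * c\<pi> \<pi> \<zeta> [x, y] \<longleftrightarrow>
      \<zeta> [p y, p z] * \<zeta> [p x, p y \<otimes>\<^bsub>Q\<^esub> p z] =
        \<pi> [p x] (act (p x) (\<beta> [p y, p z])) * \<zeta> [p x \<otimes>\<^bsub>Q\<^esub> p y, p z] * \<zeta> [p x, p y]"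
    if xyz: "x \<in> carrier G" "y \<in> carrier G" "z \<in> carrier G" for x y z
  proof -
    have aux: "inverse F1 * Z1 * (inverse F2 * Z2) = inverse F3 * Z3 * (inverse F4 * Z4) \<longleftrightarrow>
        Z1 * Z2 = B * Z3 * Z4"
      if "F1 * F2 = B * (F3 * F4)" "F1 \<noteq> 0" "F2 \<noteq> 0" "F3 \<noteq> 0" "F4 \<noteq> 0" "B \<noteq> 0"
      for F1 F2 F3 F4 B Z1 Z2 Z3 Z4 :: complex
    proof -
      have "inverse F1 * Z1 * (inverse F2 * Z2) = Z1 * Z2 / (F1 * F2)"
        "inverse F3 * Z3 * (inverse F4 * Z4) = Z3 * Z4 / (F3 * F4)"
        by (simp_all add: field_simps)
      then show ?thesis
        unfolding that(1) using that by (simp add: divide_simps) (simp add: mult_ac)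
    qed
    show ?thesis
      unfolding c\<pi>_apply[OF xyz(1,2)] c\<pi>_apply[OF xyz(2,3)]
        c\<pi>_apply[OF xyz(1) G.m_closed[OF xyz(2,3)]] c\<pi>_apply[OF G.m_closed[OF xyz(1,2)] xyz(3)]
        p_mult[OF xyz(1,2)] p_mult[OF xyz(2,3)]
      by (rule aux) (use Z1_dual_A_part_cocycle[OF \<pi> xyz] xyz Z1_dual_nz[OF \<pi>] in simp_all)
  qed
  show ?thesis
  proof
    assume "c\<pi> \<pi> \<zeta> \<in> Z2_G"
    then have "\<zeta> [h, k] * \<zeta> [g, h \<otimes>\<^bsub>Q\<^esub> k] =
        \<pi> [g] (act g (\<beta> [h, k])) * \<zeta> [g \<otimes>\<^bsub>Q\<^esub> h, k] * \<zeta> [g, h]"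
      if "g \<in> carrier Q" "h \<in> carrier Q" "k \<in> carrier Q" for g h k
      \<comment> \<open>Evaluation at transversal elements reaches every triple of \<open>Q\<close>,
        so the condition on \<open>G\<close> descends to \<open>Q\<close>.\<close>
      using that key[of "s g" "s h" "s k"] Z2_G_eq[of "c\<pi> \<pi> \<zeta>" "s g" "s h" "s k"] by simp
    then show "\<zeta> \<in> admissible_\<zeta> \<pi>"
      using \<zeta> by (simp add: admissible_\<zeta>_iff[OF \<pi>])
  next
    assume "\<zeta> \<in> admissible_\<zeta> \<pi>"
    then show "c\<pi> \<pi> \<zeta> \<in> Z2_G"
      unfolding Z2_G_iff using key c\<pi>_cochain[OF \<pi> \<zeta>] by (simp add: admissible_\<zeta>_iff[OF \<pi>])
  qed
qed

lemma admissible_\<zeta>_cochain: "\<zeta> \<in> admissible_\<zeta> \<pi> \<Longrightarrow> \<zeta> \<in> carrier (cochains 2 Q Cstar)"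
  by (simp add: admissible_\<zeta>_def)

lemma c\<pi>_in_Z2_G: "\<pi> \<in> Z1_dual \<Longrightarrow> \<zeta> \<in> admissible_\<zeta> \<pi> \<Longrightarrow> c\<pi> \<pi> \<zeta> \<in> Z2_G"
  using c\<pi>_in_Z2_G_iff admissible_\<zeta>_cochain by blast

lemma c\<pi>_ker_res:
  assumes \<pi>: "\<pi> \<in> Z1_dual" and \<zeta>: "\<zeta> \<in> admissible_\<zeta> \<pi>"
  shows "class2 (c\<pi> \<pi> \<zeta>) \<in> ker_res"
proof -
  have "\<zeta> [\<one>\<^bsub>Q\<^esub>, \<one>\<^bsub>Q\<^esub>] \<noteq> 0"
    using cochain_nz[OF admissible_\<zeta>_cochain[OF \<zeta>]] by simp
  then show ?thesis
    unfolding class2_in_ker_res_iff[OF c\<pi>_in_Z2_G[OF \<pi> \<zeta>]]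
    by (intro exI[of _ "\<lambda>_. \<zeta> [\<one>\<^bsub>Q\<^esub>, \<one>\<^bsub>Q\<^esub>]"]) (simp add: c\<pi>_apply Z1_dual_one[OF \<pi>])
qed

text \<open>Independence of \<open>\<pi>\<close> and of \<open>\<zeta>\<close> in one statement: for
  equal \<open>\<pi>\<close> and trivial \<open>\<chi>\<close>, the inflated cocycle below is just
  the quotient of the two choices of \<open>\<zeta>\<close>.\<close>

lemma mod_im_inf_c\<pi>_cong:
  assumes \<pi>: "\<pi> \<in> Z1_dual" and \<zeta>: "\<zeta> \<in> admissible_\<zeta> \<pi>"
    and \<pi>': "\<pi>' \<in> Z1_dual" and \<zeta>': "\<zeta>' \<in> admissible_\<zeta> \<pi>'"
    and "class1 \<pi> = class1 \<pi>'"
  shows "mod_im_inf (class2 (c\<pi> \<pi> \<zeta>)) = mod_im_inf (class2 (c\<pi> \<pi>' \<zeta>'))"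
proof -
  obtain \<chi> where \<chi>: "\<chi> \<in> carrier (dual A)"
    and "\<And>g a. g \<in> carrier Q \<Longrightarrow> a \<in> carrier A \<Longrightarrow>
      \<pi> [g] a * \<chi> a = \<chi> (act (inv\<^bsub>Q\<^esub> g) a) * \<pi>' [g] a"
    using assms(5) by (auto simp: class1_eq_iff[OF \<pi> \<pi>'])
  then have \<pi>_eq: "\<pi> [g] (act g a) * \<chi> (act g a) = \<chi> a * \<pi>' [g] (act g a)"
    if "g \<in> carrier Q" "a \<in> carrier A" for g a
    using that by simp
  have nz: "\<chi> a \<noteq> 0" if "a \<in> carrier A" for a
    using \<chi> that by (simp add: dual_carrier_iff)
  have \<chi>_mult: "\<chi> (a \<otimes>\<^bsub>A\<^esub> a') = \<chi> a * \<chi> a'" if "a \<in> carrier A" "a' \<in> carrier A" for a a'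
    using \<chi> that by (simp add: dual_carrier_iff)
  have \<zeta>_nz: "\<zeta> [g, h] \<noteq> 0" "\<zeta>' [g, h] \<noteq> 0" if "g \<in> carrier Q" "h \<in> carrier Q" for g h
    using cochain_nz[OF admissible_\<zeta>_cochain[OF \<zeta>]] cochain_nz[OF admissible_\<zeta>_cochain[OF \<zeta>']] that
    by simp_all
  \<comment> \<open>By \<open>A_part_mult\<close>, the coboundary of
    \<open>inverse (\<chi> (A_part x))\<close> contributes \<open>\<chi> (\<beta> xs)\<close>
    besides the action term. Dividing by it makes \<open>w\<close> a cocycle on \<open>Q\<close>,
    although the quotient of \<open>\<zeta>\<close> by \<open>\<zeta>'\<close> alone need not be
    one.\<close>
  define w where "w = (\<lambda>xs \<in> tuples 2 Q. \<zeta> xs / (\<zeta>' xs * \<chi> (\<beta> xs)))"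
  have w_apply: "w [g, h] = \<zeta> [g, h] / (\<zeta>' [g, h] * \<chi> (\<beta> [g, h]))"
    if "g \<in> carrier Q" "h \<in> carrier Q" for g h
    using that by (simp add: w_def)
  have w: "w \<in> Z2_Q"
    unfolding cocycles_2_Cstar_iff[OF Q.is_group]
  proof (intro conjI ballI)
    show "w \<in> carrier (cochains 2 Q Cstar)"
      unfolding w_def by (rule restrict_cochain) (auto elim!: tuples_2E simp: \<zeta>_nz nz)
    fix g h k assume ghk: "g \<in> carrier Q" "h \<in> carrier Q" "k \<in> carrier Q"
    have "\<zeta> [h, k] * \<zeta> [g, h \<otimes>\<^bsub>Q\<^esub> k] =
        \<pi> [g] (act g (\<beta> [h, k])) * \<zeta> [g \<otimes>\<^bsub>Q\<^esub> h, k] * \<zeta> [g, h]"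
      "\<zeta>' [h, k] * \<zeta>' [g, h \<otimes>\<^bsub>Q\<^esub> k] =
        \<pi>' [g] (act g (\<beta> [h, k])) * \<zeta>' [g \<otimes>\<^bsub>Q\<^esub> h, k] * \<zeta>' [g, h]"
      using \<zeta> \<zeta>' ghk by (simp_all add: admissible_\<zeta>_iff \<pi> \<pi>')
    moreover have "\<chi> (act g (\<beta> [h, k])) * \<chi> (\<beta> [g, h \<otimes>\<^bsub>Q\<^esub> k]) =
        \<chi> (\<beta> [g, h]) * \<chi> (\<beta> [g \<otimes>\<^bsub>Q\<^esub> h, k])"
      using \<beta>_cocycle_eq[OF ghk] ghk by (simp flip: \<chi>_mult)
    moreover have "\<pi> [g] (act g (\<beta> [h, k])) * \<chi> (act g (\<beta> [h, k])) =
        \<chi> (\<beta> [h, k]) * \<pi>' [g] (act g (\<beta> [h, k]))"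
      using ghk by (simp add: \<pi>_eq)
    ultimately have "(\<zeta> [h, k] * \<zeta> [g, h \<otimes>\<^bsub>Q\<^esub> k]) * ((\<zeta>' [g \<otimes>\<^bsub>Q\<^esub> h, k] * \<chi> (\<beta> [g \<otimes>\<^bsub>Q\<^esub> h, k])) *
          (\<zeta>' [g, h] * \<chi> (\<beta> [g, h]))) =
        (\<zeta> [g \<otimes>\<^bsub>Q\<^esub> h, k] * \<zeta> [g, h]) * ((\<zeta>' [h, k] * \<chi> (\<beta> [h, k])) *
          (\<zeta>' [g, h \<otimes>\<^bsub>Q\<^esub> k] * \<chi> (\<beta> [g, h \<otimes>\<^bsub>Q\<^esub> k])))"
      by algebra
    then show "w [h, k] * w [g, h \<otimes>\<^bsub>Q\<^esub> k] = w [g \<otimes>\<^bsub>Q\<^esub> h, k] * w [g, h]"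
      using ghk by (simp add: w_apply \<zeta>_nz nz frac_eq_eq)
  qed
  show ?thesis
    unfolding mod_im_inf_eq_iff[OF c\<pi>_in_Z2_G[OF \<pi> \<zeta>] c\<pi>_ker_res[OF \<pi> \<zeta>]
        c\<pi>_in_Z2_G[OF \<pi>' \<zeta>'] c\<pi>_ker_res[OF \<pi>' \<zeta>']]
  proof (intro bexI[OF _ w] exI[of _ "\<lambda>x. inverse (\<chi> (A_part x))"] conjI ballI)
    show "inverse (\<chi> (A_part x)) \<noteq> 0" if "x \<in> carrier G" for x
      using that by (simp add: nz)
    fix x y assume xy: "x \<in> carrier G" "y \<in> carrier G"
    \<comment> \<open>Here \<open>F\<close> and \<open>F'\<close> are the values of
      \<open>\<pi>\<close> and \<open>\<pi>'\<close>; \<open>a\<close>, \<open>X\<close>,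
      \<open>Xu\<close> and \<open>b\<close> are the values of \<open>\<chi>\<close> at the
      \<open>A\<close>-part of \<open>x\<close>, the \<open>A\<close>-part of \<open>y\<close>, its
      translate by \<open>p x\<close>, and \<open>\<beta>\<close>.\<close>
    have aux: "inverse F * Z * inverse (a * Xu * b) = inverse a * inverse X * (Z / (Z' * b) * (inverse F' * Z'))"
      if "F * Xu = X * F'" "F \<noteq> 0" "F' \<noteq> 0" "Xu \<noteq> 0" "X \<noteq> 0" "Z' \<noteq> 0"
      for F F' Z Z' a b X Xu :: complex
    proof -
      have "inverse F * inverse Xu = inverse X * inverse F'"
        using that(1) by (metis inverse_mult_distrib)
      then show ?thesis
        using that by (simp add: divide_inverse)
    qed
    show "c\<pi> \<pi> \<zeta> [x, y] * inverse (\<chi> (A_part (x \<otimes>\<^bsub>G\<^esub> y))) =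
        inverse (\<chi> (A_part x)) * inverse (\<chi> (A_part y)) * (w [p x, p y] * c\<pi> \<pi>' \<zeta>' [x, y])"
      using xy by (simp only: c\<pi>_apply w_apply A_part_mult \<chi>_mult p_closed act_closed A_part_closed
          \<beta>_closed A.m_closed)
        (rule aux, use \<pi>_eq Z1_dual_nz \<pi> \<pi>' nz \<zeta>_nz in simp_all)
  qed
qed

lemma C_map_eq:
  assumes \<pi>: "\<pi> \<in> Z1_dual" and \<zeta>: "\<zeta> \<in> admissible_\<zeta> \<pi>"
  shows "C_map (class1 \<pi>) = mod_im_inf (class2 (c\<pi> \<pi> \<zeta>))"
proof -
  have "{mod_im_inf (class2 (c\<pi> \<pi>' \<zeta>')) | \<pi>' \<zeta>'.
      \<pi>' \<in> Z1_dual \<and> class1 \<pi>' = class1 \<pi> \<and> \<zeta>' \<in> admissible_\<zeta> \<pi>'} = {mod_im_inf (class2 (c\<pi> \<pi> \<zeta>))}"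
    using mod_im_inf_c\<pi>_cong[OF _ _ \<pi> \<zeta>] \<pi> \<zeta> by blast
  then show ?thesis by (simp add: C_map_def)
qed

lemma C_map_well_defined: C_map_well_defined
  unfolding C_map_well_defined_def
  using class1_in_K\<beta>_iff c\<pi>_in_Z2_G c\<pi>_ker_res C_map_eq by blast

lemma c\<pi>_mult:
  "c\<pi> (\<pi> \<otimes>\<^bsub>cochains 1 Q (dual A)\<^esub> \<pi>') (\<zeta> \<otimes>\<^bsub>cochains 2 Q Cstar\<^esub> \<zeta>') =
    c\<pi> \<pi> \<zeta> \<otimes>\<^bsub>cochains 2 G Cstar\<^esub> c\<pi> \<pi>' \<zeta>'"
  unfolding c\<pi>_def mult_cochains[of 2 G]
  by (rule restrict_ext) (auto elim!: tuples_2E simp: mult_cochains dual_mult)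

text \<open>A product of admissible choices is an admissible choice for the product, and
  \<open>c\<pi>\<close> is multiplicative in the pair of \<open>\<pi>\<close> and
  \<open>\<zeta>\<close>.\<close>

lemma group_hom_C_map: "group_hom K\<beta> ker_res_mod_im_inf C_map"
proof -
  have "C_map \<in> hom K\<beta> ker_res_mod_im_inf"
  proof (rule homI)
    fix U assume "U \<in> carrier K\<beta>"
    then obtain \<pi> \<zeta> where \<pi>: "\<pi> \<in> Z1_dual" "\<zeta> \<in> admissible_\<zeta> \<pi>" and U: "U = class1 \<pi>"
      by (auto simp: carrier_K\<beta>)
    then show "C_map U \<in> carrier ker_res_mod_im_inf"
      by (simp add: C_map_eq carrier_ker_res_mod_im_inf c\<pi>_ker_res)
    fix V assume "V \<in> carrier K\<beta>"
    then obtain \<pi>' \<zeta>' where \<pi>': "\<pi>' \<in> Z1_dual" "\<zeta>' \<in> admissible_\<zeta> \<pi>'" and V: "V = class1 \<pi>'"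
      by (auto simp: carrier_K\<beta>)
    have "U \<otimes>\<^bsub>K\<beta>\<^esub> V = class1 (\<pi> \<otimes>\<^bsub>cochains 1 Q (dual A)\<^esub> \<pi>')"
      unfolding U V class1_mult[OF \<pi>(1) \<pi>'(1)] by (simp add: K\<beta>_def)
    then have "C_map (U \<otimes>\<^bsub>K\<beta>\<^esub> V) = mod_im_inf (class2 (c\<pi> \<pi> \<zeta> \<otimes>\<^bsub>cochains 2 G Cstar\<^esub> c\<pi> \<pi>' \<zeta>'))"
      using C_map_eq[OF Z1_dual_mult_closed[OF \<pi>(1) \<pi>'(1)] admissible_\<zeta>_mult[OF \<pi>(1) \<pi>'(1) \<pi>(2) \<pi>'(2)]]
      by (simp only: c\<pi>_mult)
    also have "\<dots> = C_map U \<otimes>\<^bsub>ker_res_mod_im_inf\<^esub> C_map V"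
      using \<pi> \<pi>' by (simp add: U V C_map_eq class2_mult c\<pi>_in_Z2_G mod_im_inf_mult c\<pi>_ker_res)
    finally show "C_map (U \<otimes>\<^bsub>K\<beta>\<^esub> V) = C_map U \<otimes>\<^bsub>ker_res_mod_im_inf\<^esub> C_map V" .
  qed
  then show ?thesis
    using comm_group_K\<beta> comm_group_ker_res_mod_im_inf
    by (simp add: group_hom_def group_hom_axioms_def comm_group_def)
qed

section \<open>The map \<open>\<Pi>\<close>\<close>

text \<open>Changes the representative within its class by a prescribed coboundary; used twice to
  reach an \<open>A\<close>-normalized cocycle.\<close>

lemma twist_by_coboundary:
  assumes c: "c \<in> Z2_G" and nz: "\<And>x. x \<in> carrier G \<Longrightarrow> h x \<noteq> 0"
  obtains d where "d \<in> Z2_G" "class2 d = class2 c"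
    and "\<And>x y. x \<in> carrier G \<Longrightarrow> y \<in> carrier G \<Longrightarrow> d [x, y] * h (x \<otimes>\<^bsub>G\<^esub> y) = h x * h y * c [x, y]"
proof -
  define d where "d = (\<lambda>xs \<in> tuples 2 G. h (xs ! 0) * h (xs ! 1) * c xs / h (xs ! 0 \<otimes>\<^bsub>G\<^esub> xs ! 1))"
  have d_apply: "d [x, y] = h x * h y * c [x, y] / h (x \<otimes>\<^bsub>G\<^esub> y)"
    if "x \<in> carrier G" "y \<in> carrier G" for x y
    using that by (simp add: d_def)
  have d: "d \<in> Z2_G"
    unfolding Z2_G_iff
  proof (intro conjI ballI)
    show "d \<in> carrier (cochains 2 G Cstar)"
      unfolding d_def by (rule restrict_cochain) (auto elim!: tuples_2E simp: nz Z2_G_nz[OF c])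
    fix x y z assume xyz: "x \<in> carrier G" "y \<in> carrier G" "z \<in> carrier G"
    have [simp]: "h (x \<otimes>\<^bsub>G\<^esub> y) \<noteq> 0" "h (y \<otimes>\<^bsub>G\<^esub> z) \<noteq> 0" "h (x \<otimes>\<^bsub>G\<^esub> (y \<otimes>\<^bsub>G\<^esub> z)) \<noteq> 0"
      using xyz nz by simp_all
    have "d [y, z] * d [x, y \<otimes>\<^bsub>G\<^esub> z] =
        h x * h y * h z * (c [y, z] * c [x, y \<otimes>\<^bsub>G\<^esub> z]) / h (x \<otimes>\<^bsub>G\<^esub> (y \<otimes>\<^bsub>G\<^esub> z))"
      using xyz by (simp add: d_apply)
    also have "\<dots> = h x * h y * h z * (c [x \<otimes>\<^bsub>G\<^esub> y, z] * c [x, y]) / h (x \<otimes>\<^bsub>G\<^esub> (y \<otimes>\<^bsub>G\<^esub> z))"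
      using Z2_G_eq[OF c xyz] by simp
    also have "\<dots> = d [x \<otimes>\<^bsub>G\<^esub> y, z] * d [x, y]"
      using xyz by (simp add: d_apply G.m_assoc)
    finally show "d [y, z] * d [x, y \<otimes>\<^bsub>G\<^esub> z] = d [x \<otimes>\<^bsub>G\<^esub> y, z] * d [x, y]" .
  qed
  have eq: "d [x, y] * h (x \<otimes>\<^bsub>G\<^esub> y) = h x * h y * c [x, y]" if "x \<in> carrier G" "y \<in> carrier G" for x y
    using that nz[of "x \<otimes>\<^bsub>G\<^esub> y"] by (simp add: d_apply)
  then have "class2 d = class2 c"
    unfolding class2_eq_iff[OF d c] using nz by blast
  with d show thesis by (rule that) (rule eq)
qed

text \<open>In terms of the central extension of \<open>G\<close> by the nonzero complex numbers that a cocycle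
  defines, the two twists first choose a splitting over \<open>A\<close> and then the lift of \<open>\<iota> a \<otimes> s g\<close> to be
  the product of the lifts of \<open>\<iota> a\<close> and \<open>s g\<close>.\<close>

lemma A_normalized_representative:
  assumes "U \<in> ker_res"
  obtains c where "c \<in> A_normalized" "class2 c = U"
proof -
  obtain c where c: "c \<in> Z2_G" and U: "U = class2 c"
    using assms by (rule ker_resE)
  from assms obtain \<eta> where \<eta>_nz: "\<And>a. a \<in> carrier A \<Longrightarrow> \<eta> a \<noteq> 0"
    and \<eta>: "\<And>a b. a \<in> carrier A \<Longrightarrow> b \<in> carrier A \<Longrightarrow> c [\<iota> a, \<iota> b] * \<eta> (a \<otimes>\<^bsub>A\<^esub> b) = \<eta> a * \<eta> b"
    unfolding U class2_in_ker_res_iff[OF c] by blast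
  obtain c1 where c1: "c1 \<in> Z2_G" "class2 c1 = class2 c"
    and c1_eq: "\<And>x y. x \<in> carrier G \<Longrightarrow> y \<in> carrier G \<Longrightarrow>
      c1 [x, y] * inverse (\<eta> (A_part (x \<otimes>\<^bsub>G\<^esub> y))) =
      inverse (\<eta> (A_part x)) * inverse (\<eta> (A_part y)) * c [x, y]"
    \<comment> \<open>\<open>\<eta>\<close> trivializes \<open>c\<close> on \<open>A\<close>.
      Extending its inverse to \<open>G\<close> through \<open>A_part\<close> keeps it unchanged on
      \<open>A\<close>, so the twist is trivial on pairs from \<open>A\<close>.\<close>
    by (rule twist_by_coboundary[OF c, of "\<lambda>x. inverse (\<eta> (A_part x))"]) (auto simp: \<eta>_nz)
  have c1_A: "c1 [\<iota> a, \<iota> b] = 1" if "a \<in> carrier A" "b \<in> carrier A" for a b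
  proof -
    have "\<eta> a \<noteq> 0" "\<eta> b \<noteq> 0" "\<eta> (a \<otimes>\<^bsub>A\<^esub> b) \<noteq> 0"
      using that \<eta>_nz by simp_all
    moreover have "c1 [\<iota> a, \<iota> b] * inverse (\<eta> (a \<otimes>\<^bsub>A\<^esub> b)) = inverse (\<eta> a) * inverse (\<eta> b) * c [\<iota> a, \<iota> b]"
      using c1_eq[of "\<iota> a" "\<iota> b"] that by (simp flip: \<iota>_mult)
    ultimately show ?thesis
      using \<eta>[OF that] by (simp add: field_simps)
  qed
  \<comment> \<open>In the central extension, \<open>k x\<close> compares the product of the lifts
    of \<open>\<iota> (A_part x)\<close> and \<open>s (p x)\<close> with the lift of
    \<open>x\<close>; twisting by it makes the new lift of \<open>x\<close> that product.\<close>
  define k where "k x = c1 [\<iota> (A_part x), s (p x)]" for x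
  have k_nz: "k x \<noteq> 0" if "x \<in> carrier G" for x
    using that by (simp add: k_def Z2_G_nz[OF c1(1)])
  obtain c2 where c2: "c2 \<in> Z2_G" "class2 c2 = class2 c1"
    and c2_eq: "\<And>x y. x \<in> carrier G \<Longrightarrow> y \<in> carrier G \<Longrightarrow>
      c2 [x, y] * k (x \<otimes>\<^bsub>G\<^esub> y) = k x * k y * c1 [x, y]"
    by (rule twist_by_coboundary[OF c1(1), of k]) (auto simp: k_nz)
  have c2_A: "c2 [\<iota> a, x] = 1" if a: "a \<in> carrier A" and x: "x \<in> carrier G" for a x
  proof -
    have "k (\<iota> a) = 1"
      using c1_A[of a "\<one>\<^bsub>A\<^esub>"] a by (simp add: k_def)
    moreover have "k (\<iota> a \<otimes>\<^bsub>G\<^esub> x) = k x * c1 [\<iota> a, x]"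
      using Z2_G_eq[OF c1(1), of "\<iota> a" "\<iota> (A_part x)" "s (p x)"] c1_A[of a "A_part x"] a x
      by (simp add: k_def A_part_\<iota>_mult \<iota>_mult A_part_decomp)
    ultimately show ?thesis
      using c2_eq[of "\<iota> a" x] a x k_nz[of "\<iota> a \<otimes>\<^bsub>G\<^esub> x"] by simp
  qed
  \<comment> \<open>In the cocycle identity at \<open>(\<iota> a, x, y)\<close> the two factors with
    first argument \<open>\<iota> a\<close> are 1, and invariance is what remains.\<close>
  have "c2 [\<iota> a \<otimes>\<^bsub>G\<^esub> x, y] = c2 [x, y]" if "a \<in> carrier A" "x \<in> carrier G" "y \<in> carrier G" for a x y
    using Z2_G_eq[OF c2(1), of "\<iota> a" x y] that by (simp add: c2_A)
  moreover have "c2 [\<one>\<^bsub>G\<^esub>, \<one>\<^bsub>G\<^esub>] = 1"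
    using c2_A[of "\<one>\<^bsub>A\<^esub>" "\<one>\<^bsub>G\<^esub>"] by simp
  ultimately show thesis
    using that[of c2] c2 c1(2) by (simp add: A_normalized_def U)
qed

section \<open>From a normalized cocycle to a crossed homomorphism\<close>

lemma \<pi>c_apply: "g \<in> carrier Q \<Longrightarrow> a \<in> carrier A \<Longrightarrow> \<pi>c c [g] a = c [s (inv\<^bsub>Q\<^esub> g), \<iota> a]"
  by (simp add: \<pi>c_def)

context
  fixes c assumes c: "c \<in> A_normalized"
begin

lemma A_normalized_Z2_G: "c \<in> Z2_G"
  using c by (simp add: A_normalized_def)

lemma A_normalized_left:
  "a \<in> carrier A \<Longrightarrow> x \<in> carrier G \<Longrightarrow> y \<in> carrier G \<Longrightarrow> c [\<iota> a \<otimes>\<^bsub>G\<^esub> x, y] = c [x, y]"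
  using c by (simp add: A_normalized_def)

lemma A_normalized_p:
  assumes "x \<in> carrier G" "y \<in> carrier G"
  shows "c [s (p x), y] = c [x, y]"
  using assms A_normalized_left[of "A_part x" "s (p x)" y] by (simp add: A_part_decomp)

lemma A_normalized_one: "x \<in> carrier G \<Longrightarrow> c [x, \<one>\<^bsub>G\<^esub>] = 1" "x \<in> carrier G \<Longrightarrow> c [\<one>\<^bsub>G\<^esub>, x] = 1"
  using c cocycle_2_Cstar_one[OF G.is_group A_normalized_Z2_G[unfolded Z2_G_def], of x]
  by (simp_all add: A_normalized_def)

lemma A_normalized_\<iota>: "a \<in> carrier A \<Longrightarrow> x \<in> carrier G \<Longrightarrow> c [\<iota> a, x] = 1"
  using A_normalized_left[of a "\<one>\<^bsub>G\<^esub>" x] by (simp add: A_normalized_one)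

text \<open>Invariance is available in the first argument only. In the cocycle identity at
  \<open>(x, \<iota> a, y)\<close> the element \<open>\<iota> a\<close> is conjugated across
  \<open>x\<close> to the left, where it disappears. For \<open>y\<close> in \<open>A\<close> this
  shows that \<open>c [x, \<iota> a]\<close> is a character in \<open>a\<close>.\<close>

lemma A_normalized_right:
  assumes "a \<in> carrier A" "x \<in> carrier G" "y \<in> carrier G"
  shows "c [x, \<iota> a \<otimes>\<^bsub>G\<^esub> y] = c [x, \<iota> a] * c [x, y]"
  using Z2_G_eq[OF A_normalized_Z2_G, of x "\<iota> a" y] assms
    A_normalized_left[of "act (p x) a" x y]
  by (simp add: A_normalized_\<iota> \<iota>_act_commute)

text \<open>The cocycle identity at \<open>(x, y, \<iota> a)\<close>, with
  \<open>y \<otimes> \<iota> a\<close> rewritten so that its \<open>A\<close>-factor comes first and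
  splits off. The order of the factors is opposite to that of a crossed homomorphism, which the
  inverse in \<open>\<pi>c\<close> corrects.\<close>

lemma A_normalized_mult_\<iota>:
  assumes "a \<in> carrier A" "x \<in> carrier G" "y \<in> carrier G"
  shows "c [x \<otimes>\<^bsub>G\<^esub> y, \<iota> a] = c [y, \<iota> a] * c [x, \<iota> (act (p y) a)]"
proof -
  have "c [y, \<iota> a] * (c [x, \<iota> (act (p y) a)] * c [x, y]) = c [x \<otimes>\<^bsub>G\<^esub> y, \<iota> a] * c [x, y]"
    using Z2_G_eq[OF A_normalized_Z2_G, of x y "\<iota> a"] assms
      A_normalized_right[of "act (p y) a" x y]
    by (simp add: \<iota>_act_commute)
  then show ?thesis
    using assms Z2_G_nz[OF A_normalized_Z2_G, of x y] by simp
qed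

lemma \<pi>c_in_Z1_dual: "\<pi>c c \<in> Z1_dual"
  unfolding Z1_dual_iff
proof (intro conjI ballI)
  have "(\<lambda>a \<in> carrier A. c [s (inv\<^bsub>Q\<^esub> g), \<iota> a]) \<in> carrier (dual A)" if "g \<in> carrier Q" for g
    using that
    by (simp add: dual_carrier_iff Z2_G_nz[OF A_normalized_Z2_G] \<iota>_mult A_normalized_right)
  then show "\<pi>c c \<in> carrier (cochains 1 Q (dual A))"
    by (auto simp: carrier_cochains \<pi>c_def elim!: tuples_1E)
  fix g h a assume *: "g \<in> carrier Q" "h \<in> carrier Q" "a \<in> carrier A"
  \<comment> \<open>\<open>s\<close> is not multiplicative, but both sides use elements of
    \<open>G\<close> over the same element of \<open>Q\<close>, which the first argument of
    \<open>c\<close> cannot distinguish.\<close>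
  have "\<pi>c c [g \<otimes>\<^bsub>Q\<^esub> h] a = c [s (inv\<^bsub>Q\<^esub> h) \<otimes>\<^bsub>G\<^esub> s (inv\<^bsub>Q\<^esub> g), \<iota> a]"
    using * A_normalized_p[of "s (inv\<^bsub>Q\<^esub> h) \<otimes>\<^bsub>G\<^esub> s (inv\<^bsub>Q\<^esub> g)" "\<iota> a"]
    by (simp add: \<pi>c_apply Q.inv_mult_group)
  then show "\<pi>c c [g \<otimes>\<^bsub>Q\<^esub> h] a = \<pi>c c [g] a * \<pi>c c [h] (act (inv\<^bsub>Q\<^esub> g) a)"
    using * by (simp add: \<pi>c_apply A_normalized_mult_\<iota>)
qed

lemma c\<pi>_\<pi>c:
  obtains \<zeta> where "\<zeta> \<in> admissible_\<zeta> (\<pi>c c)" "c\<pi> (\<pi>c c) \<zeta> = c"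
proof -
  define \<zeta> where "\<zeta> = (\<lambda>xs \<in> tuples 2 Q. c [s (xs ! 0), s (xs ! 1)])"
  have \<zeta>: "\<zeta> \<in> carrier (cochains 2 Q Cstar)"
    unfolding \<zeta>_def
    by (rule restrict_cochain) (auto elim!: tuples_2E simp: Z2_G_nz[OF A_normalized_Z2_G])
  have eq: "c\<pi> (\<pi>c c) \<zeta> = c"
  proof (rule cochain_eqI[OF c\<pi>_cochain[OF \<pi>c_in_Z1_dual \<zeta>] Z2_G_cochain[OF A_normalized_Z2_G]])
    fix xs assume "xs \<in> tuples 2 G"
    then obtain x y where xy: "x \<in> carrier G" "y \<in> carrier G" and xs: "xs = [x, y]"
      by (rule tuples_2E)
    have "c [s (p x), \<iota> (A_part y)] = inverse (\<pi>c c [p x] (act (p x) (A_part y)))"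
      using xy Z1_dual_inv[OF \<pi>c_in_Z1_dual, of "p x" "A_part y"] by (simp add: \<pi>c_apply)
    moreover have "c [x, y] = c [s (p x), \<iota> (A_part y) \<otimes>\<^bsub>G\<^esub> s (p y)]"
      using xy by (simp add: A_part_decomp A_normalized_p)
    ultimately show "c\<pi> (\<pi>c c) \<zeta> xs = c xs"
      using xy by (simp add: xs c\<pi>_apply \<zeta>_def A_normalized_right)
  qed
  \<comment> \<open>The cocycle criterion read backwards: \<open>c\<close> is a cocycle of the form
    \<open>c\<pi>\<close>, hence \<open>\<zeta>\<close> trivializes the cup product. This puts the
    class of \<open>\<pi>c c\<close> in \<open>K\<beta>\<close>.\<close>
  have "\<zeta> \<in> admissible_\<zeta> (\<pi>c c)"
    using c\<pi>_in_Z2_G_iff[OF \<pi>c_in_Z1_dual \<zeta>] A_normalized_Z2_G by (simp add: eq)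
  then show thesis
    using eq by (rule that)
qed

lemma class1_\<pi>c_in_K\<beta>: "class1 (\<pi>c c) \<in> carrier K\<beta>"
  unfolding class1_in_K\<beta>_iff[OF \<pi>c_in_Z1_dual] by (rule c\<pi>_\<pi>c) blast

lemma C_map_class1_\<pi>c: "C_map (class1 (\<pi>c c)) = mod_im_inf (class2 c)"
  by (rule c\<pi>_\<pi>c) (simp add: C_map_eq[OF \<pi>c_in_Z1_dual])

end

text \<open>The function \<open>h\<close> linking the two cocycles is, on \<open>A\<close> and up to
  a constant, a character: at \<open>(\<iota> a, x)\<close> both cocycles are 1, and
  \<open>h\<close> must turn products into products. That character links the two crossed
  homomorphisms.\<close>

lemma class1_\<pi>c_cong:
  assumes c: "c \<in> A_normalized" "class2 c \<in> ker_res" and d: "d \<in> A_normalized" "class2 d \<in> ker_res"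
    and "mod_im_inf (class2 c) = mod_im_inf (class2 d)"
  shows "class1 (\<pi>c c) = class1 (\<pi>c d)"
proof -
  from assms(5) obtain w h where w: "w \<in> Z2_Q" and h_nz: "\<And>x. x \<in> carrier G \<Longrightarrow> h x \<noteq> 0"
    and eq: "\<And>x y. x \<in> carrier G \<Longrightarrow> y \<in> carrier G \<Longrightarrow>
      c [x, y] * h (x \<otimes>\<^bsub>G\<^esub> y) = h x * h y * (w [p x, p y] * d [x, y])"
    unfolding mod_im_inf_eq_iff[OF A_normalized_Z2_G[OF c(1)] c(2) A_normalized_Z2_G[OF d(1)] d(2)]
    by blast
  define k where "k = w [\<one>\<^bsub>Q\<^esub>, \<one>\<^bsub>Q\<^esub>]"
  have w_one: "w [g, \<one>\<^bsub>Q\<^esub>] = k" "w [\<one>\<^bsub>Q\<^esub>, g] = k" if "g \<in> carrier Q" for g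
    using cocycle_2_Cstar_one[OF Q.is_group w that] by (simp_all add: k_def)
  have k_nz: "k \<noteq> 0"
    unfolding k_def using w
    by (intro cochain_nz[of w 2 Q]) (auto simp: cocycles_2_Cstar_iff[OF Q.is_group])
  \<comment> \<open>The inflated cocycle takes the value \<open>k\<close> whenever one entry is
    trivial, so \<open>h\<close> satisfies
    \<open>h (\<iota> a \<otimes> x) = k * h (\<iota> a) * h x\<close>; the factor \<open>k\<close>
    absorbs this defect.\<close>
  define \<chi> where "\<chi> = (\<lambda>a \<in> carrier A. h (\<iota> a) * k)"
  have h_mult: "h (\<iota> a \<otimes>\<^bsub>G\<^esub> x) = \<chi> a * h x" if "a \<in> carrier A" "x \<in> carrier G" for a x
    using that eq[of "\<iota> a" x]
    by (simp add: A_normalized_\<iota>[OF c(1)] A_normalized_\<iota>[OF d(1)] w_one \<chi>_def)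
  have \<chi>_nz: "\<chi> a \<noteq> 0" if "a \<in> carrier A" for a
    using that h_nz k_nz by (simp add: \<chi>_def)
  have "\<chi> \<in> carrier (dual A)"
    unfolding dual_carrier_iff
  proof (intro conjI ballI)
    show "\<chi> (a \<otimes>\<^bsub>A\<^esub> b) = \<chi> a * \<chi> b" if "a \<in> carrier A" "b \<in> carrier A" for a b
      using that h_mult[of a "\<iota> b"] by (simp add: \<chi>_def \<iota>_mult)
  qed (auto simp: \<chi>_nz, simp add: \<chi>_def)
  moreover have "\<pi>c d [g] a * \<chi> a = \<chi> (act (inv\<^bsub>Q\<^esub> g) a) * \<pi>c c [g] a"
    if ga: "g \<in> carrier Q" "a \<in> carrier A" for g a
  proof -
    let ?x = "s (inv\<^bsub>Q\<^esub> g)"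
    have "h (?x \<otimes>\<^bsub>G\<^esub> \<iota> a) = \<chi> (act (inv\<^bsub>Q\<^esub> g) a) * h ?x"
      \<comment> \<open>Moving \<open>\<iota> a\<close> to the left of \<open>?x\<close> brings the
        argument into the form to which multiplicativity of \<open>h\<close> applies.\<close>
      using h_mult[of "act (inv\<^bsub>Q\<^esub> g) a" ?x] \<iota>_act_commute[of ?x a] ga by simp
    then have "(c [?x, \<iota> a] * \<chi> (act (inv\<^bsub>Q\<^esub> g) a)) * h ?x = (d [?x, \<iota> a] * \<chi> a) * h ?x"
      using eq[of ?x "\<iota> a"] ga by (simp add: w_one \<chi>_def mult_ac)
    moreover have "h ?x \<noteq> 0"
      using ga h_nz by simp
    ultimately show ?thesis
      using ga by (simp add: \<pi>c_apply mult.commute)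
  qed
  ultimately have "class1 (\<pi>c d) = class1 (\<pi>c c)"
    unfolding class1_eq_iff[OF \<pi>c_in_Z1_dual[OF d(1)] \<pi>c_in_Z1_dual[OF c(1)]] by blast
  then show ?thesis ..
qed

lemma Pi_map_eq:
  assumes "c \<in> A_normalized" "class2 c \<in> ker_res"
  shows "Pi_map (mod_im_inf (class2 c)) = class1 (\<pi>c c)"
proof -
  have "{class1 (\<pi>c d) | d. d \<in> A_normalized \<and> class2 d \<in> ker_res \<and>
      mod_im_inf (class2 d) = mod_im_inf (class2 c)} = {class1 (\<pi>c c)}"
    using class1_\<pi>c_cong[OF _ _ assms] assms by blast
  then show ?thesis by (simp add: Pi_map_def)
qed

lemma Pi_map_well_defined: Pi_map_well_defined
  unfolding Pi_map_well_defined_def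
  using A_normalized_representative \<pi>c_in_Z1_dual class1_\<pi>c_in_K\<beta> Pi_map_eq by blast

section \<open>The two maps are mutually inverse\<close>

lemma C_map_Pi_map:
  assumes "V \<in> carrier ker_res_mod_im_inf"
  shows "Pi_map V \<in> carrier K\<beta>" "C_map (Pi_map V) = V"
proof -
  from assms obtain U where U: "U \<in> ker_res" "V = mod_im_inf U"
    by (auto simp: carrier_ker_res_mod_im_inf)
  from U(1) obtain c where "c \<in> A_normalized" "class2 c = U"
    by (rule A_normalized_representative)
  with U show "Pi_map V \<in> carrier K\<beta>" "C_map (Pi_map V) = V"
    using Pi_map_eq class1_\<pi>c_in_K\<beta> C_map_class1_\<pi>c by auto
qed

lemma Pi_map_C_map:
  assumes "U \<in> carrier K\<beta>"
  shows "Pi_map (C_map U) = U"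
proof -
  from assms obtain \<pi> \<zeta>0 where \<pi>: "\<pi> \<in> Z1_dual" and U: "U = class1 \<pi>" and "\<zeta>0 \<in> admissible_\<zeta> \<pi>"
    by (auto simp: carrier_K\<beta>)
  then have \<zeta>0: "\<zeta>0 \<in> carrier (cochains 2 Q Cstar)"
    "\<And>g h k. g \<in> carrier Q \<Longrightarrow> h \<in> carrier Q \<Longrightarrow> k \<in> carrier Q \<Longrightarrow>
      \<zeta>0 [h, k] * \<zeta>0 [g, h \<otimes>\<^bsub>Q\<^esub> k] = \<pi> [g] (act g (\<beta> [h, k])) * \<zeta>0 [g \<otimes>\<^bsub>Q\<^esub> h, k] * \<zeta>0 [g, h]"
    by (auto simp: admissible_\<zeta>_iff)
  \<comment> \<open>The normalization \<open>c [1, 1] = 1\<close> requires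
    \<open>\<zeta> [1, 1] = 1\<close>. Rescaling by a constant preserves admissibility, since both
    sides of its equation contain two values of the cochain.\<close>
  define \<zeta> where "\<zeta> = (\<lambda>xs \<in> tuples 2 Q. \<zeta>0 xs / \<zeta>0 [\<one>\<^bsub>Q\<^esub>, \<one>\<^bsub>Q\<^esub>])"
  have nz: "\<zeta>0 xs \<noteq> 0" if "xs \<in> tuples 2 Q" for xs
    using cochain_nz[OF \<zeta>0(1) that] .
  have \<zeta>: "\<zeta> \<in> admissible_\<zeta> \<pi>"
    unfolding admissible_\<zeta>_iff[OF \<pi>]
  proof (intro conjI ballI)
    show "\<zeta> \<in> carrier (cochains 2 Q Cstar)"
      unfolding \<zeta>_def by (rule restrict_cochain) (simp add: nz)
  qed (simp add: \<zeta>_def \<zeta>0(2))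
  let ?c = "c\<pi> \<pi> \<zeta>"
  have one: "?c [\<one>\<^bsub>G\<^esub>, \<one>\<^bsub>G\<^esub>] = 1"
    using nz A_part_s[of "\<one>\<^bsub>Q\<^esub>"] by (simp add: c\<pi>_apply Z1_dual_one[OF \<pi>] \<zeta>_def)
  \<comment> \<open>Invariance under \<open>A\<close> is automatic, because \<open>c\<pi>\<close>
    sees its first argument only through \<open>p\<close>.\<close>
  then have c: "?c \<in> A_normalized"
    using c\<pi>_in_Z2_G[OF \<pi> \<zeta>] by (simp add: A_normalized_def c\<pi>_apply)
  \<comment> \<open>\<open>\<pi>c\<close> evaluates the cocycle at second arguments
    \<open>\<iota> a\<close>, which lie over the identity of \<open>Q\<close>; the factor
    \<open>\<zeta>\<close> must be 1 there for \<open>\<pi>\<close> itself to be recovered rather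
    than a multiple.\<close>
  have \<zeta>_one: "\<zeta> [g, \<one>\<^bsub>Q\<^esub>] = 1" if g: "g \<in> carrier Q" for g
  proof -
    have "act g \<one>\<^bsub>A\<^esub> = \<one>\<^bsub>A\<^esub>"
      using g by (intro hom_one[of _ A A]) (auto simp: hom_def act_A_mult A.is_group)
    then show ?thesis
      using g A_normalized_one(1)[OF c, of "s g"] A_part_s[of "\<one>\<^bsub>Q\<^esub>"]
      by (simp add: c\<pi>_apply Z1_dual_one_A[OF \<pi>])
  qed
  have "\<pi>c ?c = \<pi>"
  proof (rule cochain_eqI[OF Z1_dual_cochain[OF \<pi>c_in_Z1_dual[OF c]] Z1_dual_cochain[OF \<pi>]])
    fix xs assume "xs \<in> tuples 1 Q"
    then obtain g where g: "g \<in> carrier Q" and xs: "xs = [g]"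
      by (auto elim: tuples_1E)
    have "\<pi>c ?c [g] \<in> extensional (carrier A)" "\<pi> [g] \<in> extensional (carrier A)"
      using Z1_dual_char[OF \<pi>c_in_Z1_dual[OF c] g] Z1_dual_char[OF \<pi> g] by (simp_all add: dual_carrier_iff)
    then show "\<pi>c ?c xs = \<pi> xs"
      unfolding xs
    proof (rule extensionalityI)
      fix a assume a: "a \<in> carrier A"
      show "\<pi>c ?c [g] a = \<pi> [g] a"
        using g a Z1_dual_inv[OF \<pi>, of "inv\<^bsub>Q\<^esub> g" a]
        by (simp add: \<pi>c_apply c\<pi>_apply \<zeta>_one)
    qed
  qed
  then show ?thesis
    using C_map_eq[OF \<pi> \<zeta>] Pi_map_eq[OF c c\<pi>_ker_res[OF \<pi> \<zeta>]] by (simp add: U)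
qed

lemma group_hom_Pi_map: "group_hom ker_res_mod_im_inf K\<beta> Pi_map"
proof -
  interpret C: group_hom K\<beta> ker_res_mod_im_inf C_map by (rule group_hom_C_map)
  have "Pi_map (V \<otimes>\<^bsub>ker_res_mod_im_inf\<^esub> W) = Pi_map V \<otimes>\<^bsub>K\<beta>\<^esub> Pi_map W"
    if "V \<in> carrier ker_res_mod_im_inf" "W \<in> carrier ker_res_mod_im_inf" for V W
  proof -
    have "V \<otimes>\<^bsub>ker_res_mod_im_inf\<^esub> W = C_map (Pi_map V \<otimes>\<^bsub>K\<beta>\<^esub> Pi_map W)"
      using that by (simp add: C_map_Pi_map)
    moreover have "Pi_map V \<otimes>\<^bsub>K\<beta>\<^esub> Pi_map W \<in> carrier K\<beta>"
      using that by (simp add: C_map_Pi_map)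
    ultimately show ?thesis
      by (simp only: Pi_map_C_map)
  qed
  then show ?thesis
    by (simp add: group_hom_def group_hom_axioms_def hom_def C_map_Pi_map C.G.is_group C.H.is_group)
qed

end

theorem proposition3p7:
  fixes A :: "'a monoid" and G :: "'g monoid" and Q :: "'q monoid"
    and \<iota> :: "'a \<Rightarrow> 'g" and p :: "'g \<Rightarrow> 'q" and s :: "'q \<Rightarrow> 'g"
  assumes "abelian_extension A G Q \<iota> p s"
  shows
    "abelian_extension.C_map_well_defined A G Q \<iota> p s \<and>
     abelian_extension.Pi_map_well_defined A G Q \<iota> p s \<and>
     group_hom (abelian_extension.K\<beta> A G Q \<iota> s)
       (abelian_extension.ker_res_mod_im_inf A G Q \<iota> p)
       (abelian_extension.C_map A G Q \<iota> p s) \<and>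
     group_hom (abelian_extension.ker_res_mod_im_inf A G Q \<iota> p)
       (abelian_extension.K\<beta> A G Q \<iota> s)
       (abelian_extension.Pi_map A G Q \<iota> p s) \<and>
     (\<forall>x \<in> carrier (abelian_extension.K\<beta> A G Q \<iota> s).
        abelian_extension.Pi_map A G Q \<iota> p s (abelian_extension.C_map A G Q \<iota> p s x) = x) \<and>
     (\<forall>y \<in> carrier (abelian_extension.ker_res_mod_im_inf A G Q \<iota> p).
        abelian_extension.C_map A G Q \<iota> p s (abelian_extension.Pi_map A G Q \<iota> p s y) = y)"
proof -
  interpret abelian_extension A G Q \<iota> p s by fact
  show ?thesis
    using C_map_well_defined Pi_map_well_defined group_hom_C_map group_hom_Pi_map
      Pi_map_C_map C_map_Pi_map(2) by blast
qed

end
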